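(* Let $0<\gamma<2$ and $0<\mu<1/4$. For every $\varepsilon>0$ let $u_j=u_j^\varepsilon,\ u_{j+1}=u_{j+1}^\varepsilon\in\mathcal A_\varepsilon$ be such that $u_{j+1}$ is a minimizer of $\mathcal F_\varepsilon^{\tau,\gamma}(\cdot,u_j)$, $I_j$ is a discrete octagon, the family $(I_j^\varepsilon)_\varepsilon$ satisfies assumption (H), $\partial^+I_j\subset Z_j$, and, with $C_\varepsilon:=\#Z_j^\varepsilon$, $\varepsilon^2C_\varepsilon\to0$ as $\varepsilon\to0$. Suppose that there exists $i\in\{1,\dots,4\}$ such that $D_{j,i}/\sqrt2\ge\max\{2\varepsilon\sqrt{C_\varepsilon},\varepsilon^\mu\}$. Then there exists $\bar\varepsilon>0$ such that for every $\varepsilon\le\bar\varepsilon$ the set $I_{j+1}$ is a (possibly degenerate) discrete octagon with the following properties: (i) $\mathbb O_{j+1}\subset\mathbb O_j$; in particular $\mathscr D_{j+1,i}\subset\mathscr D_{j,i}$ for every $i$ such that $D_{j+1,i}>0$. (ii) $\#\mathscr D_{j+1,i}=1$ for every $i$ such that $D_{j,i}=0$. (iii) There exists a constant $c$ depending only on $\bar c$ (the constant of (H)) and $\mu$ such that the displacements $\alpha_{j,i}$ of the parallel sides satisfy $$\alpha_{j,i}\begin{cases}=\left\lfloor\frac{2\zeta(1-k)}{P_{j,i}}\right\rfloor&\text{if }\operatorname{dist}\left(\frac{2\zeta(1-k)}{P_{j,i}},\mathbb N\right)\ge c\,\varepsilon,\\[4pt]\in\left\{\left[\frac{2\zeta(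1-k)}{P_{j,i}}\right],\left[\frac{2\zeta(1-k)}{P_{j,i}}\right]-1\right\}&\text{otherwise}.\end{cases}$$
   Context: Fix $k\in(1/3,1)$, $\zeta>0$; for $\varepsilon>0$ let $\tau=\zeta\varepsilon$. $\mathbb N=\{1,2,\dots\}$; $\lfloor x\rfloor$ is the floor and $[x]$ the closest integer to $x$; $e_1,e_2$ is the standard basis of $\mathbb R^2$. $\mathcal A_\varepsilon$ is the set of functions $u:\varepsilon\mathbb Z^2\to\{-1,0,1\}$ with $\#\{p:u(p)=0\}<\infty$. For $u\in\mathcal A_\varepsilon$, $$\mathcal E_\varepsilon(u)=\sum\varepsilon\big(1-u(p)u(q)-k(1-(u(p)u(q))^2)\big),$$ the sum being over unordered pairs $\{p,q\}\subset\varepsilon\mathbb Z^2$ with $|p-q|=\varepsilon$. Put $I_u=\{u=1\}$, $Z_u=\{u=0\}$, $I_s=I_{u_s}$, $Z_s=Z_{u_s}$ for $s=j,j+1$. $A_I=\bigcup_{p\in I}(p+\varepsilon[-1/2,1/2]^2)$; $\mathcal N(p)=\{p\pm\varepsilon e_1,p\pm\varepsilon e_2\}$. For $I\subset\varepsilon\mathbb Z^2$, $d_1^\varepsilon(p,\partial I)=\inf\{\|p-q\|_1:q\in I\}$ if $p\notin I$, and $=\inf\{\|p-q\|_1:q\in\varepsilon\mathbb Z^2\setminus I\}$ if $p\in I$. $\partial^+I=\{p\notin I:d_1^\varepsilon(p,\partial I)=\varepsilon\}$. For $u,w\in\mathcal A_\varepsilon$, $$\mathcal F_\varepsilon^{\tau,\gamma}(u,w)=\mathcal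 E_\varepsilon(u)+\frac1\tau\Big(\sum_{p\in I_u\triangle I_w}\varepsilon^2d_1^\varepsilon(p,\partial I_w)+\varepsilon^\gamma|\#Z_u-\#Z_w|\Big);$$ minimizers are taken over $\mathcal A_\varepsilon$. $\mathbb O_s=\{p\in\partial^+I_s:\#(\mathcal N(p)\cap I_s)=2\}$. A set is strongly connected if any two of its points are joined inside it by a finite path whose consecutive points have $\ell^1$-distance $\varepsilon$. A staircase set is a strongly connected set which is horizontally and vertically convex (if $p,\,p+n\varepsilon e_i\in I$, $n\in\mathbb N$, then all lattice points of the segment between them lie in $I$). Its external slices are $\mathscr P_1$ (lowest horizontal slice), $\mathscr P_2$ (leftmost vertical slice), $\mathscr P_3$ (highest horizontal slice), $\mathscr P_4$ (rightmost vertical slice). Assumption (H) for $(I_j^\varepsilon)_\varepsilon$: there exist constants $\bar R,\bar c>0$ such that every $I_j^\varepsilon$ is a staircase set with $\min_i\#\mathscr P_i^\varepsilon\ge\bar c/\varepsilon$, and all are contained in a ball of radius $\bar R$. Octagons: an octagon is a convex octagon in $\mathbb R^2$ with sides parallel to $e_1,e_2,e_1\pm e_2$ (sides of zero length allowed: degenerate case). A discrete octagon is $I=A\cap\varepsilon\mathbb Z^2$ with $A$ an octagon; it is a staircase set, with parallel sides the external slices $\mathscr P_1,\dots,\mathscr P_4$. Let $p^1,q^1$ be the left and right endpoints of $\mathscr P_1$, $p^2,q^2$ the lower and upper endpoints of $\mathscr P_2$, $p^3,q^3$ the left and right endpoints of $\mathscr P_3$, $p^4,q^4$ the lower and upper endpoints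 of $\mathscr P_4$. The diagonal sides $\mathscr D_1,\mathscr D_2,\mathscr D_3,\mathscr D_4$ are the discrete segments (sets of lattice points $p+s\varepsilon(e_1\pm e_2)$) joining $p^2$ to $p^1$, $q^2$ to $p^3$, $q^3$ to $q^4$, $q^1$ to $p^4$ respectively. $P_i$ and $D_i$ denote the lengths of the corresponding parallel and diagonal sides of the smallest octagon containing $A_I$ (so $\#\mathscr D_i=1$ iff $D_i=0$). A second index $s=j,j+1$ refers to $I_s$. $\varepsilon\alpha_{j,i}$ is the Euclidean distance between the parallel straight lines containing the $i$-th parallel sides of the smallest octagons containing $A_{I_j}$ and $A_{I_{j+1}}$. *)

theory Defs
  imports "HOL-Analysis.Analysis"
begin

type_synonym pt = "real \<times> real"

definition lattice :: "real \<Rightarrow> pt set" where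
  "lattice \<epsilon> = {(\<epsilon> * of_int m, \<epsilon> * of_int n) | m n :: int. True}"

definition l1_dist :: "pt \<Rightarrow> pt \<Rightarrow> real" where
  "l1_dist p q = \<bar>fst p - fst q\<bar> + \<bar>snd p - snd q\<bar>"

definition nbhd :: "real \<Rightarrow> pt \<Rightarrow> pt set" where
  "nbhd \<epsilon> p = {p + \<epsilon> *\<^sub>R (1, 0), p - \<epsilon> *\<^sub>R (1, 0), p + \<epsilon> *\<^sub>R (0, 1), p - \<epsilon> *\<^sub>R (0, 1)}"


section \<open>Spin configurations and the functional\<close>

text \<open>A spin function on the lattice is represented by a function on the whole plane; its values
  off the lattice are unconstrained and never used.\<close>

definition configs :: "real \<Rightarrow> (pt \<Rightarrow> real) set" where
  "configs \<epsilon> = {u \<in> lattice \<epsilon> \<rightarrow> {-1, 0, 1}. finite {p \<in> lattice \<epsilon>. u p = 0}}"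

definition phaseI :: "real \<Rightarrow> (pt \<Rightarrow> real) \<Rightarrow> pt set" where
  "phaseI \<epsilon> u = {p \<in> lattice \<epsilon>. u p = 1}"

definition phaseZ :: "real \<Rightarrow> (pt \<Rightarrow> real) \<Rightarrow> pt set" where
  "phaseZ \<epsilon> u = {p \<in> lattice \<epsilon>. u p = 0}"

definition bonds :: "real \<Rightarrow> pt set set" where
  "bonds \<epsilon> = {{p, q} | p q. p \<in> lattice \<epsilon> \<and> q \<in> lattice \<epsilon> \<and> dist p q = \<epsilon>}"

text \<open>The energy is extended-valued: finitely many zeros do not exclude infinitely many
  (+1,-1) bonds. For a bond \<open>e = {p, q}\<close> the product over \<open>e\<close> is \<open>u p * u q\<close>. For \<open>k < 1\<close> the
  summands \<open>0\<close>, \<open>\<epsilon> * (1 - k)\<close>, \<open>2 * \<epsilon>\<close> are nonnegative, so \<^const>\<open>ennreal\<close> does not truncate.\<close>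

definition energy :: "real \<Rightarrow> real \<Rightarrow> (pt \<Rightarrow> real) \<Rightarrow> ennreal" where
  "energy k \<epsilon> u =
     (\<Sum>\<^sub>\<infinity>e\<in>bonds \<epsilon>. ennreal (\<epsilon> * (1 - (\<Prod>p\<in>e. u p) - k * (1 - (\<Prod>p\<in>e. u p)\<^sup>2))))"

text \<open>Infima over the empty set are \<open>\<infinity>\<close>.\<close>

definition d1 :: "real \<Rightarrow> pt \<Rightarrow> pt set \<Rightarrow> ennreal" where
  "d1 \<epsilon> p I = (if p \<in> I then (INF q\<in>lattice \<epsilon> - I. ennreal (l1_dist p q))
                        else (INF q\<in>I. ennreal (l1_dist p q)))"

definition outer_boundary :: "real \<Rightarrow> pt set \<Rightarrow> pt set" where
  "outer_boundary \<epsilon> I = {p \<in> lattice \<epsilon> - I. d1 \<epsilon> p I = ennreal \<epsilon>}"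

definition functional ::
  "real \<Rightarrow> real \<Rightarrow> real \<Rightarrow> real \<Rightarrow> (pt \<Rightarrow> real) \<Rightarrow> (pt \<Rightarrow> real) \<Rightarrow> ennreal" where
  "functional k \<tau> \<gamma> \<epsilon> u w = energy k \<epsilon> u + ennreal (1 / \<tau>) *
     ((\<Sum>\<^sub>\<infinity>p\<in>sym_diff (phaseI \<epsilon> u) (phaseI \<epsilon> w). ennreal (\<epsilon>\<^sup>2) * d1 \<epsilon> p (phaseI \<epsilon> w))
      + ennreal (\<epsilon> powr \<gamma> * \<bar>real (card (phaseZ \<epsilon> u)) - real (card (phaseZ \<epsilon> w))\<bar>))"

definition minimizer ::
  "real \<Rightarrow> real \<Rightarrow> real \<Rightarrow> real \<Rightarrow> (pt \<Rightarrow> real) \<Rightarrow> (pt \<Rightarrow> real) \<Rightarrow> bool" where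
  "minimizer k \<tau> \<gamma> \<epsilon> w u \<longleftrightarrow>
     u \<in> configs \<epsilon> \<and> (\<forall>v\<in>configs \<epsilon>. functional k \<tau> \<gamma> \<epsilon> u w \<le> functional k \<tau> \<gamma> \<epsilon> v w)"

definition OO_set :: "real \<Rightarrow> pt set \<Rightarrow> pt set" where
  "OO_set \<epsilon> I = {p \<in> outer_boundary \<epsilon> I. card (nbhd \<epsilon> p \<inter> I) = 2}"


section \<open>Sides\<close>

text \<open>The side of a (discrete or continuous) set with outward normal \<open>\<nu>\<close>.\<close>

definition side :: "pt \<Rightarrow> pt set \<Rightarrow> pt set" where
  "side \<nu> S = {p \<in> S. \<forall>q\<in>S. q \<bullet> \<nu> \<le> p \<bullet> \<nu>}"

text \<open>Outward normals. Parallel sides 1, 2, 3, 4 are bottom, left, top, right; diagonal sides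
  1, 2, 3, 4 are south-west, north-west, north-east, south-east.\<close>

definition par_normal :: "nat \<Rightarrow> pt" where
  "par_normal i =
     (if i = 1 then (0, -1) else if i = 2 then (-1, 0) else if i = 3 then (0, 1) else (1, 0))"

definition diag_normal :: "nat \<Rightarrow> pt" where
  "diag_normal i =
     (if i = 1 then (-1, -1) else if i = 2 then (-1, 1) else if i = 3 then (1, 1) else (1, -1))"

definition slice :: "nat \<Rightarrow> pt set \<Rightarrow> pt set" where
  "slice i I = side (par_normal i) I"

text \<open>On a slice one of the two coordinates is constant, so these are its left/lower and
  right/upper endpoints, i.e. the points \<open>p\<^sup>i\<close> and \<open>q\<^sup>i\<close>.\<close>

definition first_pt :: "nat \<Rightarrow> pt set \<Rightarrow> pt" where
  "first_pt i I = (Min (fst ` slice i I), Min (snd ` slice i I))"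

definition last_pt :: "nat \<Rightarrow> pt set \<Rightarrow> pt" where
  "last_pt i I = (Max (fst ` slice i I), Max (snd ` slice i I))"

text \<open>For a discrete octagon the two endpoints differ by a multiple of \<open>\<epsilon> (e\<^sub>1 \<plusminus> e\<^sub>2)\<close>, so the lattice
  points on the segment between them are exactly the points of the discrete diagonal segment.\<close>

definition diag_side :: "real \<Rightarrow> nat \<Rightarrow> pt set \<Rightarrow> pt set" where
  "diag_side \<epsilon> i I = lattice \<epsilon> \<inter>
     (if i = 1 then closed_segment (first_pt 2 I) (first_pt 1 I)
      else if i = 2 then closed_segment (last_pt 2 I) (first_pt 3 I)
      else if i = 3 then closed_segment (last_pt 3 I) (last_pt 4 I)
      else closed_segment (last_pt 1 I) (first_pt 4 I))"


section \<open>Staircase sets and octagons\<close>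

definition strongly_connected :: "real \<Rightarrow> pt set \<Rightarrow> bool" where
  "strongly_connected \<epsilon> I \<longleftrightarrow>
     (\<forall>p\<in>I. \<forall>q\<in>I. (p, q) \<in> {(x, y). x \<in> I \<and> y \<in> I \<and> l1_dist x y = \<epsilon>}\<^sup>*)"

definition hv_convex :: "real \<Rightarrow> pt set \<Rightarrow> bool" where
  "hv_convex \<epsilon> I \<longleftrightarrow> (\<forall>e\<in>{(1, 0), (0, 1)}. \<forall>p\<in>I. \<forall>n::nat.
     p + (of_nat n * \<epsilon>) *\<^sub>R e \<in> I \<longrightarrow> closed_segment p (p + (of_nat n * \<epsilon>) *\<^sub>R e) \<inter> lattice \<epsilon> \<subseteq> I)"

definition staircase :: "real \<Rightarrow> pt set \<Rightarrow> bool" where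
  "staircase \<epsilon> I \<longleftrightarrow> I \<subseteq> lattice \<epsilon> \<and> strongly_connected \<epsilon> I \<and> hv_convex \<epsilon> I"

text \<open>Sides of zero length correspond to redundant inequalities.\<close>

definition octagon :: "pt set \<Rightarrow> bool" where
  "octagon A \<longleftrightarrow> interior A \<noteq> {} \<and> (\<exists>a1 b1 a2 b2 a3 b3 a4 b4.
     A = {(x, y). a1 \<le> x \<and> x \<le> b1 \<and> a2 \<le> y \<and> y \<le> b2 \<and>
                  a3 \<le> x + y \<and> x + y \<le> b3 \<and> a4 \<le> x - y \<and> x - y \<le> b4})"

text \<open>The staircase condition excludes the sets cut out by octagons so thin (along a diagonal)
  or so small that the intersection with the lattice is disconnected or empty.\<close>

definition discrete_octagon :: "real \<Rightarrow> pt set \<Rightarrow> bool" where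
  "discrete_octagon \<epsilon> I \<longleftrightarrow>
     I \<noteq> {} \<and> staircase \<epsilon> I \<and> (\<exists>A. octagon A \<and> I = A \<inter> lattice \<epsilon>)"

text \<open>The set \<open>A\<^sub>I\<close>.\<close>

definition cells :: "real \<Rightarrow> pt set \<Rightarrow> pt set" where
  "cells \<epsilon> I = (\<Union>p\<in>I. (\<lambda>x. p + \<epsilon> *\<^sub>R x) ` ({-1/2..1/2} \<times> {-1/2..1/2}))"

definition octagon_hull :: "pt set \<Rightarrow> pt set" where
  "octagon_hull S = \<Inter>{A. octagon A \<and> S \<subseteq> A}"

text \<open>The lengths \<open>P\<^sub>i\<close> and \<open>D\<^sub>i\<close>; a side is a segment or a point, so its length is its diameter.\<close>

definition par_length :: "real \<Rightarrow> nat \<Rightarrow> pt set \<Rightarrow> real" where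
  "par_length \<epsilon> i I = diameter (side (par_normal i) (octagon_hull (cells \<epsilon> I)))"

definition diag_length :: "real \<Rightarrow> nat \<Rightarrow> pt set \<Rightarrow> real" where
  "diag_length \<epsilon> i I = diameter (side (diag_normal i) (octagon_hull (cells \<epsilon> I)))"

text \<open>The straight line through the \<open>i\<close>-th parallel side; it keeps the direction of that side
  also when the side degenerates to a point.\<close>

definition par_line :: "real \<Rightarrow> nat \<Rightarrow> pt set \<Rightarrow> pt set" where
  "par_line \<epsilon> i I =
     {x. \<exists>y\<in>side (par_normal i) (octagon_hull (cells \<epsilon> I)). x \<bullet> par_normal i = y \<bullet> par_normal i}"

definition displacement :: "real \<Rightarrow> nat \<Rightarrow> pt set \<Rightarrow> pt set \<Rightarrow> real" where
  "displacement \<epsilon> i I J = setdist (par_line \<epsilon> i I) (par_line \<epsilon> i J) / \<epsilon>"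

text \<open>Assumption (H), with constants \<open>R\<close> and \<open>c\<close>, for a family indexed by \<open>\<epsilon> \<in> E\<close>; the ball is
  common to the whole family.\<close>

definition assumption_H :: "real set \<Rightarrow> (real \<Rightarrow> pt set) \<Rightarrow> real \<Rightarrow> real \<Rightarrow> bool" where
  "assumption_H E I R c \<longleftrightarrow> R > 0 \<and> c > 0 \<and>
     (\<forall>\<epsilon>\<in>E. staircase \<epsilon> (I \<epsilon>) \<and> (\<forall>i\<in>{1..4}. c / \<epsilon> \<le> real (card (slice i (I \<epsilon>))))) \<and>
     (\<exists>x. \<forall>\<epsilon>\<in>E. I \<epsilon> \<subseteq> ball x R)"

end

theory Submission
  imports Defs
begin

text \<open>In integer coordinates \<open>I\<^sub>j\<close> is a rectangle with four corners cut off along diagonals.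
  For a configuration with \<open>N\<close> zeros the energy is at least \<open>\<epsilon> (1 - k) / 2 * (4 N + Q)\<close>, where \<open>Q\<close> is
  a perimeter that counts both transitions \<open>-1, 0\<close> and \<open>0, 1\<close>; a total variation argument on
  columns and rows gives \<open>Q \<ge> 4 (|X| + |Y|) + 8\<close>, where \<open>X\<close> and \<open>Y\<close> are the sets of columns and rows
  met by the phase \<open>+1\<close>. Since the dissipation only decreases when points of \<open>I\<^sub>j\<close> are restored, a
  minimizer is of the form \<open>I\<^sub>j \<inter> X \<times> Y\<close>, where \<open>(X, Y)\<close> maximizes the total distance to the
  boundary minus \<open>\<lambda> (|X| + |Y|)\<close> with \<open>\<lambda> = 2 (1 - k) \<zeta> / \<epsilon>\<close>.

  The sum of the distances over a column is large for all columns at depth more than a constant, and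
  increases strictly with the depth for the others, so optimal sets \<open>X\<close> and \<open>Y\<close> are intervals:
  parallel sides move inwards and diagonal sides do not move. The column at depth \<open>m\<close>
  has sum \<open>m P / \<epsilon> + O(1)\<close>, and it is removed or kept according to the comparison of this sum
  with \<open>\<lambda>\<close>.

  The lower bound is attained when the surplus zeros fit outside a diagonal side but inside the
  bounding rectangle, where they do not change the perimeter of the union of the phases \<open>0\<close> and \<open>1\<close>;
  the hypothesis on the lengths \<open>D\<close> of the diagonal sides provides this room.\<close>

subsection \<open>Total variation of spin configurations\<close>

text \<open>The number of zeros is effectively frozen: a zero adds
  \<open>2 * (1 - k) * \<epsilon>\<close> to the energy bound, while changing their number by one is
  penalized by \<open>\<epsilon> powr \<gamma> / (\<zeta> * \<epsilon>)\<close>, which is at least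
  as large for small \<open>\<epsilon>\<close> because \<open>\<gamma> < 2\<close>. So every
  configuration can be compared with a competitor that has exactly as many zeros as the previous
  step.

  In units of \<open>\<epsilon>^2 / \<zeta>\<close> a kept row or column costs \<open>lam\<close>,
  and a lost point of the old phase costs its integer depth. Both \<open>lam\<close> and the slice
  lengths are of order \<open>1 / \<epsilon>\<close>, so a line deeper than a constant
  \<open>M\<close> outweighs its cost several times and only boundedly many layers are at stake. The
  column sums are then known up to O(M^2); relative to a slice length of at least
  \<open>cbar / \<epsilon>\<close> this is an error of order \<open>\<epsilon>\<close>, the origin
  of \<open>c\<close>.

  Optimal pairs need not be unique: at a tie two displacements are possible. Hence the shape is
  established for every optimal pair, and it is used twice, for the competitor and for the minimizer
  itself.\<close>

lemma tv_ge:
  fixes g :: "int \<Rightarrow> real"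
  assumes "l \<le> c"
  shows "\<bar>g c - g l\<bar> \<le> (\<Sum>x\<in>{l..<c}. \<bar>g x - g (x + 1)\<bar>)"
  using assms
proof (induction c rule: int_ge_induct)
  case (step i)
  have "{l..<i+1} = insert i {l..<i}" using step by auto
  then have "(\<Sum>x\<in>{l..<i+1}. \<bar>g x - g (x + 1)\<bar>) = \<bar>g i - g (i+1)\<bar> + (\<Sum>x\<in>{l..<i}. \<bar>g x - g (x + 1)\<bar>)"
    by simp
  then show ?case using step by linarith
qed simp

lemma tv_incr:
  fixes g :: "int \<Rightarrow> real"
  assumes "l \<le> c" "\<And>x. l \<le> x \<Longrightarrow> x < c \<Longrightarrow> g x \<le> g (x+1)"
  shows "(\<Sum>x\<in>{l..<c}. \<bar>g x - g (x + 1)\<bar>) = g c - g l"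
  using assms
proof (induction c rule: int_ge_induct)
  case (step i)
  have "{l..<i+1} = insert i {l..<i}" using step by auto
  then have "(\<Sum>x\<in>{l..<i+1}. \<bar>g x - g (x + 1)\<bar>) = \<bar>g i - g (i+1)\<bar> + (\<Sum>x\<in>{l..<i}. \<bar>g x - g (x + 1)\<bar>)"
    by simp
  moreover have "g i \<le> g (i+1)" using step by simp
  moreover have "(\<Sum>x\<in>{l..<i}. \<bar>g x - g (x + 1)\<bar>) = g i - g l" using step by simp
  ultimately show ?case by linarith
qed simp

lemma tv_split:
  fixes g :: "int \<Rightarrow> real"
  assumes "l \<le> c" "c \<le> r"
  shows "(\<Sum>x\<in>{l..<r}. \<bar>g x - g (x + 1)\<bar>) =
    (\<Sum>x\<in>{l..<c}. \<bar>g x - g (x + 1)\<bar>) + (\<Sum>x\<in>{c..<r}. \<bar>g x - g (x + 1)\<bar>)"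
proof -
  have "{l..<r} = {l..<c} \<union> {c..<r}" using assms by auto
  then show ?thesis by (simp add: sum.union_disjoint ivl_disj_int)
qed

text \<open>A function that starts and ends at \<open>-1\<close> has to climb to \<open>g c\<close>
  and come down again.\<close>

lemma tv_excursion:
  fixes g :: "int \<Rightarrow> real"
  assumes "g l = -1" "g r = -1" "l \<le> c" "c \<le> r"
  shows "2 * (g c + 1) \<le> (\<Sum>x\<in>{l..<r}. \<bar>g x - g (x + 1)\<bar>)"
proof -
  have "g c - g l \<le> (\<Sum>x\<in>{l..<c}. \<bar>g x - g (x + 1)\<bar>)"
    using abs_ge_self tv_ge[OF assms(3)] by (rule order_trans)
  moreover have "- (g r - g c) \<le> (\<Sum>x\<in>{c..<r}. \<bar>g x - g (x + 1)\<bar>)"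
    using abs_ge_minus_self tv_ge[OF assms(4)] by (rule order_trans)
  ultimately show ?thesis
    unfolding tv_split[OF assms(3,4), of g] using assms(1,2) by simp
qed

text \<open>The equality case of \<open>tv_excursion\<close>; the descending half is
  \<open>tv_incr\<close> for \<open>- g\<close>.\<close>

lemma tv_unimodal:
  fixes g :: "int \<Rightarrow> real"
  assumes "g l = -1" "g r = -1" "l \<le> c" "c \<le> r"
    and "\<And>x. l \<le> x \<Longrightarrow> x < c \<Longrightarrow> g x \<le> g (x+1)" "\<And>x. c \<le> x \<Longrightarrow> x < r \<Longrightarrow> g (x+1) \<le> g x"
  shows "(\<Sum>x\<in>{l..<r}. \<bar>g x - g (x + 1)\<bar>) = 2 * (g c + 1)"
proof -
  have "(\<Sum>x\<in>{c..<r}. \<bar>(- g x) - (- g (x + 1))\<bar>) = - g r - (- g c)"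
    by (rule tv_incr[of c r "\<lambda>x. - g x"]) (use assms in auto)
  moreover have "(\<Sum>x\<in>{c..<r}. \<bar>(- g x) - (- g (x + 1))\<bar>) = (\<Sum>x\<in>{c..<r}. \<bar>g x - g (x + 1)\<bar>)"
    by (rule sum.cong) auto
  ultimately show ?thesis
    using tv_incr[of l c g] tv_split[of l c r g] assms by simp
qed

text \<open>The intervals are open: the spins are still \<open>-1\<close> on the lines
  \<open>l\<close> and \<open>r\<close>, so lines enter and leave the box at \<open>-1\<close>, and
  every bond of nonzero cost starts (at its left or lower end) in
  \<open>{l..<r} \<times> {l..<r}\<close>.\<close>

definition spin_box :: "int \<Rightarrow> int \<Rightarrow> (int \<times> int \<Rightarrow> real) \<Rightarrow> bool" where
  "spin_box l r U \<longleftrightarrow> range U \<subseteq> {-1, 0, 1} \<and> {p. U p \<noteq> -1} \<subseteq> {l<..<r} \<times> {l<..<r}"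

definition clash :: "real \<Rightarrow> real \<Rightarrow> real" where
  "clash a b = (if a * b = -1 then 2 else 0)"

text \<open>Jumps are counted along the columns but clashes across them: a clash makes up for a
  missing layer of zeros beside an extreme column. The other half of both counts is the cost of
  \<open>U \<circ> prod.swap\<close>.\<close>

definition column_cost :: "int \<Rightarrow> int \<Rightarrow> (int \<times> int \<Rightarrow> real) \<Rightarrow> real" where
  "column_cost l r U =
     (\<Sum>x\<in>{l..<r}. \<Sum>y\<in>{l..<r}. \<bar>U (x, y) - U (x, y + 1)\<bar> + clash (U (x, y)) (U (x + 1, y)))"

lemma spin_box_cases: "spin_box l r U \<Longrightarrow> U p = -1 \<or> U p = 0 \<or> U p = 1"
  unfolding spin_box_def by auto

lemma spin_box_outside: "spin_box l r U \<Longrightarrow> p \<notin> {l<..<r} \<times> {l<..<r} \<Longrightarrow> U p = -1"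
  unfolding spin_box_def by auto

text \<open>A column that meets the phase 1 goes from -1 to 1 and back, which costs 4. The
  additional 4 come from just outside the two extreme columns: the neighbour of a point of phase 1
  is there either a zero, whose column then has variation at least 2, or a -1, which is a
  clash.\<close>

lemma column_cost_ge:
  assumes U: "spin_box l r U" and ne: "{p. U p = 1} \<noteq> {}"
  shows "4 * real (card (fst ` {p. U p = 1})) + 4 \<le> column_cost l r U"
proof -
  define J where "J = {p. U p = 1}"
  define X where "X = fst ` J"
  have J: "J \<subseteq> {l<..<r} \<times> {l<..<r}"
  proof
    fix p assume "p \<in> J"
    then have "U p \<noteq> -1" by (simp add: J_def)
    then show "p \<in> {l<..<r} \<times> {l<..<r}" using U unfolding spin_box_def by blast
  qed
  have finJ: "finite J" using J by (rule finite_subset) auto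
  have finX: "finite X" and neX: "X \<noteq> {}" using finJ ne by (auto simp: X_def J_def)
  have X: "X \<subseteq> {l<..<r}" using J by (auto simp: X_def)
  define tv where "tv x = (\<Sum>y\<in>{l..<r}. \<bar>U (x, y) - U (x, y + 1)\<bar>)" for x
  define h where "h x = (\<Sum>y\<in>{l..<r}. clash (U (x, y)) (U (x + 1, y)))" for x
  have tv0: "0 \<le> tv x" for x unfolding tv_def by (intro sum_nonneg) auto
  have h0: "0 \<le> h x" for x unfolding h_def by (intro sum_nonneg) (auto simp: clash_def)
  have tv: "2 * (U (x, y) + 1) \<le> tv x" if "l < y" "y < r" for x y
    unfolding tv_def using U that
    by (intro tv_excursion[of "\<lambda>y. U (x, y)"]) (auto intro: spin_box_outside)
  have tvX: "4 \<le> tv x" if "x \<in> X" for x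
  proof -
    from that obtain y where "U (x, y) = 1" "l < y" "y < r"
      using J by (auto simp: X_def J_def)
    then show ?thesis using tv[of y x] by simp
  qed
  have hbond: "2 \<le> h x" if "l < y" "y < r" "U (x, y) * U (x + 1, y) = -1" for x y
  proof -
    have "clash (U (x, y)) (U (x + 1, y)) \<le> h x"
      unfolding h_def using that by (intro member_le_sum) (auto simp: clash_def)
    then show ?thesis using that by (simp add: clash_def)
  qed
  define x0 where "x0 = Min X"
  define x1 where "x1 = Max X"
  have x0: "x0 \<in> X" "\<And>x. x \<in> X \<Longrightarrow> x0 \<le> x" and x1: "x1 \<in> X" "\<And>x. x \<in> X \<Longrightarrow> x \<le> x1"
    using finX neX by (auto simp: x0_def x1_def)
  have x01: "x0 \<le> x1" using x0 x1 by auto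
  have left: "2 \<le> tv (x0 - 1) + h (x0 - 1)"
  proof -
    obtain y where y: "U (x0, y) = 1" "l < y" "y < r" using x0 J by (auto simp: X_def J_def)
    have "x0 - 1 \<notin> X" using x0(2)[of "x0 - 1"] by auto
    then have "U (x0 - 1, y) \<noteq> 1" by (force simp: X_def J_def)
    then consider "U (x0 - 1, y) = 0" | "U (x0 - 1, y) = -1" using spin_box_cases[OF U] by blast
    then show ?thesis
    proof cases
      case 1 then show ?thesis using tv[of y "x0 - 1"] h0[of "x0 - 1"] y by simp
    next
      case 2 then show ?thesis using hbond[of y "x0 - 1"] tv0[of "x0 - 1"] y by simp
    qed
  qed
  have right: "2 \<le> tv (x1 + 1) + h x1"
  proof -
    obtain y where y: "U (x1, y) = 1" "l < y" "y < r" using x1 J by (auto simp: X_def J_def)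
    have "x1 + 1 \<notin> X" using x1(2)[of "x1 + 1"] by auto
    then have "U (x1 + 1, y) \<noteq> 1" by (force simp: X_def J_def)
    then consider "U (x1 + 1, y) = 0" | "U (x1 + 1, y) = -1" using spin_box_cases[OF U] by blast
    then show ?thesis
    proof cases
      case 1 then show ?thesis using tv[of y "x1 + 1"] h0[of x1] y by simp
    next
      case 2 then show ?thesis using hbond[of y x1] tv0[of "x1 + 1"] y by simp
    qed
  qed
  have xs: "l < x0" "x1 < r" using x0(1) x1(1) X by auto
  have tvr: "tv r = 0"
    unfolding tv_def using U by (intro sum.neutral) (auto simp: spin_box_outside[OF U])
  \<comment> \<open>The range is extended to \<open>r\<close> because \<open>x1 + 1\<close> may be
    equal to \<open>r\<close>; that column is constantly -1 and contributes nothing.\<close>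
  have "4 * real (card X) + tv (x0 - 1) + tv (x1 + 1) \<le> (\<Sum>x\<in>{l..<r+1}. tv x)"
  proof -
    have "4 * real (card X) \<le> (\<Sum>x\<in>X. tv x)"
      using sum_mono[of X "\<lambda>_. 4" tv] tvX by (simp add: mult.commute)
    moreover have "(\<Sum>x\<in>insert (x0 - 1) (insert (x1 + 1) X). tv x) = tv (x0 - 1) + (tv (x1 + 1) + (\<Sum>x\<in>X. tv x))"
    proof -
      have "x0 - 1 \<notin> X" "x1 + 1 \<notin> X" using x0(2)[of "x0 - 1"] x1(2)[of "x1 + 1"] by auto
      then show ?thesis using finX x01 by simp
    qed
    moreover have "(\<Sum>x\<in>insert (x0 - 1) (insert (x1 + 1) X). tv x) \<le> (\<Sum>x\<in>{l..<r+1}. tv x)"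
      using X xs x01 tv0 by (intro sum_mono2) auto
    ultimately show ?thesis by linarith
  qed
  moreover have "(\<Sum>x\<in>{l..<r+1}. tv x) = (\<Sum>x\<in>{l..<r}. tv x)"
  proof -
    have "{l..<r+1} = insert r {l..<r}" using xs x01 by auto
    then show ?thesis using tvr by simp
  qed
  moreover have "h (x0 - 1) + h x1 \<le> (\<Sum>x\<in>{l..<r}. h x)"
  proof -
    have "(\<Sum>x\<in>{x0 - 1, x1}. h x) \<le> (\<Sum>x\<in>{l..<r}. h x)"
      using xs x01 h0 by (intro sum_mono2) auto
    then show ?thesis using x01 by simp
  qed
  moreover have "column_cost l r U = (\<Sum>x\<in>{l..<r}. tv x) + (\<Sum>x\<in>{l..<r}. h x)"
    unfolding column_cost_def tv_def h_def by (simp add: sum.distrib)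
  ultimately show ?thesis using left right unfolding X_def J_def by linarith
qed

lemma column_cost_nonneg: "0 \<le> column_cost l r U"
  unfolding column_cost_def by (intro sum_nonneg) (auto simp: clash_def)

text \<open>Both superlevel sets are vertically convex, so every column is unimodal.\<close>

lemma column_cost_le:
  assumes U: "spin_box l r U"
    and noclash: "\<And>x y. U (x, y) * U (x + 1, y) \<noteq> -1"
    and J: "J = {p. U p = 1}" and S: "S = {p. U p \<noteq> -1}"
    and vJ: "\<And>x y y' t. (x, y) \<in> J \<Longrightarrow> (x, y') \<in> J \<Longrightarrow> y \<le> t \<Longrightarrow> t \<le> y' \<Longrightarrow> (x, t) \<in> J"
    and vS: "\<And>x y y' t. (x, y) \<in> S \<Longrightarrow> (x, y') \<in> S \<Longrightarrow> y \<le> t \<Longrightarrow> t \<le> y' \<Longrightarrow> (x, t) \<in> S"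
    and colJ: "fst ` J = {x0..x1}" and colS: "fst ` S \<subseteq> {x0-1..x1+1}" and "x0 \<le> x1"
  shows "column_cost l r U \<le> 4 * real (card (fst ` J)) + 4"
proof -
  define tv where "tv x = (\<Sum>y\<in>{l..<r}. \<bar>U (x, y) - U (x, y + 1)\<bar>)" for x
  have SB: "S \<subseteq> {l<..<r} \<times> {l<..<r}" using U by (auto simp: S spin_box_def)
  have JS: "J \<subseteq> S" by (auto simp: J S)
  have val: "U p = (if p \<in> J then 1 else if p \<in> S then 0 else -1)" for p
    using spin_box_cases[OF U, of p] by (auto simp: J S)
  \<comment> \<open>The point \<open>(x, c)\<close> is a peak of its column: it lies in
    \<open>J\<close> if the column meets \<open>J\<close> at all, and is an arbitrary point of
    \<open>S\<close> otherwise.\<close>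
  have uni: "tv x = 2 * (U (x, c) + 1)" if c: "(x, c) \<in> S" and max: "(\<exists>y. (x, y) \<in> J) \<longrightarrow> (x, c) \<in> J" for x c
    unfolding tv_def
  proof (rule tv_unimodal[where g = "\<lambda>y. U (x, y)"])
    show "U (x, l) = -1" "U (x, r) = -1" using spin_box_outside[OF U] by auto
    show "l \<le> c" "c \<le> r" using c SB by auto
    show "U (x, y) \<le> U (x, y + 1)" if "l \<le> y" "y < c" for y
      using vJ[of x y c "y+1"] vS[of x y c "y+1"] that c max JS by (auto simp: val)
    show "U (x, y + 1) \<le> U (x, y)" if "c \<le> y" "y < r" for y
      using vJ[of x c "y+1" y] vS[of x c "y+1" y] that c max JS by (auto simp: val)
  qed
  have in4: "tv x = 4" if "x \<in> {x0..x1}" for x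
  proof -
    have "x \<in> fst ` J" using that colJ by blast
    then obtain y where "(x, y) \<in> J" by force
    then show ?thesis using uni[of x y] JS by (auto simp: val)
  qed
  have out0: "tv x = 0" if "x \<notin> fst ` S" for x
  proof -
    have "U (x, y) = -1" for y using that by (force simp: S)
    then show ?thesis by (simp add: tv_def)
  qed
  have out2: "tv x \<le> 2" if "x \<notin> {x0..x1}" for x
  proof (cases "x \<in> fst ` S")
    case True
    then obtain y where y: "(x, y) \<in> S" by force
    have "\<nexists>y. (x, y) \<in> J" using that colJ by force
    then show ?thesis using uni[of x y] y by (auto simp: val)
  qed (use out0 in simp)
  have tv0: "0 \<le> tv x" for x unfolding tv_def by (intro sum_nonneg) auto
  have "column_cost l r U = (\<Sum>x\<in>{l..<r}. tv x)"
    unfolding column_cost_def tv_def clash_def using noclash by simp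
  also have "\<dots> \<le> (\<Sum>x\<in>{l..<r} \<union> {x0-1..x1+1}. tv x)" using tv0 by (intro sum_mono2) auto
  also have "\<dots> = (\<Sum>x\<in>{x0-1..x1+1}. tv x)"
  proof (rule sum.mono_neutral_right)
    show "\<forall>i\<in>{l..<r} \<union> {x0 - 1..x1 + 1} - {x0 - 1..x1 + 1}. tv i = 0" using colS out0 by blast
  qed auto
  also have "{x0-1..x1+1} = insert (x0-1) (insert (x1+1) {x0..x1})" using \<open>x0 \<le> x1\<close> by auto
  also have "(\<Sum>x\<in>\<dots>. tv x) = tv (x0-1) + (tv (x1+1) + (\<Sum>x\<in>{x0..x1}. tv x))"
    using \<open>x0 \<le> x1\<close> by simp
  also have "(\<Sum>x\<in>{x0..x1}. tv x) = 4 * real (card {x0..x1})" using in4 by simp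
  finally show ?thesis using out2[of "x0-1"] out2[of "x1+1"] colJ by simp
qed

subsection \<open>Optimal sets of columns and rows\<close>

text \<open>The weights will be the dissipation that is avoided by keeping the points of
  \<open>X \<times> Y\<close>, and \<open>lam\<close> the energy of keeping one more column or row,
  both in the same units.\<close>

definition net_gain :: "(int \<times> int \<Rightarrow> real) \<Rightarrow> real \<Rightarrow> int set \<Rightarrow> int set \<Rightarrow> real" where
  "net_gain w lam X Y = (\<Sum>x\<in>X. \<Sum>y\<in>Y. w (x, y)) - lam * (real (card X) + real (card Y))"

definition optimal_pair ::
  "(int \<times> int \<Rightarrow> real) \<Rightarrow> real \<Rightarrow> int set \<Rightarrow> int set \<Rightarrow> int set \<Rightarrow> int set \<Rightarrow> bool" where
  "optimal_pair w lam A B X Y \<longleftrightarrow> X \<subseteq> A \<and> Y \<subseteq> B \<and>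
     (\<forall>X' Y'. X' \<subseteq> A \<longrightarrow> Y' \<subseteq> B \<longrightarrow> net_gain w lam X' Y' \<le> net_gain w lam X Y)"

lemma net_gain_swap: "net_gain (w \<circ> prod.swap) lam Y X = net_gain w lam X Y"
  unfolding net_gain_def by (subst sum.swap) simp

lemma optimal_pair_swap:
  assumes "optimal_pair w lam A B X Y"
  shows "optimal_pair (w \<circ> prod.swap) lam B A Y X"
  using assms unfolding optimal_pair_def net_gain_swap by blast

lemma optimal_pair_exists:
  assumes "finite A" "finite B"
  shows "\<exists>X Y. optimal_pair w lam A B X Y"
proof -
  define S where "S = (\<lambda>(X, Y). net_gain w lam X Y) ` (Pow A \<times> Pow B)"
  have S: "finite S" "S \<noteq> {}" using assms by (auto simp: S_def)
  then have "Max S \<in> S" by simp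
  then obtain X Y where XY: "X \<subseteq> A" "Y \<subseteq> B" "Max S = net_gain w lam X Y"
    by (auto simp: S_def)
  have "net_gain w lam X' Y' \<le> net_gain w lam X Y" if "X' \<subseteq> A" "Y' \<subseteq> B" for X' Y'
  proof -
    have "net_gain w lam X' Y' \<in> S" using that by (auto simp: S_def)
    then show ?thesis using S XY(3) Max_ge by metis
  qed
  then show ?thesis using XY unfolding optimal_pair_def by blast
qed

text \<open>Deleting a single column from an optimal pair cannot help. With
  \<open>optimal_pair_out\<close> this gives the threshold rule: the sum of a column is compared
  with \<open>lam\<close>, and a tie leaves the choice open.\<close>

lemma optimal_pair_in:
  assumes opt: "optimal_pair w lam A B X Y" and "finite A" "x \<in> X"
  shows "lam \<le> (\<Sum>y\<in>Y. w (x, y))"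
proof -
  have fin: "finite X" using opt assms(2) finite_subset unfolding optimal_pair_def by blast
  have "X - {x} \<subseteq> A" using opt by (auto simp: optimal_pair_def)
  then have "net_gain w lam (X - {x}) Y \<le> net_gain w lam X Y"
    using opt by (simp add: optimal_pair_def)
  moreover have "net_gain w lam X Y = net_gain w lam (X - {x}) Y + (\<Sum>y\<in>Y. w (x, y)) - lam"
    unfolding net_gain_def sum.remove[OF fin assms(3)] card.remove[OF fin assms(3)]
    by (simp add: distrib_left)
  ultimately show ?thesis by simp
qed

lemma optimal_pair_out:
  assumes opt: "optimal_pair w lam A B X Y" and "finite A" "x \<in> A" "x \<notin> X"
  shows "(\<Sum>y\<in>Y. w (x, y)) \<le> lam"
proof -
  have fin: "finite X" using opt assms(2) finite_subset unfolding optimal_pair_def by blast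
  have "insert x X \<subseteq> A" using opt assms(3) by (auto simp: optimal_pair_def)
  then have "net_gain w lam (insert x X) Y \<le> net_gain w lam X Y"
    using opt by (simp add: optimal_pair_def)
  moreover have "net_gain w lam (insert x X) Y = net_gain w lam X Y + (\<Sum>y\<in>Y. w (x, y)) - lam"
    using fin assms(4) unfolding net_gain_def by (simp add: distrib_left)
  ultimately show ?thesis by simp
qed

text \<open>A newly added point lies in at most one new column and one new row, so the total weight
  gained is at least half of the sum of the column gains and the row gains.\<close>

lemma optimal_pair_core:
  assumes opt: "optimal_pair w lam A B X Y" and fin: "finite A" "finite B"
    and w: "\<And>p. 0 \<le> w p" and D: "D \<subseteq> A" "E \<subseteq> B" and "0 < lam"
    and col: "\<And>x. x \<in> D \<Longrightarrow> 4 * lam \<le> (\<Sum>y\<in>E. w (x, y))"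
    and row: "\<And>y. y \<in> E \<Longrightarrow> 4 * lam \<le> (\<Sum>x\<in>D. w (x, y))"
  shows "D \<subseteq> X" "E \<subseteq> Y"
proof -
  have XY: "X \<subseteq> A" "Y \<subseteq> B" using opt by (auto simp: optimal_pair_def)
  have fins: "finite X" "finite Y" "finite D" "finite E"
    using XY D fin finite_subset by blast+
  define S1 where "S1 = (D - X) \<times> E"
  define S2 where "S2 = D \<times> (E - Y)"
  have fS: "finite S1" "finite S2" using fins by (auto simp: S1_def S2_def)
  have s1: "4 * lam * card (D - X) \<le> sum w S1"
  proof -
    have "(\<Sum>x\<in>D - X. 4 * lam) \<le> (\<Sum>x\<in>D - X. \<Sum>y\<in>E. w (x, y))" by (rule sum_mono) (use col in auto)
    then show ?thesis unfolding S1_def by (simp add: sum.cartesian_product mult.commute)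
  qed
  have s2: "4 * lam * card (E - Y) \<le> sum w S2"
  proof -
    have "(\<Sum>y\<in>E - Y. 4 * lam) \<le> (\<Sum>y\<in>E - Y. \<Sum>x\<in>D. w (x, y))" by (rule sum_mono) (use row in auto)
    also have "\<dots> = (\<Sum>x\<in>D. \<Sum>y\<in>E - Y. w (x, y))" by (rule sum.swap)
    finally show ?thesis unfolding S2_def by (simp add: sum.cartesian_product mult.commute)
  qed
  have "sum w S1 \<le> sum w (S1 \<union> S2)" "sum w S2 \<le> sum w (S1 \<union> S2)"
    by (rule sum_mono2; use w fS in auto)+
  then have half: "2 * lam * (card (D - X) + card (E - Y)) \<le> sum w (S1 \<union> S2)"
    using s1 s2 by (simp add: algebra_simps)
  have "sum w (X \<times> Y) + sum w (S1 \<union> S2) \<le> sum w ((X \<union> D) \<times> (Y \<union> E))"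
  proof -
    have "sum w (X \<times> Y \<union> (S1 \<union> S2)) = sum w (X \<times> Y) + sum w (S1 \<union> S2)"
      using fins fS by (intro sum.union_disjoint) (auto simp: S1_def S2_def)
    moreover have "sum w (X \<times> Y \<union> (S1 \<union> S2)) \<le> sum w ((X \<union> D) \<times> (Y \<union> E))"
      using fins w by (intro sum_mono2) (auto simp: S1_def S2_def)
    ultimately show ?thesis by linarith
  qed
  moreover have "net_gain w lam (X \<union> D) (Y \<union> E) \<le> net_gain w lam X Y"
  proof -
    have "X \<union> D \<subseteq> A" "Y \<union> E \<subseteq> B" using XY D by auto
    then show ?thesis using opt unfolding optimal_pair_def by simp
  qed
  moreover have "card (X \<union> D) = card X + card (D - X)" "card (Y \<union> E) = card Y + card (E - Y)"
    using card_Un_disjoint[of X "D - X"] card_Un_disjoint[of Y "E - Y"] fins by auto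
  \<comment> \<open>The new points gain at least \<open>2 * lam\<close> per new line while a line
    costs only \<open>lam\<close>, so optimality leaves no line to add.\<close>
  ultimately have "2 * lam * (card (D - X) + card (E - Y)) \<le> lam * (card (D - X) + card (E - Y))"
    using half unfolding net_gain_def by (simp add: sum.cartesian_product algebra_simps)
  then have "lam * (card (D - X) + card (E - Y)) \<le> 0" by (simp add: algebra_simps)
  then have "card (D - X) + card (E - Y) = 0" using \<open>0 < lam\<close> by (simp add: mult_le_0_iff)
  then show "D \<subseteq> X" "E \<subseteq> Y" using fins by auto
qed

text \<open>Counted by columns and by rows, the weight of \<open>D \<times> E\<close> is at least
  \<open>2 * lam\<close> per line. The surplus over the cost of the lines is later used to exclude
  an empty phase.\<close>

lemma optimal_pair_gain:
  assumes opt: "optimal_pair w lam A B X Y" and D: "D \<subseteq> A" "E \<subseteq> B"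
    and col: "\<And>x. x \<in> D \<Longrightarrow> 4 * lam \<le> (\<Sum>y\<in>E. w (x, y))"
    and row: "\<And>y. y \<in> E \<Longrightarrow> 4 * lam \<le> (\<Sum>x\<in>D. w (x, y))"
  shows "lam * (card D + card E) \<le> net_gain w lam X Y"
proof -
  have "(\<Sum>x\<in>D. 4 * lam) \<le> (\<Sum>x\<in>D. \<Sum>y\<in>E. w (x, y))" by (rule sum_mono) (use col in auto)
  moreover have "(\<Sum>y\<in>E. 4 * lam) \<le> (\<Sum>y\<in>E. \<Sum>x\<in>D. w (x, y))" by (rule sum_mono) (use row in auto)
  moreover have "(\<Sum>y\<in>E. \<Sum>x\<in>D. w (x, y)) = (\<Sum>x\<in>D. \<Sum>y\<in>E. w (x, y))" by (rule sum.swap)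
  ultimately have "lam * (card D + card E) \<le> net_gain w lam D E"
    unfolding net_gain_def by (simp add: algebra_simps)
  also have "\<dots> \<le> net_gain w lam X Y" using opt D by (simp add: optimal_pair_def)
  finally show ?thesis .
qed

subsection \<open>Lattice octagons\<close>

text \<open>The corners of the rectangle \<open>[a1, b1] \<times> [a2, b2]\<close> are cut by \<open>s1\<close> (south-west), \<open>s2\<close> (north-west),
  \<open>s3\<close> (north-east) and \<open>s4\<close> (south-east) diagonal steps; \<open>fit\<close> says that no parallel side is lost.\<close>

locale lat_octagon =
  fixes a1 b1 a2 b2 s1 s2 s3 s4 :: int
  assumes cuts: "0 \<le> s1" "0 \<le> s2" "0 \<le> s3" "0 \<le> s4"
    and fit: "s1 + s4 \<le> b1 - a1" "s1 + s2 \<le> b2 - a2" "s2 + s3 \<le> b1 - a1" "s3 + s4 \<le> b2 - a2"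
begin

definition pts :: "(int \<times> int) set" where
  "pts = {(x, y). a1 \<le> x \<and> x \<le> b1 \<and> a2 \<le> y \<and> y \<le> b2 \<and>
     a1 + a2 + s1 \<le> x + y \<and> x + y \<le> b1 + b2 - s3 \<and> a1 - b2 + s2 \<le> x - y \<and> x - y \<le> b1 - a2 - s4}"

text \<open>On points of the octagon this is the l1 distance to the complement in lattice steps.
  Diagonal constraints enter with the same coefficient as parallel ones, since a unit step in either
  coordinate changes \<open>x + y\<close> and \<open>x - y\<close> by one.\<close>

fun depth :: "int \<times> int \<Rightarrow> int" where
  "depth (x, y) =
     min (min (min (x - a1 + 1) (b1 - x + 1)) (min (y - a2 + 1) (b2 - y + 1)))
       (min (min (x + y - (a1 + a2 + s1) + 1) (b1 + b2 - s3 - (x + y) + 1))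
         (min (x - y - (a1 - b2 + s2) + 1) (b1 - a2 - s4 - (x - y) + 1)))"

text \<open>Cutting off at 0 allows sums over full rectangles, whose points outside the octagon then
  do not count.\<close>

definition weight :: "int \<times> int \<Rightarrow> real" where
  "weight p = real_of_int (max 0 (depth p))"

lemma depth_ge_iff:
  "t \<le> depth (x, y) \<longleftrightarrow>
     t \<le> x - a1 + 1 \<and> t \<le> b1 - x + 1 \<and> t \<le> y - a2 + 1 \<and> t \<le> b2 - y + 1 \<and>
     t \<le> x + y - (a1 + a2 + s1) + 1 \<and> t \<le> b1 + b2 - s3 - (x + y) + 1 \<and>
     t \<le> x - y - (a1 - b2 + s2) + 1 \<and> t \<le> b1 - a2 - s4 - (x - y) + 1"
  unfolding depth.simps min.bounded_iff by (simp only: conj_assoc)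

lemmas depth_le = depth_ge_iff[THEN iffD1, OF order_refl]

declare depth.simps [simp del]

lemma pts_iff_depth: "p \<in> pts \<longleftrightarrow> 1 \<le> depth p"
  by (cases p) (auto simp: pts_def depth_ge_iff)

lemma weight_nonneg: "0 \<le> weight p"
  by (simp add: weight_def)

lemma weight_ge: "of_int t \<le> weight p" if "t \<le> depth p"
  using that by (simp add: weight_def)

lemma weight_outside: "weight p = 0" if "p \<notin> pts"
  using that by (auto simp: weight_def pts_iff_depth)

text \<open>A step to the right tightens only the constraints of the right side and of the two
  eastern diagonals. In the strip the depth is at most \<open>M\<close>, and these three have enough
  slack not to determine it.\<close>

lemma weight_mono_left:
  assumes "x < a1 + M" "2 * M + 1 \<le> b1 - a1 - s3" "2 * M + 1 \<le> b1 - a1 - s4" "0 \<le> M" "a1 \<le> x"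
  shows "weight (x, y) \<le> weight (x + 1, y)"
proof -
  have "depth (x, y) \<le> depth (x + 1, y)"
    unfolding depth_ge_iff using depth_le[of x y] assms cuts by (intro conjI) linarith+
  then show ?thesis by (simp add: weight_def)
qed

lemma depth_left_core:
  assumes "1 \<le> m" "m \<le> M + 1" "a2 + s1 \<le> y" "y \<le> b2 - s2" "a2 + M \<le> y" "y \<le> b2 - M"
    "2 * M + 1 \<le> b1 - a1 - s3" "2 * M + 1 \<le> b1 - a1 - s4"
  shows "depth (a1 + m - 1, y) = m"
proof (rule antisym)
  show "depth (a1 + m - 1, y) \<le> m" using depth_le[of "a1 + m - 1" y] by linarith
  show "m \<le> depth (a1 + m - 1, y)"
    unfolding depth_ge_iff using assms cuts by (intro conjI) linarith+
qed

text \<open>Strictness needs a single row: one facing the left side, where that side is the nearest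
  one and the depth grows by one. It belongs to \<open>Y\<close> because \<open>Y\<close> contains
  the core.\<close>

lemma column_strict_mono_left:
  assumes M: "0 \<le> M" "2 * M + 1 \<le> b1 - a1 - s3" "2 * M + 1 \<le> b1 - a1 - s4" "2 * M \<le> b2 - a2 - s1 - s2"
    and Y: "{a2 + M..b2 - M} \<subseteq> Y" "finite Y" and x: "a1 \<le> x" "x < a1 + M"
  shows "(\<Sum>y\<in>Y. weight (x, y)) < (\<Sum>y\<in>Y. weight (x + 1, y))"
proof (rule sum_strict_mono_ex1[OF Y(2)])
  show "\<forall>y\<in>Y. weight (x, y) \<le> weight (x + 1, y)" using weight_mono_left[OF x(2) M(2,3,1) x(1)] by blast
  define y where "y = max (a2 + s1) (a2 + M)"
  have y: "a2 + s1 \<le> y" "y \<le> b2 - s2" "a2 + M \<le> y" "y \<le> b2 - M"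
    using M cuts by (auto simp: y_def)
  have "depth (a1 + (x - a1 + 1) - 1, y) = x - a1 + 1" "depth (a1 + (x - a1 + 2) - 1, y) = x - a1 + 2"
    by (rule depth_left_core[OF _ _ y M(2,3)]; use x in linarith)+
  then have "weight (x, y) < weight (x + 1, y)" using x by (simp add: weight_def add.commute)
  moreover have "y \<in> Y" using y Y by auto
  ultimately show "\<exists>y\<in>Y. weight (x, y) < weight (x + 1, y)" by blast
qed

text \<open>At least \<open>P - 2 * M\<close> rows of the core face the left side, where
  \<open>P\<close> is its number of points, and on each of them the depth is exactly
  \<open>m\<close>.\<close>

lemma column_ge_left:
  assumes M: "0 \<le> M" "2 * M + 1 \<le> b1 - a1 - s3" "2 * M + 1 \<le> b1 - a1 - s4" "2 * M \<le> b2 - a2 - s1 - s2"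
    and Y: "{a2 + M..b2 - M} \<subseteq> Y" "finite Y" and m: "1 \<le> m" "m \<le> M + 1"
  shows "of_int (m * (b2 - a2 - s1 - s2 + 1 - 2 * M)) \<le> (\<Sum>y\<in>Y. weight (a1 + m - 1, y))"
proof -
  define S where "S = {max (a2 + s1) (a2 + M)..min (b2 - s2) (b2 - M)}"
  have "S \<subseteq> Y" using Y by (auto simp: S_def)
  have "b2 - a2 - s1 - s2 + 1 - 2 * M \<le> int (card S)"
    using M cuts by (auto simp: S_def)
  then have "m * (b2 - a2 - s1 - s2 + 1 - 2 * M) \<le> int (card S) * m"
    using m by (simp add: mult.commute)
  then have "of_int (m * (b2 - a2 - s1 - s2 + 1 - 2 * M)) \<le> real_of_int (int (card S) * m)"
    by (simp only: of_int_le_iff)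
  also have "\<dots> = (\<Sum>y\<in>S. real_of_int m)" by simp
  also have "\<dots> \<le> (\<Sum>y\<in>S. weight (a1 + m - 1, y))"
  proof (rule sum_mono)
    fix y assume "y \<in> S"
    then have "depth (a1 + m - 1, y) = m"
      using m M by (intro depth_left_core[of m M]) (auto simp: S_def)
    then show "real_of_int m \<le> weight (a1 + m - 1, y)" by (simp add: weight_def)
  qed
  also have "\<dots> \<le> (\<Sum>y\<in>Y. weight (a1 + m - 1, y))"
    using \<open>S \<subseteq> Y\<close> Y weight_nonneg by (intro sum_mono2) auto
  finally show ?thesis .
qed

text \<open>The depth is at most \<open>m\<close> in this column, and the diagonals let the column
  exceed the left side by at most \<open>m - 1\<close> points at either end.\<close>

lemma column_le_left:
  assumes "finite Y" and m: "1 \<le> m"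
  shows "(\<Sum>y\<in>Y. weight (a1 + m - 1, y)) \<le> of_int (m * (b2 - a2 - s1 - s2 + 1 + 2 * m))"
proof -
  define S where "S = {a2 + s1 - (m - 1)..b2 - s2 + (m - 1)}"
  have "weight (a1 + m - 1, y) = 0" if "y \<notin> S" for y
    by (rule weight_outside) (use that in \<open>auto simp: pts_def S_def\<close>)
  then have "(\<Sum>y\<in>Y. weight (a1 + m - 1, y)) = (\<Sum>y\<in>Y \<inter> S. weight (a1 + m - 1, y))"
    using assms(1) by (intro sum.mono_neutral_right) auto
  also have "\<dots> \<le> (\<Sum>y\<in>S. weight (a1 + m - 1, y))"
    using weight_nonneg by (intro sum_mono2) (auto simp: S_def)
  also have "\<dots> \<le> (\<Sum>y\<in>S. real_of_int m)"
  proof (rule sum_mono)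
    fix y
    have "depth (a1 + m - 1, y) \<le> m" using depth_le[of "a1 + m - 1" y] by linarith
    then show "weight (a1 + m - 1, y) \<le> real_of_int m" using m by (simp add: weight_def)
  qed
  also have "\<dots> = real_of_int (m * int (card S))" by simp
  also have "\<dots> \<le> of_int (m * (b2 - a2 - s1 - s2 + 1 + 2 * m))"
  proof -
    have "int (card S) \<le> b2 - a2 - s1 - s2 + 1 + 2 * m" using fit m by (simp add: S_def)
    then show ?thesis using m by (simp only: of_int_le_iff) (simp add: mult_left_mono)
  qed
  finally show ?thesis .
qed

text \<open>The length of a column of the octagon is concave in \<open>x\<close>, and the end
  columns are the left and right sides; so every column has at least \<open>L\<close> points.
  Trimming \<open>M\<close> of them at both ends leaves points of depth at least
  \<open>M + 1\<close>.\<close>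

lemma column_ge_core:
  assumes "0 \<le> M" "a1 + M \<le> x" "x \<le> b1 - M"
    and "L \<le> b2 - a2 - s1 - s2 + 1" "L \<le> b2 - a2 - s3 - s4 + 1"
  shows "of_int ((M + 1) * (L - 2 * M)) \<le> (\<Sum>y\<in>{a2 + M..b2 - M}. weight (x, y))"
proof -
  define lo where "lo = max a2 (max (a1 + a2 + s1 - x) (x - b1 + a2 + s4))"
  define hi where "hi = min b2 (min (b1 + b2 - s3 - x) (x - a1 + b2 - s2))"
  have "a2 + L - 1 \<le> hi" "a1 + a2 + s1 - x + L - 1 \<le> hi" "x - b1 + a2 + s4 + L - 1 \<le> hi"
    unfolding hi_def min.bounded_iff using assms cuts fit by (intro conjI; linarith)+
  then have len: "L \<le> hi - lo + 1" unfolding lo_def by linarith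
  define S where "S = {lo + M..hi - M}"
  have S: "S \<subseteq> {a2 + M..b2 - M}" by (simp add: S_def lo_def hi_def)
  have "of_int ((M + 1) * (L - 2 * M)) \<le> real_of_int ((M + 1) * int (card S))"
    using len assms(1) by (simp only: of_int_le_iff) (intro mult_left_mono; simp add: S_def)
  also have "\<dots> = (\<Sum>y\<in>S. real_of_int (M + 1))" by simp
  also have "\<dots> \<le> (\<Sum>y\<in>S. weight (x, y))"
  proof (intro sum_mono weight_ge)
    fix y assume "y \<in> S"
    then have "lo + M \<le> y" "y \<le> hi - M" by (auto simp: S_def)
    moreover have "a2 \<le> lo" "a1 + a2 + s1 - x \<le> lo" "x - b1 + a2 + s4 \<le> lo"
      "hi \<le> b2" "hi \<le> b1 + b2 - s3 - x" "hi \<le> x - a1 + b2 - s2"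
      by (simp_all add: lo_def hi_def)
    ultimately show "M + 1 \<le> depth (x, y)"
      unfolding depth_ge_iff using assms(2,3) by (intro conjI; linarith)
  qed
  also have "\<dots> \<le> (\<Sum>y\<in>{a2 + M..b2 - M}. weight (x, y))"
    using S weight_nonneg by (intro sum_mono2) auto
  finally show ?thesis .
qed

subsection \<open>Shape of the optimal pairs\<close>

text \<open>A kept column followed by a dropped one would give \<open>lam\<close> \<le> its sum <
  the next sum \<le> \<open>lam\<close>. So in the strip the kept columns run up to the core without
  gaps. The last dropped column and the first kept one yield the two bounds on
  \<open>m\<close>.\<close>

lemma left_end:
  assumes M: "0 \<le> M" "2 * M + 1 \<le> b1 - a1 - s3" "2 * M + 1 \<le> b1 - a1 - s4" "2 * M \<le> b2 - a2 - s1 - s2"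
    and X: "{a1 + M..b1 - M} \<subseteq> X" "X \<subseteq> {a1..b1}"
    and Y: "{a2 + M..b2 - M} \<subseteq> Y" "finite Y" and "0 \<le> lam"
    and inn: "\<And>x. x \<in> X \<Longrightarrow> lam \<le> (\<Sum>y\<in>Y. weight (x, y))"
    and out: "\<And>x. x \<in> {a1..b1} - X \<Longrightarrow> (\<Sum>y\<in>Y. weight (x, y)) \<le> lam"
  shows "\<exists>m. 0 \<le> m \<and> m \<le> M \<and> X \<inter> {..a1 + M} = {a1 + m..a1 + M} \<and>
    of_int (m * (b2 - a2 - s1 - s2 + 1 - 2 * M)) \<le> lam \<and>
    lam \<le> of_int ((m + 1) * (b2 - a2 - s1 - s2 + 1 + 2 * (m + 1)))"
proof -
  have finX: "finite X" using X(2) finite_subset by blast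
  have core: "a1 + M \<in> X" using X(1) M cuts by auto
  define l where "l = Min X"
  have l: "l \<in> X" "\<And>x. x \<in> X \<Longrightarrow> l \<le> x"
    unfolding l_def using Min_in[OF finX] Min_le[OF finX] core by blast+
  have l_le: "l \<le> a1 + M" using l(2)[OF core] .
  have l_ge: "a1 \<le> l" using l(1) X(2) by auto
  have up: "x + 1 \<in> X" if "x \<in> X" "x < a1 + M" for x
  proof (rule ccontr)
    assume "x + 1 \<notin> X"
    moreover have "a1 \<le> x" using that X by auto
    moreover have "x + 1 \<le> b1" using that M cuts by linarith
    ultimately have "(\<Sum>y\<in>Y. weight (x + 1, y)) \<le> lam" by (intro out) auto
    moreover have "(\<Sum>y\<in>Y. weight (x, y)) < (\<Sum>y\<in>Y. weight (x + 1, y))"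
      by (rule column_strict_mono_left[OF M Y \<open>a1 \<le> x\<close> that(2)])
    ultimately show False using inn[OF that(1)] by linarith
  qed
  have "j \<le> a1 + M \<longrightarrow> j \<in> X" if "l \<le> j" for j
    using that
  proof (induction j rule: int_ge_induct)
    case (step i)
    then show ?case using up[of i] by auto
  qed (use l in simp)
  then have "X \<inter> {..a1 + M} = {a1 + (l - a1)..a1 + M}" using l by auto
  moreover have "of_int ((l - a1) * (b2 - a2 - s1 - s2 + 1 - 2 * M)) \<le> lam"
  proof (cases "l = a1")
    case False
    have "l - 1 \<notin> X" using l(2)[of "l - 1"] by auto
    then have "(\<Sum>y\<in>Y. weight (l - 1, y)) \<le> lam"
      using l l_ge False X(2) by (intro out) auto
    then show ?thesis using column_ge_left[OF M Y, of "l - a1"] l_ge l_le False by simp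
  qed (use \<open>0 \<le> lam\<close> in simp)
  moreover have "lam \<le> of_int ((l - a1 + 1) * (b2 - a2 - s1 - s2 + 1 + 2 * (l - a1 + 1)))"
    using inn[OF l(1)] column_le_left[OF Y(2), of "l - a1 + 1"] l_ge by simp
  ultimately show ?thesis using l_ge l_le by (intro exI[of _ "l - a1"]) auto
qed

text \<open>Reflecting \<open>x\<close> exchanges the western with the eastern corners; transposing
  exchanges only north-west and south-east. These two symmetries transfer \<open>left_end\<close> to
  the other three sides.\<close>

lemma reflected: "lat_octagon (-b1) (-a1) a2 b2 s4 s3 s2 s1"
  using cuts fit by unfold_locales auto

lemma transposed: "lat_octagon a2 b2 a1 b1 s1 s4 s3 s2"
  using cuts fit by unfold_locales auto

lemma depth_reflected: "lat_octagon.depth (-b1) (-a1) a2 b2 s4 s3 s2 s1 (x, y) = depth (-x, y)"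
proof -
  interpret R: lat_octagon "-b1" "-a1" a2 b2 s4 s3 s2 s1 by (rule reflected)
  have "t \<le> R.depth (x, y) \<longleftrightarrow> t \<le> depth (-x, y)" for t
    unfolding R.depth_ge_iff depth_ge_iff by linarith
  then show ?thesis by (metis order_antisym order_refl)
qed

lemma depth_transposed: "lat_octagon.depth a2 b2 a1 b1 s1 s4 s3 s2 (y, x) = depth (x, y)"
proof -
  interpret T: lat_octagon a2 b2 a1 b1 s1 s4 s3 s2 by (rule transposed)
  have "t \<le> T.depth (y, x) \<longleftrightarrow> t \<le> depth (x, y)" for t
    unfolding T.depth_ge_iff depth_ge_iff by linarith
  then show ?thesis by (metis order_antisym order_refl)
qed

lemma right_end:
  assumes M: "0 \<le> M" "2 * M + 1 \<le> b1 - a1 - s2" "2 * M + 1 \<le> b1 - a1 - s1" "2 * M \<le> b2 - a2 - s3 - s4"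
    and X: "{a1 + M..b1 - M} \<subseteq> X" "X \<subseteq> {a1..b1}"
    and Y: "{a2 + M..b2 - M} \<subseteq> Y" "finite Y" and "0 \<le> lam"
    and inn: "\<And>x. x \<in> X \<Longrightarrow> lam \<le> (\<Sum>y\<in>Y. weight (x, y))"
    and out: "\<And>x. x \<in> {a1..b1} - X \<Longrightarrow> (\<Sum>y\<in>Y. weight (x, y)) \<le> lam"
  shows "\<exists>m. 0 \<le> m \<and> m \<le> M \<and> X \<inter> {b1 - M..} = {b1 - M..b1 - m} \<and>
    of_int (m * (b2 - a2 - s3 - s4 + 1 - 2 * M)) \<le> lam \<and>
    lam \<le> of_int ((m + 1) * (b2 - a2 - s3 - s4 + 1 + 2 * (m + 1)))"
proof -
  interpret R: lat_octagon "-b1" "-a1" a2 b2 s4 s3 s2 s1 by (rule reflected)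
  have w: "R.weight (x, y) = weight (-x, y)" for x y
    by (simp add: R.weight_def weight_def depth_reflected)
  have uX: "x \<in> uminus ` X \<longleftrightarrow> - x \<in> X" for x by force
  have "\<exists>m. 0 \<le> m \<and> m \<le> M \<and> uminus ` X \<inter> {..- b1 + M} = {- b1 + m..- b1 + M} \<and>
    of_int (m * (b2 - a2 - s4 - s3 + 1 - 2 * M)) \<le> lam \<and>
    lam \<le> of_int ((m + 1) * (b2 - a2 - s4 - s3 + 1 + 2 * (m + 1)))"
  proof (rule R.left_end[OF M(1) _ _ _ _ _ Y \<open>0 \<le> lam\<close>])
    show "{- b1 + M..- a1 - M} \<subseteq> uminus ` X"
    proof
      fix x assume "x \<in> {- b1 + M..- a1 - M}"
      then have "- x \<in> {a1 + M..b1 - M}" by auto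
      then show "x \<in> uminus ` X" using X(1) uX by blast
    qed
    show "uminus ` X \<subseteq> {- b1..- a1}" using X(2) by auto
    show "lam \<le> (\<Sum>y\<in>Y. R.weight (x, y))" if "x \<in> uminus ` X" for x
      using inn[of "-x"] that unfolding w uX by blast
    show "(\<Sum>y\<in>Y. R.weight (x, y)) \<le> lam" if "x \<in> {- b1..- a1} - uminus ` X" for x
    proof -
      have "- x \<in> {a1..b1} - X" using that uX[of x] by auto
      then show ?thesis unfolding w by (rule out)
    qed
  qed (use M in auto)
  then obtain m where m: "0 \<le> m" "m \<le> M" "uminus ` X \<inter> {..- b1 + M} = {- b1 + m..- b1 + M}"
    "of_int (m * (b2 - a2 - s4 - s3 + 1 - 2 * M)) \<le> lam"
    "lam \<le> of_int ((m + 1) * (b2 - a2 - s4 - s3 + 1 + 2 * (m + 1)))" by blast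
  have "x \<in> X \<inter> {b1 - M..} \<longleftrightarrow> x \<in> {b1 - M..b1 - m}" for x
  proof -
    have "- x \<in> uminus ` X \<inter> {..- b1 + M} \<longleftrightarrow> - x \<in> {- b1 + m..- b1 + M}" using m(3) by blast
    then show ?thesis using uX[of "-x"] by auto
  qed
  then have "X \<inter> {b1 - M..} = {b1 - M..b1 - m}" by blast
  moreover have "b2 - a2 - s4 - s3 = b2 - a2 - s3 - s4" by simp
  ultimately show ?thesis using m by metis
qed

text \<open>\<open>par_count i\<close> is the number of points of the \<open>i\<close>-th external slice.\<close>

definition par_count :: "nat \<Rightarrow> int" where
  "par_count i = (if i = 1 then b1 - a1 - s1 - s4 else if i = 2 then b2 - a2 - s1 - s2
     else if i = 3 then b1 - a1 - s2 - s3 else b2 - a2 - s3 - s4) + 1"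

text \<open>The two end strips and the core overlap and cover the line, so the two local
  descriptions glue to one interval.\<close>

lemma columns_shape:
  assumes M: "0 \<le> M" "4 * M + 4 \<le> L" and L: "\<And>i. L \<le> par_count i"
    and lam: "0 < lam" "4 * lam \<le> of_int ((M + 1) * (L - 2 * M))"
    and opt: "optimal_pair weight lam {a1..b1} {a2..b2} X Y"
    and core: "{a1 + M..b1 - M} \<subseteq> X" "{a2 + M..b2 - M} \<subseteq> Y"
  shows "\<exists>m m'. 0 \<le> m \<and> m \<le> M \<and> 0 \<le> m' \<and> m' \<le> M \<and> X = {a1 + m..b1 - m'} \<and>
    of_int (m * (par_count 2 - 2 * M)) \<le> lam \<and> lam \<le> of_int ((m + 1) * (par_count 2 + 2 * (m + 1))) \<and>
    of_int (m' * (par_count 4 - 2 * M)) \<le> lam \<and> lam \<le> of_int ((m' + 1) * (par_count 4 + 2 * (m' + 1)))"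
proof -
  have n: "L \<le> b1 - a1 - s1 - s4 + 1" "L \<le> b2 - a2 - s1 - s2 + 1" "L \<le> b1 - a1 - s2 - s3 + 1"
    "L \<le> b2 - a2 - s3 - s4 + 1"
    using L[of 1] L[of 2] L[of 3] L[of 4] by (simp_all add: par_count_def)
  have X: "X \<subseteq> {a1..b1}" and Y: "finite Y" using opt finite_subset by (auto simp: optimal_pair_def)
  have inn: "lam \<le> (\<Sum>y\<in>Y. weight (x, y))" if "x \<in> X" for x
    using optimal_pair_in[OF opt _ that] by simp
  have out: "(\<Sum>y\<in>Y. weight (x, y)) \<le> lam" if "x \<in> {a1..b1} - X" for x
    using optimal_pair_out[OF opt, of x] that by simp
  obtain m where m: "0 \<le> m" "m \<le> M" "X \<inter> {..a1 + M} = {a1 + m..a1 + M}"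
    "of_int (m * (par_count 2 - 2 * M)) \<le> lam" "lam \<le> of_int ((m + 1) * (par_count 2 + 2 * (m + 1)))"
    using left_end[OF M(1) _ _ _ core(1) X core(2) Y _ inn out] n M lam cuts
    by (auto simp: par_count_def)
  obtain m' where m': "0 \<le> m'" "m' \<le> M" "X \<inter> {b1 - M..} = {b1 - M..b1 - m'}"
    "of_int (m' * (par_count 4 - 2 * M)) \<le> lam" "lam \<le> of_int ((m' + 1) * (par_count 4 + 2 * (m' + 1)))"
    using right_end[OF M(1) _ _ _ core(1) X core(2) Y _ inn out] n M lam cuts
    by (auto simp: par_count_def)
  have "x \<in> X \<longleftrightarrow> a1 + m \<le> x \<and> x \<le> b1 - m'" for x
  proof -
    have far: "a1 + M \<le> b1 - M" using n M cuts by linarith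
    consider "x \<le> a1 + M" | "b1 - M \<le> x" | "x \<in> {a1 + M..b1 - M}" by fastforce
    then show ?thesis
    proof cases
      case 1
      then have "x \<in> X \<longleftrightarrow> x \<in> {a1 + m..a1 + M}" using m(3) by blast
      then show ?thesis using 1 m' far by auto
    next
      case 2
      then have "x \<in> X \<longleftrightarrow> x \<in> {b1 - M..b1 - m'}" using m'(3) by blast
      then show ?thesis using 2 m far by auto
    next
      case 3
      then show ?thesis using core(1) m m' by auto
    qed
  qed
  then have "X = {a1 + m..b1 - m'}" by (simp only: set_eq_iff atLeastAtMost_iff) simp
  then show ?thesis using m m' by blast
qed

text \<open>Lines at distance at least \<open>M\<close> from the bounding rectangle weigh
  \<open>4 * lam\<close> even when only their part inside the core is counted. The core thus
  supports itself and lies in every optimal pair, whatever happens near the sides.\<close>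

lemma optimal_core:
  assumes M: "0 \<le> M" and L: "\<And>i. L \<le> par_count i"
    and lam: "0 < lam" "4 * lam \<le> of_int ((M + 1) * (L - 2 * M))"
    and opt: "optimal_pair weight lam {a1..b1} {a2..b2} X Y"
  shows "{a1 + M..b1 - M} \<subseteq> X" "{a2 + M..b2 - M} \<subseteq> Y"
    "lam * (card {a1 + M..b1 - M} + card {a2 + M..b2 - M}) \<le> net_gain weight lam X Y"
proof -
  interpret T: lat_octagon a2 b2 a1 b1 s1 s4 s3 s2 by (rule transposed)
  have w: "T.weight (y, x) = weight (x, y)" for x y
    by (simp add: T.weight_def weight_def depth_transposed)
  have n: "L \<le> b1 - a1 - s1 - s4 + 1" "L \<le> b2 - a2 - s1 - s2 + 1" "L \<le> b1 - a1 - s2 - s3 + 1"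
    "L \<le> b2 - a2 - s3 - s4 + 1"
    using L[of 1] L[of 2] L[of 3] L[of 4] by (simp_all add: par_count_def)
  have D: "{a1 + M..b1 - M} \<subseteq> {a1..b1}" "{a2 + M..b2 - M} \<subseteq> {a2..b2}" using M by auto
  have col: "4 * lam \<le> (\<Sum>y\<in>{a2 + M..b2 - M}. weight (x, y))" if "x \<in> {a1 + M..b1 - M}" for x
    using column_ge_core[OF M, of x L] that n lam by auto
  have row: "4 * lam \<le> (\<Sum>x\<in>{a1 + M..b1 - M}. weight (x, y))" if "y \<in> {a2 + M..b2 - M}" for y
    using T.column_ge_core[OF M, of y L] that n lam unfolding w by auto
  show "{a1 + M..b1 - M} \<subseteq> X" "{a2 + M..b2 - M} \<subseteq> Y"
    using optimal_pair_core[OF opt _ _ weight_nonneg D lam(1) col row] by auto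
  show "lam * (card {a1 + M..b1 - M} + card {a2 + M..b2 - M}) \<le> net_gain weight lam X Y"
    by (rule optimal_pair_gain[OF opt D col row])
qed

lemma optimal_shape:
  assumes M: "0 \<le> M" "4 * M + 4 \<le> L" and L: "\<And>i. L \<le> par_count i"
    and lam: "0 < lam" "4 * lam \<le> of_int ((M + 1) * (L - 2 * M))"
    and opt: "optimal_pair weight lam {a1..b1} {a2..b2} X Y"
  obtains m :: "nat \<Rightarrow> int" where "\<And>i. 0 \<le> m i" "\<And>i. m i \<le> M"
    "X = {a1 + m 2..b1 - m 4}" "Y = {a2 + m 1..b2 - m 3}"
    "\<And>i. of_int (m i * (par_count i - 2 * M)) \<le> lam"
    "\<And>i. lam \<le> of_int ((m i + 1) * (par_count i + 2 * (m i + 1)))"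
proof -
  interpret T: lat_octagon a2 b2 a1 b1 s1 s4 s3 s2 by (rule transposed)
  have Tw: "T.weight = weight \<circ> prod.swap"
    by (auto simp: T.weight_def weight_def depth_transposed)
  have Tpc: "T.par_count 2 = par_count 1" "T.par_count 4 = par_count 3"
    by (auto simp: T.par_count_def par_count_def)
  have TL: "L \<le> T.par_count i" for i
    using L[of 1] L[of 2] L[of 3] L[of 4] by (auto simp: T.par_count_def par_count_def)
  note core = optimal_core[OF M(1) L lam opt]
  have optT: "optimal_pair T.weight lam {a2..b2} {a1..b1} Y X"
    unfolding Tw by (rule optimal_pair_swap[OF opt])
  obtain m2 m4 where X: "0 \<le> m2" "m2 \<le> M" "0 \<le> m4" "m4 \<le> M" "X = {a1 + m2..b1 - m4}"
    "of_int (m2 * (par_count 2 - 2 * M)) \<le> lam" "lam \<le> of_int ((m2 + 1) * (par_count 2 + 2 * (m2 + 1)))"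
    "of_int (m4 * (par_count 4 - 2 * M)) \<le> lam" "lam \<le> of_int ((m4 + 1) * (par_count 4 + 2 * (m4 + 1)))"
    using columns_shape[OF M L lam opt core(1,2)] by blast
  obtain m1 m3 where Y: "0 \<le> m1" "m1 \<le> M" "0 \<le> m3" "m3 \<le> M" "Y = {a2 + m1..b2 - m3}"
    "of_int (m1 * (par_count 1 - 2 * M)) \<le> lam" "lam \<le> of_int ((m1 + 1) * (par_count 1 + 2 * (m1 + 1)))"
    "of_int (m3 * (par_count 3 - 2 * M)) \<le> lam" "lam \<le> of_int ((m3 + 1) * (par_count 3 + 2 * (m3 + 1)))"
    using T.columns_shape[OF M TL lam optT core(2,1)] unfolding Tpc by blast
  \<comment> \<open>Indices outside \<open>{1..4}\<close> take the value for side 4, as in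
    \<open>par_count\<close>, so that the bounds hold for all \<open>i\<close> without a side
    condition.\<close>
  define m where "m i = (if i = 1 then m1 else if i = 2 then m2 else if i = 3 then m3 else m4)" for i :: nat
  have pc: "par_count i = par_count 4" if "i \<notin> {1, 2, 3}" for i using that by (simp add: par_count_def)
  show ?thesis
  proof (rule that[of m])
    fix i
    show "0 \<le> m i" "m i \<le> M" using X Y by (auto simp: m_def)
    consider "i = 1" | "i = 2" | "i = 3" | "m i = m4" "par_count i = par_count 4"
      using pc[of i] unfolding m_def by fastforce
    then show "of_int (m i * (par_count i - 2 * M)) \<le> lam"
      "lam \<le> of_int ((m i + 1) * (par_count i + 2 * (m i + 1)))"
      by (cases; use X Y in \<open>simp add: m_def\<close>)+
  qed (use X Y in \<open>auto simp: m_def\<close>)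
qed

end

subsection \<open>The outer boundary and the pockets of an octagon\<close>

definition outer :: "(int \<times> int) set \<Rightarrow> (int \<times> int) set" where
  "outer K = {(x, y). (x, y) \<notin> K \<and> ((x + 1, y) \<in> K \<or> (x - 1, y) \<in> K \<or> (x, y + 1) \<in> K \<or> (x, y - 1) \<in> K)}"

text \<open>Add a remaining point of maximal value, \<open>n\<close> times. Ties are broken
  arbitrarily, so only strictly larger values are guaranteed to be present.\<close>

lemma exists_upper_subset:
  fixes f :: "'a \<Rightarrow> int"
  assumes "finite T" "n \<le> card T"
  shows "\<exists>V\<subseteq>T. card V = n \<and> (\<forall>p\<in>V. \<forall>q\<in>T. f p < f q \<longrightarrow> q \<in> V)"
  using assms(2)
proof (induction n)
  case 0
  then show ?case by (intro exI[of _ "{}"]) auto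
next
  case (Suc n)
  then obtain V where V: "V \<subseteq> T" "card V = n" "\<forall>p\<in>V. \<forall>q\<in>T. f p < f q \<longrightarrow> q \<in> V" by auto
  have fV: "finite V" using V(1) assms(1) finite_subset by blast
  have ne: "T - V \<noteq> {}" using Suc.prems V by auto
  define M where "M = Max (f ` (T - V))"
  have "M \<in> f ` (T - V)" unfolding M_def using assms(1) ne by (intro Max_in) auto
  then obtain q where q: "q \<in> T - V" "f q = M" by auto
  have max: "f r \<le> f q" if "r \<in> T - V" for r
    unfolding q(2) M_def using assms(1) that by (intro Max_ge) auto
  have "insert q V \<subseteq> T" "card (insert q V) = Suc n" using q V fV by auto
  moreover have "\<forall>p\<in>insert q V. \<forall>r\<in>T. f p < f r \<longrightarrow> r \<in> insert q V"
    using V(3) max by fastforce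
  ultimately show ?case by blast
qed

text \<open>The size of the pocket behind a diagonal of \<open>n\<close> steps, with
  \<open>i\<close> and \<open>j\<close> measured from the corner of the bounding rectangle.\<close>

lemma card_triangle:
  "2 * card {(i, j). i + j + 2 \<le> (n::nat)} = n * (n - 1)"
proof -
  have "{(i, j). i + j + 2 \<le> n} = (SIGMA i:{..<n - 1}. {..<n - 1 - i})" by auto
  then have "card {(i, j). i + j + 2 \<le> n} = (\<Sum>i<n - 1. n - 1 - i)" by simp
  also have "\<dots> = (\<Sum>i<n - 1. Suc i)"
    by (rule sum.reindex_bij_witness[of _ "\<lambda>i. n - 1 - Suc i" "\<lambda>i. n - 1 - Suc i"]) auto
  also have "2 * \<dots> = n * (n - 1)"
  proof -
    have "2 * (\<Sum>i<m. Suc i) = (m + 1) * m" for m by (induction m) auto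
    from this[of "n - 1"] show ?thesis by (cases n) auto
  qed
  finally show ?thesis .
qed

lemma set_eqI_pair: "(\<And>x y. (x, y) \<in> A \<longleftrightarrow> (x, y) \<in> B) \<Longrightarrow> A = B"
  by auto

context lat_octagon
begin

definition lo :: "int \<Rightarrow> int" where
  "lo x = max a2 (max (a1 + a2 + s1 - x) (x - b1 + a2 + s4))"

definition hi :: "int \<Rightarrow> int" where
  "hi x = min b2 (min (b1 + b2 - s3 - x) (x - a1 + b2 - s2))"

lemma pts_iff: "(x, y) \<in> pts \<longleftrightarrow> a1 \<le> x \<and> x \<le> b1 \<and> lo x \<le> y \<and> y \<le> hi x"
  unfolding pts_def lo_def hi_def by (auto simp only: mem_Collect_eq case_prod_conv max.bounded_iff min.bounded_iff)

lemma lo_le_hi: "a1 \<le> x \<Longrightarrow> x \<le> b1 \<Longrightarrow> lo x \<le> hi x"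
  unfolding lo_def hi_def max.bounded_iff min.bounded_iff using cuts fit by (intro conjI; linarith)

lemma lo_step: "lo (x + 1) \<le> lo x + 1" "lo x \<le> lo (x + 1) + 1"
  unfolding lo_def by linarith+

lemma hi_step: "hi (x + 1) \<le> hi x + 1" "hi x \<le> hi (x + 1) + 1"
  unfolding hi_def by linarith+

lemma lo_ends: "lo a1 = a2 + s1" "lo b1 = a2 + s4" and hi_ends: "hi a1 = b2 - s2" "hi b1 = b2 - s3"
  unfolding lo_def hi_def using cuts fit by linarith+

lemma fst_pts: "fst ` pts = {a1..b1}"
proof -
  have "x \<in> fst ` pts" if "x \<in> {a1..b1}" for x
  proof -
    have "(x, lo x) \<in> pts" using that lo_le_hi[of x] by (simp add: pts_iff)
    then show ?thesis by force
  qed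
  moreover have "fst ` pts \<subseteq> {a1..b1}" by (auto simp: pts_def)
  ultimately show ?thesis by blast
qed

lemma finite_pts: "finite pts"
  by (rule finite_subset[of _ "{a1..b1} \<times> {a2..b2}"]) (auto simp: pts_def)

text \<open>\<open>lo\<close> and \<open>hi\<close> change by at most one from a column to the next.
  Hence an outside point over \<open>{a1..b1}\<close> with a horizontal neighbour in the octagon is
  already directly below or above its own column, and diagonals need no separate count.\<close>

lemma outer_pts:
  "outer pts = ((\<lambda>x. (x, lo x - 1)) ` {a1..b1} \<union> (\<lambda>x. (x, hi x + 1)) ` {a1..b1}) \<union>
    ({a1 - 1} \<times> {a2 + s1..b2 - s2} \<union> {b1 + 1} \<times> {a2 + s4..b2 - s3})" (is "_ = ?R")
proof (rule set_eqI_pair, rule iffI)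
  fix x y
  have inR: "(x, y) \<in> ?R \<longleftrightarrow> (a1 \<le> x \<and> x \<le> b1 \<and> (y = lo x - 1 \<or> y = hi x + 1)) \<or>
     (x = a1 - 1 \<and> lo a1 \<le> y \<and> y \<le> hi a1) \<or> (x = b1 + 1 \<and> lo b1 \<le> y \<and> y \<le> hi b1)"
    unfolding lo_ends hi_ends by auto
  have ab: "a1 \<le> b1" using cuts fit by linarith
  have ne: "a1 \<le> x \<Longrightarrow> x \<le> b1 \<Longrightarrow> lo x \<le> hi x" by (rule lo_le_hi)
  have lo: "lo (x + 1) \<le> lo x + 1" "lo x \<le> lo (x + 1) + 1" "lo x \<le> lo (x - 1) + 1" "lo (x - 1) \<le> lo x + 1"
    using lo_step[of x] lo_step[of "x - 1"] by simp_all
  have hi: "hi (x + 1) \<le> hi x + 1" "hi x \<le> hi (x + 1) + 1" "hi x \<le> hi (x - 1) + 1" "hi (x - 1) \<le> hi x + 1"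
    using hi_step[of x] hi_step[of "x - 1"] by simp_all
  show "(x, y) \<in> ?R" if "(x, y) \<in> outer pts"
  proof -
    have nin: "\<not> (a1 \<le> x \<and> x \<le> b1 \<and> lo x \<le> y \<and> y \<le> hi x)"
      using that by (simp add: outer_def pts_iff)
    have "(x + 1, y) \<in> pts \<or> (x - 1, y) \<in> pts \<or> (x, y + 1) \<in> pts \<or> (x, y - 1) \<in> pts"
      using that by (simp add: outer_def)
    then consider "(x + 1, y) \<in> pts" | "(x - 1, y) \<in> pts" | "(x, y + 1) \<in> pts" | "(x, y - 1) \<in> pts" by blast
    then show ?thesis
    proof cases
      case 1
      then have *: "a1 - 1 \<le> x" "x + 1 \<le> b1" "lo (x + 1) \<le> y" "y \<le> hi (x + 1)" by (simp_all add: pts_iff)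
      show ?thesis
      proof (cases "x = a1 - 1")
        case True
        then show ?thesis unfolding inR using * by simp
      next
        case False
        then have "a1 \<le> x" "x \<le> b1" using * by auto
        then show ?thesis unfolding inR using * nin lo hi by linarith
      qed
    next
      case 2
      then have *: "a1 \<le> x - 1" "x - 1 \<le> b1" "lo (x - 1) \<le> y" "y \<le> hi (x - 1)" by (simp_all add: pts_iff)
      show ?thesis
      proof (cases "x = b1 + 1")
        case True
        then show ?thesis unfolding inR using * by simp
      next
        case False
        then have "a1 \<le> x" "x \<le> b1" using * by auto
        then show ?thesis unfolding inR using * nin lo hi by linarith
      qed
    next
      case 3
      then have "a1 \<le> x" "x \<le> b1" "lo x \<le> y + 1" "y + 1 \<le> hi x" by (simp_all add: pts_iff)
      then show ?thesis unfolding inR using nin by linarith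
    next
      case 4
      then have "a1 \<le> x" "x \<le> b1" "lo x \<le> y - 1" "y - 1 \<le> hi x" by (simp_all add: pts_iff)
      then show ?thesis unfolding inR using nin by linarith
    qed
  qed
  show "(x, y) \<in> outer pts" if "(x, y) \<in> ?R"
  proof -
    from that[unfolded inR] consider "a1 \<le> x" "x \<le> b1" "y = lo x - 1" | "a1 \<le> x" "x \<le> b1" "y = hi x + 1"
      | "x = a1 - 1" "lo a1 \<le> y" "y \<le> hi a1" | "x = b1 + 1" "lo b1 \<le> y" "y \<le> hi b1" by blast
    then show ?thesis using ab ne by cases (simp_all add: outer_def pts_iff)
  qed
qed

lemma card_outer: "int (card (outer pts)) = 2 * (b1 - a1 + 1) + par_count 2 + par_count 4"
proof -
  define B where "B = (\<lambda>x. (x, lo x - 1)) ` {a1..b1}"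
  define T where "T = (\<lambda>x. (x, hi x + 1)) ` {a1..b1}"
  define Lf where "Lf = {a1 - 1} \<times> {a2 + s1..b2 - s2}"
  define R where "R = {b1 + 1} \<times> {a2 + s4..b2 - s3}"
  have fin: "finite B" "finite T" "finite Lf" "finite R" by (simp_all add: B_def T_def Lf_def R_def)
  have disj: "B \<inter> T = {}" "Lf \<inter> R = {}" "(B \<union> T) \<inter> (Lf \<union> R) = {}"
    using lo_le_hi fit cuts by (fastforce simp: B_def T_def Lf_def R_def)+
  have c: "card B = nat (b1 - a1 + 1)" "card T = nat (b1 - a1 + 1)"
    unfolding B_def T_def by (subst card_image; simp add: inj_on_def)+
  have "card (outer pts) = (card B + card T) + (card Lf + card R)"
    unfolding outer_pts B_def[symmetric] T_def[symmetric] Lf_def[symmetric] R_def[symmetric]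
    using fin disj by (simp add: card_Un_disjoint)
  then show ?thesis using fit cuts by (simp add: c Lf_def R_def par_count_def)
qed

text \<open>Negative values of \<open>diag_depth\<close> measure how far a point of the bounding rectangle lies outside
  the octagon, whichever corner it is in.\<close>

fun diag_depth :: "int \<times> int \<Rightarrow> int" where
  "diag_depth (x, y) =
     min (min (x + y - (a1 + a2 + s1)) (b1 + b2 - s3 - (x + y)))
       (min (x - y - (a1 - b2 + s2)) (b1 - a2 - s4 - (x - y)))"

declare diag_depth.simps [simp del]

lemma diag_depth_ge_iff:
  "t \<le> diag_depth (x, y) \<longleftrightarrow> t \<le> x + y - (a1 + a2 + s1) \<and> t \<le> b1 + b2 - s3 - (x + y) \<and>
     t \<le> x - y - (a1 - b2 + s2) \<and> t \<le> b1 - a2 - s4 - (x - y)"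
  unfolding diag_depth.simps min.bounded_iff by (simp only: conj_assoc)

lemmas diag_depth_le = diag_depth_ge_iff[THEN iffD1, OF order_refl]

text \<open>All four terms are affine with slope 1 or -1 in each coordinate, so each is strictly
  larger at an interior point than at one of the two ends. Strictness is what makes the arbitrary
  choice among ties in \<open>exists_upper_subset\<close> harmless.\<close>

lemma diag_depth_between:
  "x < t \<Longrightarrow> t < x' \<Longrightarrow> min (diag_depth (x, y)) (diag_depth (x', y)) < diag_depth (t, y)"
  "y < t \<Longrightarrow> t < y' \<Longrightarrow> min (diag_depth (x, y)) (diag_depth (x, y')) < diag_depth (x, t)"
proof -
  assume "x < t" "t < x'"
  then have "min (diag_depth (x, y)) (diag_depth (x', y)) + 1 \<le> diag_depth (t, y)"
    unfolding diag_depth_ge_iff using diag_depth_le[of x y] diag_depth_le[of x' y] by (intro conjI; linarith)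
  then show "min (diag_depth (x, y)) (diag_depth (x', y)) < diag_depth (t, y)" by simp
next
  assume "y < t" "t < y'"
  then have "min (diag_depth (x, y)) (diag_depth (x, y')) + 1 \<le> diag_depth (x, t)"
    unfolding diag_depth_ge_iff using diag_depth_le[of x y] diag_depth_le[of x y'] by (intro conjI; linarith)
  then show "min (diag_depth (x, y)) (diag_depth (x, y')) < diag_depth (x, t)" by simp
qed

text \<open>Adding the outer boundary relaxes all eight constraints by one. The relaxed diagonal
  constraints also remove the corners of the enlarged rectangle, even where the cut is 0.\<close>

lemma pts_Un_outer:
  "pts \<union> outer pts = {(x, y). a1 - 1 \<le> x \<and> x \<le> b1 + 1 \<and> a2 - 1 \<le> y \<and> y \<le> b2 + 1 \<and> -1 \<le> diag_depth (x, y)}"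
  (is "_ = ?C")
proof (rule set_eqI_pair)
  fix x y
  have lo: "lo x - 1 \<le> y \<longleftrightarrow> a2 - 1 \<le> y \<and> a1 + a2 + s1 - 1 \<le> x + y \<and> x - y \<le> b1 - a2 - s4 + 1"
    unfolding lo_def by auto
  have hi: "y \<le> hi x + 1 \<longleftrightarrow> y \<le> b2 + 1 \<and> x + y \<le> b1 + b2 - s3 + 1 \<and> a1 - b2 + s2 - 1 \<le> x - y"
    unfolding hi_def by auto
  have R: "(x, y) \<in> ?C
    \<longleftrightarrow> a1 - 1 \<le> x \<and> x \<le> b1 + 1 \<and> lo x - 1 \<le> y \<and> y \<le> hi x + 1"
    unfolding lo hi by (auto simp: diag_depth_ge_iff)
  have ne: "a1 \<le> x \<Longrightarrow> x \<le> b1 \<Longrightarrow> lo x \<le> hi x" by (rule lo_le_hi)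
  have "(x, y) \<in> pts \<union> outer pts \<longleftrightarrow> (a1 \<le> x \<and> x \<le> b1 \<and> lo x - 1 \<le> y \<and> y \<le> hi x + 1) \<or>
     (x = a1 - 1 \<and> a2 + s1 \<le> y \<and> y \<le> b2 - s2) \<or> (x = b1 + 1 \<and> a2 + s4 \<le> y \<and> y \<le> b2 - s3)"
    unfolding outer_pts Un_iff pts_iff using ne by auto
  also have "\<dots> \<longleftrightarrow> a1 - 1 \<le> x \<and> x \<le> b1 + 1 \<and> lo x - 1 \<le> y \<and> y \<le> hi x + 1"
  proof -
    have ends: "lo (a1 - 1) - 1 = a2 + s1" "hi (a1 - 1) + 1 = b2 - s2"
      "lo (b1 + 1) - 1 = a2 + s4" "hi (b1 + 1) + 1 = b2 - s3"
      unfolding lo_def hi_def using cuts fit by linarith+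
    have "a1 \<le> b1" using cuts fit by linarith
    consider "a1 \<le> x \<and> x \<le> b1" | "x = a1 - 1" | "x = b1 + 1" | "x < a1 - 1 \<or> b1 + 1 < x"
      by linarith
    then show ?thesis
    proof cases
      case 2
      then show ?thesis using ends(1,2) \<open>a1 \<le> b1\<close> by auto
    next
      case 3
      then show ?thesis using ends(3,4) \<open>a1 \<le> b1\<close> by auto
    qed (use \<open>a1 \<le> b1\<close> in auto)
  qed
  finally show "(x, y) \<in> pts \<union> outer pts \<longleftrightarrow> (x, y) \<in> ?C"
    unfolding R .
qed

text \<open>The bound is -2 because the layer of value -1 is occupied by the outer boundary.\<close>

definition pockets :: "(int \<times> int) set" where
  "pockets = {(x, y). a1 \<le> x \<and> x \<le> b1 \<and> a2 \<le> y \<and> y \<le> b2 \<and> diag_depth (x, y) \<le> -2}"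

lemma finite_pockets: "finite pockets"
  by (rule finite_subset[of _ "{a1..b1} \<times> {a2..b2}"]) (auto simp: pockets_def)

lemma card_pockets:
  assumes "s \<in> {s1, s2, s3, s4}"
  shows "s * (s - 1) \<le> 2 * int (card pockets)"
proof (cases "s \<le> 1")
  case True
  then have "s = 0 \<or> s = 1" using assms cuts by auto
  then show ?thesis by auto
next
  case False
  define n where "n = nat s"
  define Tri where "Tri = {(i, j). i + j + 2 \<le> (n::nat)}"
  have diag: "(x, y) \<in> pockets" if "a1 \<le> x" "x \<le> b1" "a2 \<le> y" "y \<le> b2"
    "x + y - (a1 + a2 + s1) \<le> -2 \<or> b1 + b2 - s3 - (x + y) \<le> -2 \<or>
     x - y - (a1 - b2 + s2) \<le> -2 \<or> b1 - a2 - s4 - (x - y) \<le> -2" for x y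
    using that diag_depth_le[of x y] unfolding pockets_def by auto
  have n: "int n = s" using False by (simp add: n_def)
  have inj: "card Tri \<le> card pockets"
    if "inj g" "inj h" "\<And>i j. int i + int j + 2 \<le> s \<Longrightarrow> (g i, h j) \<in> pockets" for g h :: "nat \<Rightarrow> int"
  proof (rule card_inj_on_le[OF _ _ finite_pockets])
    show "inj_on (\<lambda>(i, j). (g i, h j)) Tri" using that(1,2) by (auto simp: inj_on_def)
    show "(\<lambda>(i, j). (g i, h j)) ` Tri \<subseteq> pockets"
    proof clarify
      fix i j assume "(i, j) \<in> Tri"
      then have "int i + int j + 2 \<le> s" unfolding Tri_def n[symmetric] by auto
      then show "(g i, h j) \<in> pockets" by (rule that(3))
    qed
  qed
  have "card Tri \<le> card pockets"
  proof -
    consider "s = s1" | "s = s2" | "s = s3" | "s = s4" using assms by blast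
    then show ?thesis
    proof cases
      case 1
      show ?thesis
        by (rule inj[of "\<lambda>i. a1 + int i" "\<lambda>j. a2 + int j"])
          ((simp add: inj_def; fail)+, rule diag, (use 1 fit cuts in linarith)+)
    next
      case 2
      show ?thesis
        by (rule inj[of "\<lambda>i. a1 + int i" "\<lambda>j. b2 - int j"])
          ((simp add: inj_def; fail)+, rule diag, (use 2 fit cuts in linarith)+)
    next
      case 3
      show ?thesis
        by (rule inj[of "\<lambda>i. b1 - int i" "\<lambda>j. b2 - int j"])
          ((simp add: inj_def; fail)+, rule diag, (use 3 fit cuts in linarith)+)
    next
      case 4
      show ?thesis
        by (rule inj[of "\<lambda>i. b1 - int i" "\<lambda>j. a2 + int j"])
          ((simp add: inj_def; fail)+, rule diag, (use 4 fit cuts in linarith)+)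
    qed
  qed
  moreover have "2 * int (card Tri) = s * (s - 1)"
  proof -
    have "int (2 * card Tri) = int (n * (n - 1))" unfolding Tri_def card_triangle ..
    then show ?thesis using False n by (simp add: of_nat_diff)
  qed
  ultimately show ?thesis by linarith
qed

subsection \<open>Competitors\<close>

lemma pts_transposed: "lat_octagon.pts a2 b2 a1 b1 s1 s4 s3 s2 = prod.swap ` pts"
proof -
  interpret T: lat_octagon a2 b2 a1 b1 s1 s4 s3 s2 by (rule transposed)
  have "(y, x) \<in> T.pts \<longleftrightarrow> (x, y) \<in> pts" for x y
    unfolding T.pts_iff_depth pts_iff_depth depth_transposed ..
  then have "(y, x) \<in> T.pts \<longleftrightarrow> (y, x) \<in> prod.swap ` pts" for x y by force
  then show ?thesis by (intro set_eqI_pair)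
qed

lemma snd_pts: "snd ` pts = {a2..b2}"
proof -
  interpret T: lat_octagon a2 b2 a1 b1 s1 s4 s3 s2 by (rule transposed)
  have "fst ` T.pts = snd ` pts" unfolding pts_transposed by (simp add: image_image)
  then show ?thesis using T.fst_pts by simp
qed

lemma pts_convex:
  "(x, y) \<in> pts \<Longrightarrow> (x, y') \<in> pts \<Longrightarrow> y \<le> t \<Longrightarrow> t \<le> y' \<Longrightarrow> (x, t) \<in> pts"
  "(x, y) \<in> pts \<Longrightarrow> (x', y) \<in> pts \<Longrightarrow> x \<le> t \<Longrightarrow> t \<le> x' \<Longrightarrow> (t, y) \<in> pts"
  by (auto simp: pts_def)

text \<open>Surplus zeros are put into the pockets between the octagon and its bounding rectangle,
  the outermost layers last: this keeps rows and columns convex.\<close>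

lemma exists_shell:
  assumes s: "s \<in> {s1, s2, s3, s4}" and N: "card (outer pts) \<le> N"
    and room: "2 * (int N - int (card (outer pts))) \<le> s * (s - 1)"
  obtains Z where "finite Z" "card Z = N" "pts \<inter> Z = {}" "outer pts \<subseteq> Z"
    "pts \<union> Z \<subseteq> {a1 - 1..b1 + 1} \<times> {a2 - 1..b2 + 1}"
    "\<And>x y y' t. (x, y) \<in> pts \<union> Z \<Longrightarrow> (x, y') \<in> pts \<union> Z \<Longrightarrow> y \<le> t \<Longrightarrow> t \<le> y' \<Longrightarrow> (x, t) \<in> pts \<union> Z"
    "\<And>x x' y t. (x, y) \<in> pts \<union> Z \<Longrightarrow> (x', y) \<in> pts \<union> Z \<Longrightarrow> x \<le> t \<Longrightarrow> t \<le> x' \<Longrightarrow> (t, y) \<in> pts \<union> Z"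
proof -
  define C where "C = pts \<union> outer pts"
  have C: "(x, y) \<in> C \<longleftrightarrow> a1 - 1 \<le> x \<and> x \<le> b1 + 1 \<and> a2 - 1 \<le> y \<and> y \<le> b2 + 1 \<and> -1 \<le> diag_depth (x, y)"
    for x y unfolding C_def pts_Un_outer by simp
  have finC: "finite C"
    by (rule finite_subset[of _ "{a1 - 1..b1 + 1} \<times> {a2 - 1..b2 + 1}"]) (auto simp: C)
  have "2 * (int N - int (card (outer pts))) \<le> 2 * int (card pockets)"
    using room card_pockets[OF s] by (rule order_trans)
  then have "int N - int (card (outer pts)) \<le> int (card pockets)" by simp
  then have "N - card (outer pts) \<le> card pockets" by simp
  from exists_upper_subset[OF finite_pockets this, of diag_depth]
  obtain V where V: "V \<subseteq> pockets" "card V = N - card (outer pts)"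
    "\<forall>p\<in>V. \<forall>q\<in>pockets. diag_depth p < diag_depth q \<longrightarrow> q \<in> V"
    by (elim exE conjE)
  have disj: "C \<inter> V = {}"
    using V(1) by (auto simp: C pockets_def)
  have finV: "finite V" using V(1) finite_pockets finite_subset by blast
  define S where "S = C \<union> V"
  have SB: "S \<subseteq> {a1 - 1..b1 + 1} \<times> {a2 - 1..b2 + 1}"
    using V(1) by (auto simp: S_def C pockets_def)
  \<comment> \<open>If \<open>q\<close> is not in \<open>C\<close>, the end that is lower than
    \<open>q\<close> must be one of the added points, and \<open>q\<close> follows because these
    form an upper set within the pockets. The premise \<open>inside\<close> keeps \<open>q\<close>
    off the frame around the bounding rectangle, where no zeros may be added.\<close>
  have fill: "q \<in> S"
    if q: "q \<in> {a1 - 1..b1 + 1} \<times> {a2 - 1..b2 + 1}"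
      and pS: "p \<in> S" "p' \<in> S" and min: "min (diag_depth p) (diag_depth p') < diag_depth q"
      and inside: "p \<in> pockets \<or> p' \<in> pockets \<Longrightarrow> q \<in> {a1..b1} \<times> {a2..b2}" for p p' q
  proof (cases "-1 \<le> diag_depth q")
    case True
    then have "q \<in> C" using q by (cases q) (auto simp: C)
    then show ?thesis by (simp add: S_def)
  next
    case False
    have "r \<in> V" if "r \<in> S" "diag_depth r < diag_depth q" for r
      using that False by (cases r) (auto simp: S_def C)
    moreover have "diag_depth p < diag_depth q \<or> diag_depth p' < diag_depth q"
      using min by (simp add: min_less_iff_disj)
    ultimately obtain r where r: "r \<in> V" "diag_depth r < diag_depth q" "r = p \<or> r = p'"
      using pS by blast
    then have "q \<in> {a1..b1} \<times> {a2..b2}" using V(1) inside by blast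
    then have "q \<in> pockets" using False by (cases q) (auto simp: pockets_def)
    then show ?thesis using V(3) r by (auto simp: S_def)
  qed
  have v: "(x, t) \<in> S" if p: "(x, y) \<in> S" "(x, y') \<in> S" and "y \<le> t" "t \<le> y'" for x y y' t
  proof (cases "t = y \<or> t = y'")
    case False
    then have t: "y < t" "t < y'" using that by auto
    show ?thesis
    proof (rule fill[OF _ p diag_depth_between(2)[OF t]])
      show "(x, t) \<in> {a1 - 1..b1 + 1} \<times> {a2 - 1..b2 + 1}" using p t SB by auto
      have "a2 - 1 \<le> y" "y' \<le> b2 + 1" using p SB by auto
      then show "(x, t) \<in> {a1..b1} \<times> {a2..b2}" if "(x, y) \<in> pockets \<or> (x, y') \<in> pockets"
        using that t by (auto simp: pockets_def)
    qed
  qed (use that in auto)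
  have h: "(t, y) \<in> S" if p: "(x, y) \<in> S" "(x', y) \<in> S" and "x \<le> t" "t \<le> x'" for x x' y t
  proof (cases "t = x \<or> t = x'")
    case False
    then have t: "x < t" "t < x'" using that by auto
    show ?thesis
    proof (rule fill[OF _ p diag_depth_between(1)[OF t]])
      show "(t, y) \<in> {a1 - 1..b1 + 1} \<times> {a2 - 1..b2 + 1}" using p t SB by auto
      have "a1 - 1 \<le> x" "x' \<le> b1 + 1" using p SB by auto
      then show "(t, y) \<in> {a1..b1} \<times> {a2..b2}" if "(x, y) \<in> pockets \<or> (x', y) \<in> pockets"
        using that t by (auto simp: pockets_def)
    qed
  qed (use that in auto)
  have eq: "pts \<union> (outer pts \<union> V) = S" by (auto simp: S_def C_def)
  show ?thesis
  proof (rule that[of "outer pts \<union> V"])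
    show "finite (outer pts \<union> V)" using finC finV by (simp add: C_def)
    have "outer pts \<inter> V = {}" using disj by (auto simp: C_def)
    then show "card (outer pts \<union> V) = N"
      using finC finV V(2) N by (simp add: C_def card_Un_disjoint)
    show "pts \<inter> (outer pts \<union> V) = {}" using disj by (auto simp: C_def outer_def)
  qed (use SB v h in \<open>unfold eq, blast+\<close>)
qed

text \<open>The equality case of the perimeter bound. Zeros on the whole outer boundary rule out
  clashes, and convexity of the octagon and of its shell makes all lines unimodal, while the shell
  exceeds the bounding rectangle by one line on each side only.\<close>

lemma exists_competitor:
  assumes s: "s \<in> {s1, s2, s3, s4}" and N: "card (outer pts) \<le> N"
    and room: "2 * (int N - int (card (outer pts))) \<le> s * (s - 1)"
  obtains U :: "int \<times> int \<Rightarrow> real" where "range U \<subseteq> {-1, 0, 1}" "{p. U p = 1} = pts"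
    "finite {p. U p \<noteq> -1}" "card {p. U p = 0} = N"
    "\<And>x y. U (x, y) * U (x + 1, y) \<noteq> -1" "\<And>x y. U (x, y) * U (x, y + 1) \<noteq> -1"
    "\<And>l r. spin_box l r U \<Longrightarrow>
       column_cost l r U + column_cost l r (U \<circ> prod.swap) \<le> 4 * real_of_int ((b1 - a1 + 1) + (b2 - a2 + 1)) + 8"
proof -
  obtain Z where Z: "finite Z" "card Z = N" "pts \<inter> Z = {}" "outer pts \<subseteq> Z"
    "pts \<union> Z \<subseteq> {a1 - 1..b1 + 1} \<times> {a2 - 1..b2 + 1}"
    and v: "\<And>x y y' t. (x, y) \<in> pts \<union> Z \<Longrightarrow> (x, y') \<in> pts \<union> Z \<Longrightarrow> y \<le> t \<Longrightarrow> t \<le> y' \<Longrightarrow> (x, t) \<in> pts \<union> Z"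
    and h: "\<And>x x' y t. (x, y) \<in> pts \<union> Z \<Longrightarrow> (x', y) \<in> pts \<union> Z \<Longrightarrow> x \<le> t \<Longrightarrow> t \<le> x' \<Longrightarrow> (t, y) \<in> pts \<union> Z"
    using exists_shell[OF assms] by blast
  define U :: "int \<times> int \<Rightarrow> real" where "U p = (if p \<in> pts then 1 else if p \<in> Z then 0 else -1)" for p
  have J: "{p. U p = 1} = pts" by (auto simp: U_def)
  have S: "{p. U p \<noteq> -1} = pts \<union> Z" by (auto simp: U_def)
  have Z0: "{p. U p = 0} = Z" using Z(3) by (auto simp: U_def)
  have out: "q \<in> Z" if "p \<in> pts" "q \<notin> pts" "q \<in> {(fst p + 1, snd p), (fst p - 1, snd p), (fst p, snd p + 1), (fst p, snd p - 1)}" for p q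
    using that Z(4) by (cases p) (auto simp: outer_def)
  have c1: "U (x, y) * U (x + 1, y) \<noteq> -1" for x y
    using out[of "(x, y)" "(x + 1, y)"] out[of "(x + 1, y)" "(x, y)"] by (auto simp: U_def)
  have c2: "U (x, y) * U (x, y + 1) \<noteq> -1" for x y
    using out[of "(x, y)" "(x, y + 1)"] out[of "(x, y + 1)" "(x, y)"] by (auto simp: U_def)
  have ab: "a1 \<le> b1" "a2 \<le> b2" using cuts fit by linarith+
  show ?thesis
  proof (rule that[OF _ J _ _ c1 c2])
    show "range U \<subseteq> {-1, 0, 1}" by (auto simp: U_def)
    show "finite {p. U p \<noteq> -1}" unfolding S using Z(1) finite_pts by simp
    show "card {p. U p = 0} = N" unfolding Z0 by (rule Z(2))
    fix l r assume U: "spin_box l r U"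
    have Us: "spin_box l r (U \<circ> prod.swap)" using U by (auto simp: spin_box_def)
    have "column_cost l r U \<le> 4 * real (card (fst ` pts)) + 4"
    proof (rule column_cost_le[OF U c1 J[symmetric] S[symmetric]])
      show "fst ` pts = {a1..b1}" by (rule fst_pts)
      show "fst ` (pts \<union> Z) \<subseteq> {a1 - 1..b1 + 1}" using Z(5) by force
    qed (use ab v pts_convex in blast)+
    moreover have "column_cost l r (U \<circ> prod.swap) \<le> 4 * real (card (fst ` prod.swap ` pts)) + 4"
    proof (rule column_cost_le[OF Us, where S = "prod.swap ` (pts \<union> Z)"])
      show "(U \<circ> prod.swap) (x, y) * (U \<circ> prod.swap) (x + 1, y) \<noteq> - 1" for x y using c2 by simp
      show "prod.swap ` pts = {p. (U \<circ> prod.swap) p = 1}" unfolding J[symmetric] by force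
      show "prod.swap ` (pts \<union> Z) = {p. (U \<circ> prod.swap) p \<noteq> - 1}" unfolding S[symmetric] by force
      show "fst ` prod.swap ` pts = {a2..b2}" using snd_pts by (simp add: image_image)
      show "fst ` prod.swap ` (pts \<union> Z) \<subseteq> {a2 - 1..b2 + 1}" using Z(5) by force
      show "(x, t) \<in> prod.swap ` pts" if "(x, y) \<in> prod.swap ` pts" "(x, y') \<in> prod.swap ` pts" "y \<le> t" "t \<le> y'"
        for x y y' t using that pts_convex(2)[of y x y' t] by force
      show "(x, t) \<in> prod.swap ` (pts \<union> Z)"
        if "(x, y) \<in> prod.swap ` (pts \<union> Z)" "(x, y') \<in> prod.swap ` (pts \<union> Z)" "y \<le> t" "t \<le> y'"
        for x y y' t
      proof -
        have "(y, x) \<in> pts \<union> Z" "(y', x) \<in> pts \<union> Z" using that by auto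
        then have "(t, x) \<in> pts \<union> Z" using h that by blast
        then show ?thesis by force
      qed
    qed (rule ab)
    ultimately show "column_cost l r U + column_cost l r (U \<circ> prod.swap)
        \<le> 4 * real_of_int ((b1 - a1 + 1) + (b2 - a2 + 1)) + 8"
      using ab by (simp add: fst_pts snd_pts image_image)
  qed
qed

text \<open>If both coordinates differ, a step towards the target can be blocked by only one
  diagonal constraint. The step in the other coordinate then leads away from that diagonal, and the
  opposite diagonal is not in the way because every slice has at least two points.\<close>

lemma step_towards:
  assumes pc: "\<And>i. 2 \<le> par_count i" and p: "(x, y) \<in> pts" and q: "(x', y') \<in> pts"
    and "(x, y) \<noteq> (x', y')"
  shows "\<exists>r\<in>{(x + 1, y), (x - 1, y), (x, y + 1), (x, y - 1)}.
    r \<in> pts \<and> \<bar>fst r - x'\<bar> + \<bar>snd r - y'\<bar> < \<bar>x - x'\<bar> + \<bar>y - y'\<bar>"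
proof -
  have n: "2 \<le> b1 - a1 - s1 - s4 + 1" "2 \<le> b2 - a2 - s1 - s2 + 1" "2 \<le> b1 - a1 - s2 - s3 + 1"
    "2 \<le> b2 - a2 - s3 - s4 + 1"
    using pc[of 1] pc[of 2] pc[of 3] pc[of 4] by (simp_all add: par_count_def)
  have R: "x < x' \<and> (x + 1, y) \<in> pts \<Longrightarrow> ?thesis" and L: "x' < x \<and> (x - 1, y) \<in> pts \<Longrightarrow> ?thesis"
    and U: "y < y' \<and> (x, y + 1) \<in> pts \<Longrightarrow> ?thesis" and D: "y' < y \<and> (x, y - 1) \<in> pts \<Longrightarrow> ?thesis"
    by auto
  consider "x < x'" "y = y'" | "x' < x" "y = y'" | "x = x'" "y < y'" | "x = x'" "y' < y"
    | "x < x'" "y < y'" | "x < x'" "y' < y" | "x' < x" "y < y'" | "x' < x" "y' < y"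
    using less_linear[of x x'] less_linear[of y y'] assms(4) by blast
  then show ?thesis
  proof cases
    case 1
    then show ?thesis by (intro R) (use p q in \<open>auto simp: pts_def\<close>)
  next
    case 2
    then show ?thesis by (intro L) (use p q in \<open>auto simp: pts_def\<close>)
  next
    case 3
    then show ?thesis by (intro U) (use p q in \<open>auto simp: pts_def\<close>)
  next
    case 4
    then show ?thesis by (intro D) (use p q in \<open>auto simp: pts_def\<close>)
  next
    case 5
    then show ?thesis
    proof (cases "x - y < b1 - a2 - s4")
      case True
      then show ?thesis by (intro R) (use p q 5 in \<open>auto simp: pts_def\<close>)
    next
      case False
      then show ?thesis by (intro U) (use p q 5 n cuts in \<open>auto simp: pts_def\<close>)
    qed
  next
    case 6
    then show ?thesis
    proof (cases "x + y < b1 + b2 - s3")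
      case True
      then show ?thesis by (intro R) (use p q 6 in \<open>auto simp: pts_def\<close>)
    next
      case False
      then show ?thesis by (intro D) (use p q 6 n cuts in \<open>auto simp: pts_def\<close>)
    qed
  next
    case 7
    then show ?thesis
    proof (cases "a1 + a2 + s1 < x + y")
      case True
      then show ?thesis by (intro L) (use p q 7 in \<open>auto simp: pts_def\<close>)
    next
      case False
      then show ?thesis by (intro U) (use p q 7 n cuts in \<open>auto simp: pts_def\<close>)
    qed
  next
    case 8
    then show ?thesis
    proof (cases "a1 - b2 + s2 < x - y")
      case True
      then show ?thesis by (intro L) (use p q 8 in \<open>auto simp: pts_def\<close>)
    next
      case False
      then show ?thesis by (intro D) (use p q 8 n cuts in \<open>auto simp: pts_def\<close>)
    qed
  qed
qed

text \<open>The line of a diagonal stays where it is, so the cut loses the displacements of its two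
  adjacent sides. Once these exceed it, the constraint is redundant and the corner is a right angle,
  whence \<open>max 0\<close>.\<close>

lemma truncated:
  fixes m :: "nat \<Rightarrow> int"
  assumes m: "\<And>i. 0 \<le> m i" "\<And>i. m i \<le> M" and pc: "\<And>i. 2 * M + 1 \<le> par_count i"
  shows "lat_octagon (a1 + m 2) (b1 - m 4) (a2 + m 1) (b2 - m 3)
    (max 0 (s1 - m 1 - m 2)) (max 0 (s2 - m 2 - m 3)) (max 0 (s3 - m 3 - m 4)) (max 0 (s4 - m 1 - m 4))"
proof -
  have n: "2 * M \<le> b1 - a1 - s1 - s4" "2 * M \<le> b2 - a2 - s1 - s2" "2 * M \<le> b1 - a1 - s2 - s3"
    "2 * M \<le> b2 - a2 - s3 - s4"
    using pc[of 1] pc[of 2] pc[of 3] pc[of 4] by (simp_all add: par_count_def)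
  note b = m(1)[of 1] m(1)[of 2] m(1)[of 3] m(1)[of 4] m(2)[of 1] m(2)[of 2] m(2)[of 3] m(2)[of 4]
  show ?thesis
    by unfold_locales (use n b cuts in linarith)+
qed

lemma truncated_pts:
  fixes m :: "nat \<Rightarrow> int"
  assumes m: "\<And>i. 0 \<le> m i" "\<And>i. m i \<le> M" and pc: "\<And>i. 2 * M + 1 \<le> par_count i"
  shows "lat_octagon.pts (a1 + m 2) (b1 - m 4) (a2 + m 1) (b2 - m 3)
    (max 0 (s1 - m 1 - m 2)) (max 0 (s2 - m 2 - m 3)) (max 0 (s3 - m 3 - m 4)) (max 0 (s4 - m 1 - m 4))
    = pts \<inter> {a1 + m 2..b1 - m 4} \<times> {a2 + m 1..b2 - m 3}"
proof -
  interpret J: lat_octagon "a1 + m 2" "b1 - m 4" "a2 + m 1" "b2 - m 3" "max 0 (s1 - m 1 - m 2)"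
    "max 0 (s2 - m 2 - m 3)" "max 0 (s3 - m 3 - m 4)" "max 0 (s4 - m 1 - m 4)"
    by (rule truncated[OF m pc])
  note b = m(1)[of 1] m(1)[of 2] m(1)[of 3] m(1)[of 4]
  show ?thesis
  proof (rule set_eqI_pair, rule iffI)
    fix x y
    show "(x, y) \<in> pts \<inter> {a1 + m 2..b1 - m 4} \<times> {a2 + m 1..b2 - m 3}" if "(x, y) \<in> J.pts"
      using that b unfolding J.pts_def pts_def by auto
    show "(x, y) \<in> J.pts" if "(x, y) \<in> pts \<inter> {a1 + m 2..b1 - m 4} \<times> {a2 + m 1..b2 - m 3}"
      using that unfolding J.pts_def pts_def by auto
  qed
qed

text \<open>The outer boundary does not grow: the left side gains at most \<open>2 * m 2\<close> and
  the right side at most \<open>2 * m 4\<close>, while the width, counted twice, loses the sum of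
  these. So the zeros that surrounded the old octagon suffice to surround the new one.\<close>

lemma truncated_counts:
  fixes m :: "nat \<Rightarrow> int"
  assumes m: "\<And>i. 0 \<le> m i" "\<And>i. m i \<le> M" and pc: "\<And>i. 2 * M + 1 \<le> par_count i"
  shows "par_count i - 2 * M \<le> lat_octagon.par_count (a1 + m 2) (b1 - m 4) (a2 + m 1) (b2 - m 3)
    (max 0 (s1 - m 1 - m 2)) (max 0 (s2 - m 2 - m 3)) (max 0 (s3 - m 3 - m 4)) (max 0 (s4 - m 1 - m 4)) i" (is ?A)
    and "card (outer (lat_octagon.pts (a1 + m 2) (b1 - m 4) (a2 + m 1) (b2 - m 3)
    (max 0 (s1 - m 1 - m 2)) (max 0 (s2 - m 2 - m 3)) (max 0 (s3 - m 3 - m 4)) (max 0 (s4 - m 1 - m 4))))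
    \<le> card (outer pts)" (is ?B)
proof -
  interpret J: lat_octagon "a1 + m 2" "b1 - m 4" "a2 + m 1" "b2 - m 3" "max 0 (s1 - m 1 - m 2)"
    "max 0 (s2 - m 2 - m 3)" "max 0 (s3 - m 3 - m 4)" "max 0 (s4 - m 1 - m 4)"
    by (rule truncated[OF m pc])
  note b = m(1)[of 1] m(1)[of 2] m(1)[of 3] m(1)[of 4] m(2)[of 1] m(2)[of 2] m(2)[of 3] m(2)[of 4]
  show ?A unfolding J.par_count_def par_count_def using b cuts by (simp; linarith)
  have "J.par_count 2 \<le> par_count 2 + 2 * m 2" "J.par_count 4 \<le> par_count 4 + 2 * m 4"
    unfolding J.par_count_def par_count_def by (simp; linarith)+
  moreover have "2 * (b1 - m 4 - (a1 + m 2) + 1) + p + q \<le> 2 * (b1 - a1 + 1) + par_count 2 + par_count 4"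
    if "p \<le> par_count 2 + 2 * m 2" "q \<le> par_count 4 + 2 * m 4" for p q
    using that by (simp add: algebra_simps)
  ultimately have "int (card (outer J.pts)) \<le> int (card (outer pts))"
    unfolding J.card_outer card_outer by blast
  then show ?B by simp
qed

end

subsection \<open>Energy on the integer grid\<close>

definition emb :: "real \<Rightarrow> int \<times> int \<Rightarrow> pt" where
  "emb \<epsilon> p = (\<epsilon> * of_int (fst p), \<epsilon> * of_int (snd p))"

lemma lattice_eq: "lattice \<epsilon> = range (emb \<epsilon>)"
proof
  show "lattice \<epsilon> \<subseteq> range (emb \<epsilon>)"
  proof
    fix p assume "p \<in> lattice \<epsilon>"
    then obtain m n where "p = (\<epsilon> * of_int m, \<epsilon> * of_int n)" by (auto simp: lattice_def)
    then have "p = emb \<epsilon> (m, n)" by (simp add: emb_def)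
    then show "p \<in> range (emb \<epsilon>)" by simp
  qed
qed (auto simp: lattice_def emb_def)

lemma emb_in_lattice [simp]: "emb \<epsilon> p \<in> lattice \<epsilon>"
  by (simp add: lattice_eq)

lemma emb_eq_iff: "0 < \<epsilon> \<Longrightarrow> emb \<epsilon> p = emb \<epsilon> q \<longleftrightarrow> p = q"
  by (auto simp: emb_def prod_eq_iff)

lemma inj_emb: "0 < \<epsilon> \<Longrightarrow> inj (emb \<epsilon>)"
  by (simp add: inj_def emb_eq_iff)

lemma emb_image_iff: "0 < \<epsilon> \<Longrightarrow> emb \<epsilon> p \<in> emb \<epsilon> ` K \<longleftrightarrow> p \<in> K"
  by (auto simp: emb_eq_iff)

lemma sum_squares_eq_1: "a\<^sup>2 + b\<^sup>2 = 1 \<longleftrightarrow> \<bar>a\<bar> + \<bar>b\<bar> = 1" for a b :: int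
proof
  assume *: "a\<^sup>2 + b\<^sup>2 = 1"
  have "\<bar>a\<bar> \<le> 1 \<and> \<bar>b\<bar> \<le> 1"
  proof (rule ccontr)
    assume "\<not> ?thesis"
    then have "2 \<le> \<bar>a\<bar> \<or> 2 \<le> \<bar>b\<bar>" by auto
    then have "2\<^sup>2 \<le> \<bar>a\<bar>\<^sup>2 \<or> 2\<^sup>2 \<le> \<bar>b\<bar>\<^sup>2"
      using power_mono[of 2 "\<bar>a\<bar>" 2] power_mono[of 2 "\<bar>b\<bar>" 2] by auto
    then show False using * zero_le_power2[of a] zero_le_power2[of b] by auto
  qed
  then have "a \<in> {-1, 0, 1}" "b \<in> {-1, 0, 1}" by auto
  then show "\<bar>a\<bar> + \<bar>b\<bar> = 1" using * by auto
next
  assume "\<bar>a\<bar> + \<bar>b\<bar> = 1"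
  then have "a \<in> {-1, 0, 1}" "b \<in> {-1, 0, 1}" by auto
  then show "a\<^sup>2 + b\<^sup>2 = 1" using \<open>\<bar>a\<bar> + \<bar>b\<bar> = 1\<close> by auto
qed

lemma l1_dist_emb:
  "0 < \<epsilon> \<Longrightarrow> l1_dist (emb \<epsilon> p) (emb \<epsilon> q) = \<epsilon> * of_int (\<bar>fst p - fst q\<bar> + \<bar>snd p - snd q\<bar>)"
proof -
  assume "0 < \<epsilon>"
  then have "\<bar>\<epsilon> * a - \<epsilon> * b\<bar> = \<epsilon> * \<bar>a - b\<bar>" for a b :: real
    by (simp add: abs_mult flip: right_diff_distrib)
  then show ?thesis unfolding l1_dist_def emb_def by (simp add: distrib_left)
qed

lemma dist_emb:
  assumes "0 < \<epsilon>"
  shows "dist (emb \<epsilon> p) (emb \<epsilon> q) = \<epsilon> \<longleftrightarrow> \<bar>fst p - fst q\<bar> + \<bar>snd p - snd q\<bar> = 1"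
proof -
  define a where "a = fst p - fst q"
  define b where "b = snd p - snd q"
  have "dist (emb \<epsilon> p) (emb \<epsilon> q) = sqrt ((\<epsilon> * of_int a)\<^sup>2 + (\<epsilon> * of_int b)\<^sup>2)"
    unfolding emb_def dist_Pair_Pair by (simp add: dist_real_def a_def b_def right_diff_distrib)
  also have "\<dots> = sqrt (\<epsilon>\<^sup>2 * of_int (a\<^sup>2 + b\<^sup>2))" by (simp add: power_mult_distrib distrib_left)
  also have "\<dots> = \<epsilon> * sqrt (of_int (a\<^sup>2 + b\<^sup>2))" using assms by (simp add: real_sqrt_mult)
  finally have "dist (emb \<epsilon> p) (emb \<epsilon> q) = \<epsilon> \<longleftrightarrow> sqrt (of_int (a\<^sup>2 + b\<^sup>2)) = 1"
    using assms by auto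
  also have "\<dots> \<longleftrightarrow> a\<^sup>2 + b\<^sup>2 = 1"
    unfolding real_sqrt_eq_1_iff by linarith
  finally show ?thesis unfolding sum_squares_eq_1 a_def b_def .
qed

text \<open>Lists each bond exactly once, by its left or lower end and a flag for the horizontal
  direction.\<close>

fun bond_of :: "real \<Rightarrow> (int \<times> int) \<times> bool \<Rightarrow> pt set" where
  "bond_of \<epsilon> ((x, y), d) = {emb \<epsilon> (x, y), emb \<epsilon> (if d then (x + 1, y) else (x, y + 1))}"

lemma bonds_eq:
  assumes "0 < \<epsilon>"
  shows "bonds \<epsilon> = range (bond_of \<epsilon>)"
proof
  show "bonds \<epsilon> \<subseteq> range (bond_of \<epsilon>)"
  proof
    fix e assume "e \<in> bonds \<epsilon>"
    then obtain p' q' where "e = {p', q'}" "p' \<in> lattice \<epsilon>" "q' \<in> lattice \<epsilon>" "dist p' q' = \<epsilon>"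
      unfolding bonds_def by blast
    then obtain p q where e: "e = {emb \<epsilon> p, emb \<epsilon> q}" "dist (emb \<epsilon> p) (emb \<epsilon> q) = \<epsilon>"
      unfolding lattice_eq by blast
    obtain x y x' y' where pq: "p = (x, y)" "q = (x', y')" by (cases p, cases q)
    have "\<bar>x - x'\<bar> + \<bar>y - y'\<bar> = 1" using e(2) unfolding dist_emb[OF assms] pq by simp
    then consider "x' = x + 1" "y' = y" | "x = x' + 1" "y' = y" | "x' = x" "y' = y + 1" | "x' = x" "y = y' + 1"
      by linarith
    then have "e = bond_of \<epsilon> ((x, y), True) \<or> e = bond_of \<epsilon> ((x', y'), True) \<or>
      e = bond_of \<epsilon> ((x, y), False) \<or> e = bond_of \<epsilon> ((x', y'), False)"
      by cases (simp_all add: e pq insert_commute)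
    then show "e \<in> range (bond_of \<epsilon>)" by blast
  qed
  show "range (bond_of \<epsilon>) \<subseteq> bonds \<epsilon>"
  proof clarify
    fix x y :: int and d :: bool
    define q where "q = (if d then (x + 1, y) else (x, y + 1))"
    have "dist (emb \<epsilon> (x, y)) (emb \<epsilon> q) = \<epsilon>"
      unfolding dist_emb[OF assms] by (simp add: q_def)
    then show "bond_of \<epsilon> ((x, y), d) \<in> bonds \<epsilon>"
      unfolding bonds_def bond_of.simps q_def[symmetric] using emb_in_lattice by blast
  qed
qed

lemma inj_bond_of:
  assumes "0 < \<epsilon>"
  shows "inj (bond_of \<epsilon>)"
proof (rule injI)
  fix s t assume eq: "bond_of \<epsilon> s = bond_of \<epsilon> t"
  obtain x y d x' y' d' where st: "s = ((x, y), d)" "t = ((x', y'), d')"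
    by (metis surj_pair)
  have "{(x, y), if d then (x + 1, y) else (x, y + 1)} = {(x', y'), if d' then (x' + 1, y') else (x', y' + 1)}"
    using eq unfolding st bond_of.simps
    by (metis (no_types, lifting) image_empty image_insert inj_emb[OF assms] inj_image_eq_iff)
  then show "s = t" unfolding st doubleton_eq_iff by (auto split: if_splits)
qed

definition bond_cost :: "real \<Rightarrow> real \<Rightarrow> real \<Rightarrow> real" where
  "bond_cost k a b = 1 - a * b - k * (1 - (a * b)\<^sup>2)"

definition total_cost :: "real \<Rightarrow> int \<Rightarrow> int \<Rightarrow> (int \<times> int \<Rightarrow> real) \<Rightarrow> real" where
  "total_cost k l r U = (\<Sum>x\<in>{l..<r}. \<Sum>y\<in>{l..<r}.
     bond_cost k (U (x, y)) (U (x + 1, y)) + bond_cost k (U (x, y)) (U (x, y + 1)))"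

lemma energy_eq:
  assumes "0 < \<epsilon>" "k < 1" and U: "spin_box l r U" and u: "\<And>p. u (emb \<epsilon> p) = U p"
  shows "energy k \<epsilon> u = ennreal (\<epsilon> * total_cost k l r U)"
proof -
  define f where "f t = (case t of ((x, y), d) \<Rightarrow>
    \<epsilon> * bond_cost k (U (x, y)) (U (if d then (x + 1, y) else (x, y + 1))))" for t :: "(int \<times> int) \<times> bool"
  have nonneg: "0 \<le> bond_cost k (U p) (U q)" for p q
    using spin_box_cases[OF U, of p] spin_box_cases[OF U, of q] assms(2)
    by (auto simp: bond_cost_def)
  have f0: "0 \<le> f t" for t using nonneg assms(1) by (auto simp: f_def split: prod.splits)
  define B where "B = ({l..<r} \<times> {l..<r}) \<times> (UNIV :: bool set)"
  have "energy k \<epsilon> u = (\<Sum>\<^sub>\<infinity>t. ennreal (\<epsilon> * (1 - (\<Prod>p\<in>bond_of \<epsilon> t. u p) - k * (1 - (\<Prod>p\<in>bond_of \<epsilon> t. u p)\<^sup>2))))"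
    unfolding energy_def bonds_eq[OF assms(1)]
    by (subst infsum_reindex[OF inj_bond_of[OF assms(1)]]) (simp add: o_def)
  also have "\<dots> = (\<Sum>\<^sub>\<infinity>t. ennreal (f t))"
  proof (rule infsum_cong)
    fix t :: "(int \<times> int) \<times> bool"
    obtain x y d where t: "t = ((x, y), d)" by (metis surj_pair)
    have "emb \<epsilon> (x, y) \<noteq> emb \<epsilon> (if d then (x + 1, y) else (x, y + 1))"
      by (simp add: emb_eq_iff[OF assms(1)])
    then have "(\<Prod>p\<in>bond_of \<epsilon> t. u p) = U (x, y) * U (if d then (x + 1, y) else (x, y + 1))"
      unfolding t bond_of.simps by (simp add: u del: if_split)
    then show "ennreal (\<epsilon> * (1 - (\<Prod>p\<in>bond_of \<epsilon> t. u p) - k * (1 - (\<Prod>p\<in>bond_of \<epsilon> t. u p)\<^sup>2))) = ennreal (f t)"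
      by (simp add: f_def t bond_cost_def)
  qed
  also have "\<dots> = (\<Sum>\<^sub>\<infinity>t\<in>B. ennreal (f t))"
  proof (rule infsum_cong_neutral)
    fix t :: "(int \<times> int) \<times> bool" assume "t \<in> UNIV - B"
    moreover obtain x y d where t: "t = ((x, y), d)" by (metis surj_pair)
    ultimately have "(x, y) \<notin> {l..<r} \<times> {l..<r}" by (auto simp: B_def)
    then have "U (x, y) = -1" "U (x + 1, y) = -1" "U (x, y + 1) = -1"
      by (auto intro!: spin_box_outside[OF U])
    then show "ennreal (f t) = 0" by (simp add: f_def t bond_cost_def)
  qed auto
  also have "\<dots> = (\<Sum>t\<in>B. ennreal (f t))" by (rule infsum_finite) (simp add: B_def)
  also have "\<dots> = ennreal (\<Sum>t\<in>B. f t)" using f0 by (intro sum_ennreal) auto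
  also have "(\<Sum>t\<in>B. f t) = (\<Sum>p\<in>{l..<r} \<times> {l..<r}. \<Sum>d\<in>UNIV. f (p, d))"
    unfolding B_def by (simp add: sum.cartesian_product)
  also have "\<dots> = (\<Sum>p\<in>{l..<r} \<times> {l..<r}. f (p, True) + f (p, False))" by (simp add: UNIV_bool add.commute)
  also have "\<dots> = \<epsilon> * total_cost k l r U"
    unfolding total_cost_def sum.cartesian_product sum_distrib_left
    by (rule sum.cong) (auto simp: f_def distrib_left)
  finally show ?thesis .
qed

lemma count_zeros_shift:
  assumes U: "spin_box l r U" and d: "d \<in> {(0, 0), (1, 0), (0, 1)}"
  shows "(\<Sum>p\<in>{l..<r} \<times> {l..<r}. of_bool (U (fst p + fst d, snd p + snd d) = 0)) = real (card {p. U p = 0})"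
proof -
  define g where "g p = (fst p + fst d, snd p + snd d)" for p :: "int \<times> int"
  have inj: "inj_on g A" for A by (auto simp: inj_on_def g_def prod_eq_iff)
  have "g ` ({l..<r} \<times> {l..<r} \<inter> {p. U (g p) = 0}) = {p. U p = 0}"
  proof (rule set_eqI, rule iffI)
    fix q assume q: "q \<in> {p. U p = 0}"
    have "q \<in> {l<..<r} \<times> {l<..<r}" using spin_box_outside[OF U, of q] q by force
    then have "(fst q - fst d, snd q - snd d) \<in> {l..<r} \<times> {l..<r}" using d by auto
    moreover have "g (fst q - fst d, snd q - snd d) = q" by (simp add: g_def)
    ultimately show "q \<in> g ` ({l..<r} \<times> {l..<r} \<inter> {p. U (g p) = 0})" using q
      by (intro image_eqI[of q g "(fst q - fst d, snd q - snd d)"]) auto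
  qed auto
  then have "card {p. U p = 0} = card ({l..<r} \<times> {l..<r} \<inter> {p. U (g p) = 0})"
    using card_image[OF inj] by metis
  then show ?thesis unfolding g_def by (subst sum_of_bool_eq) auto
qed

text \<open>A check of nine pairs. A bond with a zero costs \<open>1 - k\<close> whatever its other
  end is, which the jump and the two zero counts reproduce exactly; only the contact of 1 and -1
  gives an inequality, \<open>2 * (1 - k) \<le> 2\<close>.\<close>

lemma bond_cost_ge:
  assumes "a \<in> {-1, 0, 1}" "b \<in> {-1, 0, 1}" "0 \<le> k"
  shows "(1 - k) / 2 * (\<bar>a - b\<bar> + clash a b + of_bool (a = 0) + of_bool (b = 0)) \<le> bond_cost k a b"
    and "a * b \<noteq> -1 \<Longrightarrow> bond_cost k a b = (1 - k) / 2 * (\<bar>a - b\<bar> + clash a b + of_bool (a = 0) + of_bool (b = 0))"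
  using assms by (auto simp: bond_cost_def clash_def field_simps)

text \<open>The energy bound in units of \<open>(1 - k) / 2\<close>, with \<open>\<epsilon>\<close>
  removed. The factor 4 appears because a zero is an end of four bonds.\<close>

definition reduced_cost :: "int \<Rightarrow> int \<Rightarrow> (int \<times> int \<Rightarrow> real) \<Rightarrow> real" where
  "reduced_cost l r U = column_cost l r U + column_cost l r (U \<circ> prod.swap) + 4 * real (card {p. U p = 0})"

lemma reduced_cost_eq:
  assumes U: "spin_box l r U"
  shows "reduced_cost l r U = (\<Sum>(x, y)\<in>{l..<r} \<times> {l..<r}.
    (\<bar>U (x, y) - U (x + 1, y)\<bar> + clash (U (x, y)) (U (x + 1, y)) + of_bool (U (x, y) = 0) + of_bool (U (x + 1, y) = 0)) +
    (\<bar>U (x, y) - U (x, y + 1)\<bar> + clash (U (x, y)) (U (x, y + 1)) + of_bool (U (x, y) = 0) + of_bool (U (x, y + 1) = 0)))" (is "_ = ?R")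
proof -
  let ?B = "{l..<r} \<times> {l..<r}"
  have c1: "column_cost l r U = (\<Sum>(x, y)\<in>?B. \<bar>U (x, y) - U (x, y + 1)\<bar> + clash (U (x, y)) (U (x + 1, y)))"
    unfolding column_cost_def by (simp add: sum.cartesian_product)
  have c2: "column_cost l r (U \<circ> prod.swap) = (\<Sum>(x, y)\<in>?B. \<bar>U (x, y) - U (x + 1, y)\<bar> + clash (U (x, y)) (U (x, y + 1)))"
    unfolding column_cost_def by (subst sum.swap) (simp add: sum.cartesian_product)
  have z: "real (card {p. U p = 0}) = (\<Sum>(x, y)\<in>?B. of_bool (U (x, y) = 0))"
    "real (card {p. U p = 0}) = (\<Sum>(x, y)\<in>?B. of_bool (U (x + 1, y) = 0))"
    "real (card {p. U p = 0}) = (\<Sum>(x, y)\<in>?B. of_bool (U (x, y + 1) = 0))"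
    using count_zeros_shift[OF U, of "(0, 0)"] count_zeros_shift[OF U, of "(1, 0)"]
      count_zeros_shift[OF U, of "(0, 1)"] by (simp_all add: case_prod_unfold)
  have "reduced_cost l r U = column_cost l r U + column_cost l r (U \<circ> prod.swap) +
     (real (card {p. U p = 0}) + real (card {p. U p = 0}) + real (card {p. U p = 0}) + real (card {p. U p = 0}))"
    unfolding reduced_cost_def by simp
  also have "\<dots> = (\<Sum>(x, y)\<in>?B. \<bar>U (x, y) - U (x, y + 1)\<bar> + clash (U (x, y)) (U (x + 1, y))) +
     (\<Sum>(x, y)\<in>?B. \<bar>U (x, y) - U (x + 1, y)\<bar> + clash (U (x, y)) (U (x, y + 1))) +
     ((\<Sum>(x, y)\<in>?B. of_bool (U (x, y) = 0)) + (\<Sum>(x, y)\<in>?B. of_bool (U (x, y) = 0)) +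
      (\<Sum>(x, y)\<in>?B. of_bool (U (x + 1, y) = 0)) + (\<Sum>(x, y)\<in>?B. of_bool (U (x, y + 1) = 0)))"
    by (simp only: c1 c2 z(1)[symmetric] z(2)[symmetric] z(3)[symmetric])
  also have "\<dots> = ?R"
    unfolding case_prod_unfold sum.distrib[symmetric] by (rule sum.cong) auto
  finally show ?thesis .
qed

lemma total_cost_ge:
  assumes U: "spin_box l r U" and "0 \<le> k"
  shows "(1 - k) / 2 * reduced_cost l r U \<le> total_cost k l r U"
proof -
  have r: "U p \<in> {-1, 0, 1}" for p using spin_box_cases[OF U, of p] by auto
  have add: "c * (a + b) \<le> a' + b'" if "c * a \<le> a'" "c * b \<le> b'" for a a' b b' c :: real
    using that by (simp add: distrib_left)
  show ?thesis
    unfolding reduced_cost_eq[OF U] total_cost_def sum.cartesian_product sum_distrib_left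
    unfolding case_prod_unfold by (intro sum_mono add bond_cost_ge(1)[OF r r assms(2)])
qed

lemma total_cost_eq:
  assumes U: "spin_box l r U" and "0 \<le> k"
    and "\<And>x y. U (x, y) * U (x + 1, y) \<noteq> -1" "\<And>x y. U (x, y) * U (x, y + 1) \<noteq> -1"
  shows "total_cost k l r U = (1 - k) / 2 * reduced_cost l r U"
proof -
  have r: "U p \<in> {-1, 0, 1}" for p using spin_box_cases[OF U, of p] by auto
  show ?thesis
    unfolding reduced_cost_eq[OF U] total_cost_def sum.cartesian_product sum_distrib_left
    by (intro sum.cong refl) (simp add: case_prod_unfold bond_cost_ge(2)[OF r r assms(2)] assms(3,4) distrib_left)
qed

lemma reduced_cost_ge:
  assumes U: "spin_box l r U"
  shows "4 * real (card {p. U p = 0}) \<le> reduced_cost l r U"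
    and "{p. U p = 1} \<noteq> {} \<Longrightarrow> 4 * (real (card (fst ` {p. U p = 1})) + real (card (snd ` {p. U p = 1}))) + 8 +
      4 * real (card {p. U p = 0}) \<le> reduced_cost l r U"
proof -
  show "4 * real (card {p. U p = 0}) \<le> reduced_cost l r U"
    unfolding reduced_cost_def using column_cost_nonneg[of l r U] column_cost_nonneg[of l r "U \<circ> prod.swap"] by simp
  assume ne: "{p. U p = 1} \<noteq> {}"
  have sw: "{p. (U \<circ> prod.swap) p = 1} = prod.swap ` {p. U p = 1}" by force
  have "spin_box l r (U \<circ> prod.swap)" using U by (auto simp: spin_box_def)
  from column_cost_ge[OF this] have "4 * real (card (snd ` {p. U p = 1})) + 4 \<le> column_cost l r (U \<circ> prod.swap)"
    unfolding sw using ne by (simp add: image_image)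
  then show "4 * (real (card (fst ` {p. U p = 1})) + real (card (snd ` {p. U p = 1}))) + 8 +
      4 * real (card {p. U p = 0}) \<le> reduced_cost l r U"
    unfolding reduced_cost_def using column_cost_ge[OF U ne] by simp
qed

subsection \<open>Distance to the boundary and dissipation\<close>

lemma infsum_ennreal_eq_top:
  fixes f :: "'a \<Rightarrow> ennreal"
  assumes "infinite A" "0 < c" "\<And>x. x \<in> A \<Longrightarrow> ennreal c \<le> f x"
  shows "(\<Sum>\<^sub>\<infinity>x\<in>A. f x) = top"
proof (rule ccontr)
  assume "(\<Sum>\<^sub>\<infinity>x\<in>A. f x) \<noteq> top"
  then obtain r where r: "0 \<le> r" "(\<Sum>\<^sub>\<infinity>x\<in>A. f x) = ennreal r" using ennreal_cases by blast
  obtain n :: nat where n: "r < real n * c" using reals_Archimedean3[OF assms(2)] by blast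
  obtain F where F: "finite F" "F \<subseteq> A" "card F = n" using infinite_arbitrarily_large[OF assms(1)] by blast
  have "ennreal (real n * c) = (\<Sum>x\<in>F. ennreal c)"
    using F assms(2) by (simp add: ennreal_mult ennreal_of_nat_eq_real_of_nat)
  also have "\<dots> \<le> (\<Sum>x\<in>F. f x)" by (rule sum_mono) (use F assms(3) in auto)
  also have "\<dots> = (\<Sum>\<^sub>\<infinity>x\<in>F. f x)" using F(1) by simp
  also have "\<dots> \<le> (\<Sum>\<^sub>\<infinity>x\<in>A. f x)"
    by (rule infsum_mono_neutral) (use F in \<open>auto intro: nonneg_summable_on_complete\<close>)
  finally show False unfolding r(2) using n r(1) by (simp add: ennreal_le_iff)
qed

lemma l1_dist_emb_ge: "0 < \<epsilon> \<Longrightarrow> p \<noteq> q \<Longrightarrow> \<epsilon> \<le> l1_dist (emb \<epsilon> p) (emb \<epsilon> q)"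
proof -
  assume *: "0 < \<epsilon>" "p \<noteq> q"
  then have "1 \<le> \<bar>fst p - fst q\<bar> + \<bar>snd p - snd q\<bar>" by (cases p, cases q) auto
  then have "(1::real) \<le> of_int (\<bar>fst p - fst q\<bar> + \<bar>snd p - snd q\<bar>)" by linarith
  then show ?thesis unfolding l1_dist_emb[OF *(1)] using *(1) by (simp only: mult_le_cancel_left1) auto
qed

lemma d1_outside:
  assumes "0 < \<epsilon>" "p \<notin> K"
  shows "ennreal \<epsilon> \<le> d1 \<epsilon> (emb \<epsilon> p) (emb \<epsilon> ` K)"
proof -
  have "ennreal \<epsilon> \<le> ennreal (l1_dist (emb \<epsilon> p) q)" if "q \<in> emb \<epsilon> ` K" for q
  proof -
    from that obtain q' where "q = emb \<epsilon> q'" "q' \<in> K" by blast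
    then show ?thesis using l1_dist_emb_ge[OF assms(1), of p q'] assms(2) by (auto intro: ennreal_leI)
  qed
  then have "ennreal \<epsilon> \<le> (INF q\<in>emb \<epsilon> ` K. ennreal (l1_dist (emb \<epsilon> p) q))"
    by (rule INF_greatest)
  then show ?thesis using assms(2) by (simp only: d1_def emb_image_iff[OF assms(1)] if_False)
qed

text \<open>Lattice distances are multiples of \<open>\<epsilon>\<close>, so a point without a
  neighbour in \<open>K\<close> is at distance at least \<open>2 * \<epsilon>\<close>; this includes
  the infinite distance from an empty set.\<close>

lemma outer_boundary_emb:
  assumes "0 < \<epsilon>"
  shows "outer_boundary \<epsilon> (emb \<epsilon> ` K) = emb \<epsilon> ` outer K"
proof -
  have *: "d1 \<epsilon> (emb \<epsilon> p) (emb \<epsilon> ` K) = ennreal \<epsilon> \<longleftrightarrow> p \<in> outer K" if p: "p \<notin> K" for p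
  proof
    assume eq: "d1 \<epsilon> (emb \<epsilon> p) (emb \<epsilon> ` K) = ennreal \<epsilon>"
    have "\<exists>q\<in>K. \<bar>fst p - fst q\<bar> + \<bar>snd p - snd q\<bar> = 1"
    proof (rule ccontr)
      assume none: "\<not> ?thesis"
      have "ennreal (2 * \<epsilon>) \<le> d1 \<epsilon> (emb \<epsilon> p) (emb \<epsilon> ` K)"
      proof -
        have "ennreal (2 * \<epsilon>) \<le> ennreal (l1_dist (emb \<epsilon> p) (emb \<epsilon> q))" if "q \<in> K" for q
        proof (rule ennreal_leI)
          have "p \<noteq> q" using p that by blast
          then have "0 < \<bar>fst p - fst q\<bar> + \<bar>snd p - snd q\<bar>" by (cases p, cases q) auto
          then have "2 \<le> \<bar>fst p - fst q\<bar> + \<bar>snd p - snd q\<bar>" using none that by force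
          then have "(2::real) \<le> of_int (\<bar>fst p - fst q\<bar> + \<bar>snd p - snd q\<bar>)" by linarith
          then show "2 * \<epsilon> \<le> l1_dist (emb \<epsilon> p) (emb \<epsilon> q)"
            unfolding l1_dist_emb[OF assms] using assms by (metis mult.commute mult_le_cancel_left_pos)
        qed
        then show ?thesis using p by (auto simp: d1_def emb_image_iff[OF assms] intro: INF_greatest)
      qed
      then have "ennreal (2 * \<epsilon>) \<le> ennreal \<epsilon>" unfolding eq .
      then show False using assms by (simp add: ennreal_le_iff)
    qed
    then obtain q where q: "q \<in> K" "\<bar>fst p - fst q\<bar> + \<bar>snd p - snd q\<bar> = 1" by blast
    obtain x y x' y' where pq: "p = (x, y)" "q = (x', y')" by (cases p, cases q)
    have "\<bar>x - x'\<bar> + \<bar>y - y'\<bar> = 1" using q(2) unfolding pq by simp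
    then consider "x' = x + 1" "y' = y" | "x' = x - 1" "y' = y" | "x' = x" "y' = y + 1" | "x' = x" "y' = y - 1"
      by linarith
    then show "p \<in> outer K" using p q(1) unfolding pq outer_def by cases simp_all
  next
    assume "p \<in> outer K"
    then obtain q where q: "q \<in> K" "\<bar>fst p - fst q\<bar> + \<bar>snd p - snd q\<bar> = 1"
      by (force simp: outer_def)
    have "d1 \<epsilon> (emb \<epsilon> p) (emb \<epsilon> ` K) \<le> ennreal (l1_dist (emb \<epsilon> p) (emb \<epsilon> q))"
      using p q(1) by (auto simp: d1_def emb_image_iff[OF assms] intro: INF_lower)
    also have "\<dots> = ennreal \<epsilon>" unfolding l1_dist_emb[OF assms] q(2) by simp
    finally show "d1 \<epsilon> (emb \<epsilon> p) (emb \<epsilon> ` K) = ennreal \<epsilon>"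
      using d1_outside[OF assms p] by (rule antisym)
  qed
  show ?thesis
  proof (rule set_eqI)
    fix z
    show "z \<in> outer_boundary \<epsilon> (emb \<epsilon> ` K) \<longleftrightarrow> z \<in> emb \<epsilon> ` outer K"
    proof (cases "z \<in> lattice \<epsilon>")
      case True
      then obtain p where z: "z = emb \<epsilon> p" unfolding lattice_eq by blast
      show ?thesis unfolding z outer_boundary_def emb_image_iff[OF assms]
        using *[of p] by (auto simp: emb_image_iff[OF assms] outer_def)
    next
      case False
      then show ?thesis by (auto simp: outer_boundary_def)
    qed
  qed
qed

section \<open>Depth as distance to the complement, and the dissipation\<close>

context lat_octagon
begin

lemma depth_lipschitz: "depth p - (\<bar>fst p - fst q\<bar> + \<bar>snd p - snd q\<bar>) \<le> depth q"
proof -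
  obtain x y x' y' where pq: "p = (x, y)" "q = (x', y')" by (cases p, cases q)
  show ?thesis
    unfolding pq depth_ge_iff fst_conv snd_conv using depth_le[of x y] by (intro conjI; linarith)
qed

text \<open>Walking \<open>depth p\<close> steps straight in a coordinate direction violates a
  tightest constraint. \<open>depth_lipschitz\<close> shows that no shorter way out exists.\<close>

lemma depth_attained:
  assumes "p \<in> pts"
  shows "\<exists>q. q \<notin> pts \<and> \<bar>fst p - fst q\<bar> + \<bar>snd p - snd q\<bar> = depth p"
proof -
  obtain x y where p: "p = (x, y)" by (cases p)
  define t where "t = depth (x, y)"
  have t: "1 \<le> t" using assms unfolding pts_iff_depth p t_def .
  have "\<not> t + 1 \<le> depth (x, y)" by (simp add: t_def)
  then consider "x - a1 + 1 \<le> t \<or> x + y - (a1 + a2 + s1) + 1 \<le> t \<or> x - y - (a1 - b2 + s2) + 1 \<le> t"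
    | "b1 - x + 1 \<le> t \<or> b1 + b2 - s3 - (x + y) + 1 \<le> t \<or> b1 - a2 - s4 - (x - y) + 1 \<le> t"
    | "y - a2 + 1 \<le> t" | "b2 - y + 1 \<le> t"
    unfolding depth_ge_iff by linarith
  then have "\<exists>q\<in>{(x - t, y), (x + t, y), (x, y - t), (x, y + t)}. q \<notin> pts"
    by cases (auto simp: pts_def)
  then obtain q where q: "q \<in> {(x - t, y), (x + t, y), (x, y - t), (x, y + t)}" "q \<notin> pts" by blast
  have "\<bar>fst p - fst q\<bar> + \<bar>snd p - snd q\<bar> = t" using q(1) t by (auto simp: p)
  then show ?thesis using q(2) unfolding p t_def by blast
qed

lemma d1_inside:
  assumes "0 < \<epsilon>" "p \<in> pts"
  shows "d1 \<epsilon> (emb \<epsilon> p) (emb \<epsilon> ` pts) = ennreal (\<epsilon> * of_int (depth p))"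
proof -
  have d: "d1 \<epsilon> (emb \<epsilon> p) (emb \<epsilon> ` pts) = (INF q\<in>- pts. ennreal (l1_dist (emb \<epsilon> p) (emb \<epsilon> q)))"
  proof -
    have "lattice \<epsilon> - emb \<epsilon> ` pts = emb \<epsilon> ` (- pts)"
      unfolding lattice_eq using inj_emb[OF assms(1)] by (auto simp: emb_eq_iff[OF assms(1)])
    then show ?thesis using assms(2) by (simp add: d1_def image_image)
  qed
  show ?thesis
  proof (rule antisym)
    obtain q where q: "q \<notin> pts" "\<bar>fst p - fst q\<bar> + \<bar>snd p - snd q\<bar> = depth p"
      using depth_attained[OF assms(2)] by blast
    have "d1 \<epsilon> (emb \<epsilon> p) (emb \<epsilon> ` pts) \<le> ennreal (l1_dist (emb \<epsilon> p) (emb \<epsilon> q))"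
      unfolding d using q(1) by (intro INF_lower) auto
    then show "d1 \<epsilon> (emb \<epsilon> p) (emb \<epsilon> ` pts) \<le> ennreal (\<epsilon> * of_int (depth p))"
      unfolding l1_dist_emb[OF assms(1)] q(2) .
    show "ennreal (\<epsilon> * of_int (depth p)) \<le> d1 \<epsilon> (emb \<epsilon> p) (emb \<epsilon> ` pts)"
      unfolding d
    proof (intro INF_greatest ennreal_leI)
      fix q assume "q \<in> - pts"
      then have "depth q \<le> 0" by (simp add: pts_iff_depth)
      then have "depth p \<le> \<bar>fst p - fst q\<bar> + \<bar>snd p - snd q\<bar>" using depth_lipschitz[of p q] by linarith
      then show "\<epsilon> * of_int (depth p) \<le> l1_dist (emb \<epsilon> p) (emb \<epsilon> q)"
        unfolding l1_dist_emb[OF assms(1)] using assms(1)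
        by (intro mult_left_mono, subst of_int_le_iff) auto
    qed
  qed
qed

definition dissipation :: "real \<Rightarrow> (int \<times> int) set \<Rightarrow> ennreal" where
  "dissipation \<epsilon> J =
     (\<Sum>\<^sub>\<infinity>p\<in>sym_diff (emb \<epsilon> ` J) (emb \<epsilon> ` pts). ennreal (\<epsilon>\<^sup>2) * d1 \<epsilon> p (emb \<epsilon> ` pts))"

lemma dissipation_reindex:
  assumes "0 < \<epsilon>"
  shows "dissipation \<epsilon> J =
    (\<Sum>\<^sub>\<infinity>p\<in>sym_diff J pts. ennreal (\<epsilon>\<^sup>2) * d1 \<epsilon> (emb \<epsilon> p) (emb \<epsilon> ` pts))"
proof -
  have "sym_diff (emb \<epsilon> ` J) (emb \<epsilon> ` pts) = emb \<epsilon> ` (sym_diff J pts)"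
    using inj_emb[OF assms] by (simp add: image_Un image_set_diff)
  moreover have "inj_on (emb \<epsilon>) (sym_diff J pts)"
    using inj_emb[OF assms] by (rule inj_on_subset) simp
  ultimately show ?thesis
    unfolding dissipation_def by (simp add: infsum_reindex o_def)
qed

lemma weight_sum_nonneg: "0 \<le> sum weight A"
  by (simp add: sum_nonneg weight_nonneg)

lemma weight_inside: "p \<in> pts \<Longrightarrow> weight p = of_int (depth p)" and weight_ge_1: "p \<in> pts \<Longrightarrow> 1 \<le> weight p"
  by (simp_all add: weight_def pts_iff_depth)

lemma dissipation_inside:
  assumes "0 < \<epsilon>" "p \<in> pts"
  shows "ennreal (\<epsilon>\<^sup>2) * d1 \<epsilon> (emb \<epsilon> p) (emb \<epsilon> ` pts) = ennreal (\<epsilon> ^ 3 * weight p)"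
  using assms weight_inside[OF assms(2)] weight_nonneg[of p] unfolding d1_inside[OF assms]
  by (subst ennreal_mult[symmetric]) (auto simp: power2_eq_square power3_eq_cube mult_ac)

lemma dissipation_outside:
  assumes "0 < \<epsilon>" "p \<notin> pts"
  shows "ennreal (\<epsilon> ^ 3) \<le> ennreal (\<epsilon>\<^sup>2) * d1 \<epsilon> (emb \<epsilon> p) (emb \<epsilon> ` pts)"
proof -
  have "ennreal (\<epsilon> ^ 3) = ennreal (\<epsilon>\<^sup>2) * ennreal \<epsilon>"
    using assms(1) by (subst ennreal_mult[symmetric]) (auto simp: power2_eq_square power3_eq_cube)
  also have "\<dots> \<le> ennreal (\<epsilon>\<^sup>2) * d1 \<epsilon> (emb \<epsilon> p) (emb \<epsilon> ` pts)"
    by (intro mult_left_mono d1_outside assms) simp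
  finally show ?thesis .
qed

lemma dissipation_infinite:
  assumes "0 < \<epsilon>" "infinite J"
  shows "dissipation \<epsilon> J = top"
  unfolding dissipation_reindex[OF assms(1)]
proof (rule infsum_ennreal_eq_top[of _ "\<epsilon> ^ 3"])
  have "infinite (J - pts)" using assms(2) finite_pts by simp
  then show "infinite (sym_diff J pts)" by simp
  fix p assume "p \<in> sym_diff J pts"
  show "ennreal (\<epsilon> ^ 3) \<le> ennreal (\<epsilon>\<^sup>2) * d1 \<epsilon> (emb \<epsilon> p) (emb \<epsilon> ` pts)"
  proof (cases "p \<in> pts")
    case True
    then show ?thesis unfolding dissipation_inside[OF assms(1) True]
      using assms(1) weight_ge_1[OF True] by (intro ennreal_leI) simp
  qed (rule dissipation_outside[OF assms(1)])
qed (use assms in simp)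

text \<open>Points outside the octagon are counted with the minimal distance
  \<open>\<epsilon>\<close> only. Any positive cost is enough to exclude them from a
  minimizer.\<close>

lemma dissipation_ge:
  assumes "0 < \<epsilon>" "finite J"
  shows "ennreal (\<epsilon> ^ 3 * (sum weight (pts - J) + real (card (J - pts)))) \<le> dissipation \<epsilon> J"
proof -
  define g where "g p = ennreal (\<epsilon>\<^sup>2) * d1 \<epsilon> (emb \<epsilon> p) (emb \<epsilon> ` pts)" for p
  have "ennreal (\<epsilon> ^ 3 * (sum weight (pts - J) + real (card (J - pts)))) =
     ennreal (\<Sum>p\<in>pts - J. \<epsilon> ^ 3 * weight p) + ennreal (\<Sum>p\<in>J - pts. \<epsilon> ^ 3)"
    using assms by (subst ennreal_plus[symmetric])
      (auto simp: distrib_left sum_distrib_left weight_nonneg mult.commute intro!: sum_nonneg)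
  also have "\<dots> = (\<Sum>p\<in>pts - J. ennreal (\<epsilon> ^ 3 * weight p)) + (\<Sum>p\<in>J - pts. ennreal (\<epsilon> ^ 3))"
    using assms(1) weight_nonneg by (simp add: sum_ennreal del: sum_constant)
  also have "\<dots> \<le> (\<Sum>p\<in>pts - J. g p) + (\<Sum>p\<in>J - pts. g p)"
    unfolding g_def using dissipation_inside[OF assms(1)] dissipation_outside[OF assms(1)]
    by (intro add_mono sum_mono) auto
  also have "\<dots> = (\<Sum>p\<in>sym_diff J pts. g p)"
    using assms(2) finite_pts by (subst sum.union_disjoint) (auto simp: add.commute)
  also have "\<dots> = dissipation \<epsilon> J"
    unfolding dissipation_reindex[OF assms(1)] g_def using assms(2) finite_pts by simp
  finally show ?thesis .
qed

lemma dissipation_eq: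
  assumes "0 < \<epsilon>" "J \<subseteq> pts"
  shows "dissipation \<epsilon> J = ennreal (\<epsilon> ^ 3 * sum weight (pts - J))"
proof -
  have "sym_diff J pts = pts - J" using assms(2) by auto
  then have "dissipation \<epsilon> J = (\<Sum>p\<in>pts - J. ennreal (\<epsilon>\<^sup>2) * d1 \<epsilon> (emb \<epsilon> p) (emb \<epsilon> ` pts))"
    unfolding dissipation_reindex[OF assms(1)] using finite_pts by simp
  also have "\<dots> = (\<Sum>p\<in>pts - J. ennreal (\<epsilon> ^ 3 * weight p))"
    by (rule sum.cong) (auto simp: dissipation_inside[OF assms(1)])
  also have "\<dots> = ennreal (\<epsilon> ^ 3 * sum weight (pts - J))"
    using assms(1) weight_nonneg by (simp add: sum_ennreal sum_distrib_left)
  finally show ?thesis .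
qed

end

subsection \<open>Minimizers\<close>

lemma phaseI_emb: "phaseI \<epsilon> u = emb \<epsilon> ` {p. u (emb \<epsilon> p) = 1}"
  unfolding phaseI_def lattice_eq by auto

lemma phaseZ_emb: "phaseZ \<epsilon> u = emb \<epsilon> ` {p. u (emb \<epsilon> p) = 0}"
  unfolding phaseZ_def lattice_eq by auto

lemma card_phaseZ: "0 < \<epsilon> \<Longrightarrow> card (phaseZ \<epsilon> u) = card {p. u (emb \<epsilon> p) = 0}"
  unfolding phaseZ_emb by (rule card_image) (rule inj_on_subset[OF inj_emb], simp_all)

lemma spin_box_exists:
  assumes "range U \<subseteq> {-1, 0, 1}" "finite {p. U p \<noteq> -1}" "range V \<subseteq> {-1, 0, 1}" "finite {p. V p \<noteq> -1}"
  obtains l r where "spin_box l r U" "spin_box l r V"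
proof -
  define F where "F = {p. U p \<noteq> -1} \<union> {p. V p \<noteq> -1}"
  define G where "G = fst ` F \<union> snd ` F \<union> {0}"
  have G: "finite G" using assms by (simp add: G_def F_def)
  have "F \<subseteq> {Min G - 1<..<Max G + 1} \<times> {Min G - 1<..<Max G + 1}"
  proof
    fix p assume "p \<in> F"
    then have "fst p \<in> G" "snd p \<in> G" by (auto simp: G_def)
    then have "Min G \<le> fst p" "fst p \<le> Max G" "Min G \<le> snd p" "snd p \<le> Max G" using G by auto
    then show "p \<in> {Min G - 1<..<Max G + 1} \<times> {Min G - 1<..<Max G + 1}" by (cases p) auto
  qed
  then show ?thesis
    using assms by (intro that[of "Min G - 1" "Max G + 1"]) (auto simp: spin_box_def F_def)
qed

context lat_octagon
begin

lemma dissipation_functional: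
  assumes "phaseI \<epsilon> w = emb \<epsilon> ` pts"
  shows "functional k \<tau> \<gamma> \<epsilon> u w = energy k \<epsilon> u + ennreal (1 / \<tau>) *
    (dissipation \<epsilon> {p. u (emb \<epsilon> p) = 1} +
     ennreal (\<epsilon> powr \<gamma> * \<bar>real (card (phaseZ \<epsilon> u)) - real (card (phaseZ \<epsilon> w))\<bar>))"
  unfolding functional_def dissipation_def assms phaseI_emb[of \<epsilon> u] ..

text \<open>\<open>functional_eq\<close> is the equality case: a phase inside the octagon, no
  clashes and an unchanged number of zeros.\<close>

lemma functional_ge:
  assumes \<epsilon>: "0 < \<epsilon>" "0 < \<tau>" and k: "0 \<le> k" "k < 1" and w: "phaseI \<epsilon> w = emb \<epsilon> ` pts"
    and U: "spin_box l r U" and u: "\<And>p. u (emb \<epsilon> p) = U p" and J: "J = {p. U p = 1}"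
  shows "ennreal (\<epsilon> * ((1 - k) / 2 * reduced_cost l r U) + 1 / \<tau> * (\<epsilon> ^ 3 * (sum weight (pts - J) + real (card (J - pts)))
      + \<epsilon> powr \<gamma> * \<bar>real (card {p. U p = 0}) - real (card (phaseZ \<epsilon> w))\<bar>)) \<le> functional k \<tau> \<gamma> \<epsilon> u w"
proof -
  have "J \<subseteq> {p. U p \<noteq> -1}" by (auto simp: J)
  also have "\<dots> \<subseteq> {l<..<r} \<times> {l<..<r}" using U by (simp add: spin_box_def)
  finally have finJ: "finite J" by (rule finite_subset) simp
  have Z: "real (card (phaseZ \<epsilon> u)) = real (card {p. U p = 0})" using card_phaseZ[OF \<epsilon>(1), of u] by (simp add: u)
  let ?D = "\<epsilon> ^ 3 * (sum weight (pts - J) + real (card (J - pts)))"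
  let ?P = "\<epsilon> powr \<gamma> * \<bar>real (card {p. U p = 0}) - real (card (phaseZ \<epsilon> w))\<bar>"
  let ?E = "\<epsilon> * ((1 - k) / 2 * reduced_cost l r U)"
  have nn: "0 \<le> ?D" "0 \<le> ?P" "0 \<le> ?E"
    using \<epsilon> k reduced_cost_ge(1)[OF U] weight_sum_nonneg[of "pts - J"] by auto
  have "ennreal (?E + 1 / \<tau> * (?D + ?P)) = ennreal ?E + ennreal (1 / \<tau>) * (ennreal ?D + ennreal ?P)"
    using nn \<epsilon> by (simp only: ennreal_plus ennreal_mult add_nonneg_nonneg mult_nonneg_nonneg divide_nonneg_nonneg zero_le_one less_imp_le)
  also have "\<dots> \<le> energy k \<epsilon> u + ennreal (1 / \<tau>) * (dissipation \<epsilon> {p. u (emb \<epsilon> p) = 1} + ennreal ?P)"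
  proof (intro add_mono mult_left_mono order_refl)
    show "ennreal ?E \<le> energy k \<epsilon> u"
      unfolding energy_eq[OF \<epsilon>(1) k(2) U u]
      using total_cost_ge[OF U k(1)] \<epsilon>(1) by (intro ennreal_leI mult_left_mono) auto
    show "ennreal ?D \<le> dissipation \<epsilon> {p. u (emb \<epsilon> p) = 1}"
      unfolding u J[symmetric] by (rule dissipation_ge[OF \<epsilon>(1) finJ])
  qed simp
  finally show ?thesis unfolding dissipation_functional[OF w] Z .
qed

lemma functional_eq:
  assumes \<epsilon>: "0 < \<epsilon>" "0 < \<tau>" and k: "0 \<le> k" "k < 1" and w: "phaseI \<epsilon> w = emb \<epsilon> ` pts"
    and U: "spin_box l r U" and u: "\<And>p. u (emb \<epsilon> p) = U p" and J: "J = {p. U p = 1}" "J \<subseteq> pts"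
    and N: "card {p. U p = 0} = card (phaseZ \<epsilon> w)"
    and nc: "\<And>x y. U (x, y) * U (x + 1, y) \<noteq> -1" "\<And>x y. U (x, y) * U (x, y + 1) \<noteq> -1"
  shows "functional k \<tau> \<gamma> \<epsilon> u w =
    ennreal (\<epsilon> * ((1 - k) / 2 * reduced_cost l r U) + 1 / \<tau> * (\<epsilon> ^ 3 * sum weight (pts - J)))"
proof -
  have Z: "card (phaseZ \<epsilon> u) = card (phaseZ \<epsilon> w)" using card_phaseZ[OF \<epsilon>(1), of u] N by (simp add: u)
  let ?D = "\<epsilon> ^ 3 * sum weight (pts - J)"
  let ?E = "\<epsilon> * ((1 - k) / 2 * reduced_cost l r U)"
  have nn: "0 \<le> ?D" "0 \<le> ?E"
    using \<epsilon> k reduced_cost_ge(1)[OF U] weight_sum_nonneg[of "pts - J"] by auto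
  have "functional k \<tau> \<gamma> \<epsilon> u w = ennreal ?E + ennreal (1 / \<tau>) * ennreal ?D"
    unfolding dissipation_functional[OF w] Z u J(1)[symmetric] dissipation_eq[OF \<epsilon>(1) J(2)]
      energy_eq[OF \<epsilon>(1) k(2) U u] total_cost_eq[OF U k(1) nc] by simp
  also have "\<dots> = ennreal (?E + 1 / \<tau> * ?D)"
    using nn \<epsilon> by (simp only: ennreal_plus ennreal_mult mult_nonneg_nonneg divide_nonneg_nonneg zero_le_one less_imp_le)
  finally show ?thesis .
qed

lemma sum_weight_box:
  assumes "finite X" "finite Y"
  shows "(\<Sum>x\<in>X. \<Sum>y\<in>Y. weight (x, y)) = sum weight (pts \<inter> X \<times> Y)"
proof -
  have "(\<Sum>x\<in>X. \<Sum>y\<in>Y. weight (x, y)) = sum weight (X \<times> Y)"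
    by (simp add: sum.cartesian_product)
  also have "\<dots> = sum weight (pts \<inter> X \<times> Y)"
    using assms by (intro sum.mono_neutral_right) (use weight_outside in auto)
  finally show ?thesis .
qed

text \<open>Divided by \<open>\<epsilon>\<^sup>2 / \<zeta>\<close>, the left-hand side of the assumption bounds the functional of a
  configuration with phase \<open>J\<close> from below, up to an additive constant.\<close>

lemma optimal_phase:
  assumes opt: "optimal_pair weight lam {a1..b1} {a2..b2} Xo Yo" and "0 < lam" and finJ: "finite J"
    and le: "lam * (real (card (fst ` J)) + real (card (snd ` J))) - sum weight (pts \<inter> J) + real (card (J - pts))
      \<le> - net_gain weight lam Xo Yo"
  obtains X Y where "optimal_pair weight lam {a1..b1} {a2..b2} X Y" "J = pts \<inter> X \<times> Y"
proof -
  define X where "X = fst ` J \<inter> {a1..b1}"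
  define Y where "Y = snd ` J \<inter> {a2..b2}"
  have sub: "X \<subseteq> {a1..b1}" "Y \<subseteq> {a2..b2}" by (auto simp: X_def Y_def)
  have fin: "finite X" "finite Y" using finJ by (auto simp: X_def Y_def)
  have J: "pts \<inter> J \<subseteq> pts \<inter> X \<times> Y"
    by (force simp: X_def Y_def pts_def)
  have finP: "finite (pts \<inter> X \<times> Y)" using finite_pts by simp
  have W: "sum weight (pts \<inter> J) \<le> sum weight (pts \<inter> X \<times> Y)"
    using J finP weight_nonneg by (intro sum_mono2) auto
  have "real (card X) \<le> real (card (fst ` J))" "real (card Y) \<le> real (card (snd ` J))"
    using finJ by (auto simp: X_def Y_def intro!: card_mono)
  then have C: "lam * (real (card X) + real (card Y)) \<le> lam * (real (card (fst ` J)) + real (card (snd ` J)))"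
    using \<open>0 < lam\<close> by (intro mult_left_mono) auto
  have G: "net_gain weight lam X Y = sum weight (pts \<inter> X \<times> Y) - lam * (real (card X) + real (card Y))"
    unfolding net_gain_def sum_weight_box[OF fin] ..
  have le': "net_gain weight lam X Y \<le> net_gain weight lam Xo Yo"
    using opt sub by (simp add: optimal_pair_def)
  \<comment> \<open>The hypothesis closes a chain of inequalities, so all of them are equalities:
    the pair is optimal too, no weight is missing, and nothing lies outside the octagon.\<close>
  have eq: "net_gain weight lam X Y = net_gain weight lam Xo Yo"
    "sum weight (pts \<inter> J) = sum weight (pts \<inter> X \<times> Y)" "real (card (J - pts)) = 0"
    using le le' W C of_nat_0_le_iff[of "card (J - pts)", where 'a = real] unfolding G by linarith+
  have "J \<subseteq> pts" using eq(3) finJ by auto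
  moreover have "pts \<inter> X \<times> Y \<subseteq> J"
  proof
    fix p assume p: "p \<in> pts \<inter> X \<times> Y"
    show "p \<in> J"
    proof (rule ccontr)
      assume "p \<notin> J"
      then have "sum weight (insert p (pts \<inter> J)) \<le> sum weight (pts \<inter> X \<times> Y)"
        using p J finP weight_nonneg by (intro sum_mono2) auto
      then have "weight p + sum weight (pts \<inter> J) \<le> sum weight (pts \<inter> X \<times> Y)"
        using \<open>p \<notin> J\<close> finJ by simp
      then show False using eq(2) weight_ge_1[of p] p by auto
    qed
  qed
  ultimately have "J = pts \<inter> X \<times> Y" using J by auto
  moreover have "optimal_pair weight lam {a1..b1} {a2..b2} X Y"
    using opt sub eq(1) by (simp add: optimal_pair_def)
  ultimately show ?thesis by (rule that[rotated])
qed

text \<open>The functional of the minimizer is compared with that of a competitor whose phase comes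
  from some optimal pair. After rescaling, this is the inequality required by
  \<open>optimal_phase\<close>, which returns a possibly different optimal pair for the
  minimizer.\<close>

lemma minimizer_shape:
  assumes \<epsilon>: "0 < \<epsilon>" "0 < \<zeta>" and k: "0 \<le> k" "k < 1"
    and w: "w \<in> configs \<epsilon>" "phaseI \<epsilon> w = emb \<epsilon> ` pts" "outer_boundary \<epsilon> (phaseI \<epsilon> w) \<subseteq> phaseZ \<epsilon> w"
    and min: "minimizer k (\<zeta> * \<epsilon>) \<gamma> \<epsilon> w u"
    and M: "0 \<le> M" "4 * M + 4 \<le> L" and L: "\<And>i. L \<le> par_count i"
    and lam: "lam = 2 * (1 - k) * \<zeta> / \<epsilon>" "4 * lam \<le> of_int ((M + 1) * (L - 2 * M))"
    and pen: "2 * (1 - k) * \<epsilon> \<le> \<epsilon> powr \<gamma> / (\<zeta> * \<epsilon>)"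
    and room: "s \<in> {s1, s2, s3, s4}" "2 * M + 1 \<le> s"
      "2 * int (card (phaseZ \<epsilon> w)) \<le> (s - 2 * M) * (s - 2 * M - 1)"
  obtains m :: "nat \<Rightarrow> int" where "\<And>i. 0 \<le> m i" "\<And>i. m i \<le> M"
    "\<And>i. of_int (m i * (par_count i - 2 * M)) \<le> lam"
    "\<And>i. lam \<le> of_int ((m i + 1) * (par_count i + 2 * (m i + 1)))"
    "phaseI \<epsilon> u = emb \<epsilon> ` (pts \<inter> {a1 + m 2..b1 - m 4} \<times> {a2 + m 1..b2 - m 3})"
proof -
  define N where "N = card (phaseZ \<epsilon> w)"
  define \<tau> where "\<tau> = \<zeta> * \<epsilon>"
  have \<tau>: "0 < \<tau>" using \<epsilon> by (simp add: \<tau>_def)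
  have lam0: "0 < lam" using \<epsilon> k by (simp add: lam)
  have pc: "2 * M + 1 \<le> par_count i" for i using L[of i] M by linarith
  obtain Xo Yo where opt: "optimal_pair weight lam {a1..b1} {a2..b2} Xo Yo"
    using optimal_pair_exists by blast
  obtain mo :: "nat \<Rightarrow> int" where mo: "\<And>i. 0 \<le> mo i" "\<And>i. mo i \<le> M"
    "Xo = {a1 + mo 2..b1 - mo 4}" "Yo = {a2 + mo 1..b2 - mo 3}"
    by (rule optimal_shape[OF M L lam0 lam(2) opt]) blast
  interpret J: lat_octagon "a1 + mo 2" "b1 - mo 4" "a2 + mo 1" "b2 - mo 3" "max 0 (s1 - mo 1 - mo 2)"
    "max 0 (s2 - mo 2 - mo 3)" "max 0 (s3 - mo 3 - mo 4)" "max 0 (s4 - mo 1 - mo 4)"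
    by (rule truncated[OF mo(1,2) pc])
  have Jpts: "J.pts = pts \<inter> Xo \<times> Yo" unfolding mo(3,4) by (rule truncated_pts[OF mo(1,2) pc])
  have outN: "card (outer J.pts) \<le> N"
  proof -
    have "finite (phaseZ \<epsilon> w)" using w(1) by (simp add: configs_def phaseZ_def)
    then have "card (emb \<epsilon> ` outer pts) \<le> N"
      using w(3) unfolding w(2) outer_boundary_emb[OF \<epsilon>(1)] N_def by (rule card_mono)
    moreover have "card (emb \<epsilon> ` outer pts) = card (outer pts)"
      by (rule card_image) (rule inj_on_subset[OF inj_emb[OF \<epsilon>(1)]], simp)
    moreover have "card (outer J.pts) \<le> card (outer pts)" by (rule truncated_counts(2)[OF mo(1,2) pc])
    ultimately show ?thesis by simp
  qed
  \<comment> \<open>Each diagonal loses at most \<open>2 * M\<close> steps under truncation, so the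
    long one still provides a large pocket.\<close>
  obtain s' where s': "s' \<in> {max 0 (s1 - mo 1 - mo 2), max 0 (s2 - mo 2 - mo 3),
      max 0 (s3 - mo 3 - mo 4), max 0 (s4 - mo 1 - mo 4)}" "s - 2 * M \<le> s'"
  proof -
    note b = mo(2)[of 1] mo(2)[of 2] mo(2)[of 3] mo(2)[of 4]
    consider "s = s1" | "s = s2" | "s = s3" | "s = s4" using room(1) by blast
    then show ?thesis
    proof cases
      case 1 then show ?thesis using b by (intro that[of "max 0 (s1 - mo 1 - mo 2)"]) auto
    next
      case 2 then show ?thesis using b by (intro that[of "max 0 (s2 - mo 2 - mo 3)"]) auto
    next
      case 3 then show ?thesis using b by (intro that[of "max 0 (s3 - mo 3 - mo 4)"]) auto
    next
      case 4 then show ?thesis using b by (intro that[of "max 0 (s4 - mo 1 - mo 4)"]) auto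
    qed
  qed
  have "(s - 2 * M) * (s - 2 * M - 1) \<le> s' * (s' - 1)" using s'(2) room(2) by (intro mult_mono) auto
  then have roomJ: "2 * (int N - int (card (outer J.pts))) \<le> s' * (s' - 1)"
  proof -
    have "2 * (int N - int (card (outer J.pts))) \<le> 2 * int N" by simp
    also have "\<dots> \<le> (s - 2 * M) * (s - 2 * M - 1)" using room(3) by (simp add: N_def)
    also note \<open>\<dots> \<le> s' * (s' - 1)\<close>
    finally show ?thesis .
  qed
  obtain V :: "int \<times> int \<Rightarrow> real" where V: "range V \<subseteq> {-1, 0, 1}" "{p. V p = 1} = J.pts"
    "finite {p. V p \<noteq> -1}" "card {p. V p = 0} = N"
    and ncV: "\<And>x y. V (x, y) * V (x + 1, y) \<noteq> -1" "\<And>x y. V (x, y) * V (x, y + 1) \<noteq> -1"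
    and cV: "\<And>l r. spin_box l r V \<Longrightarrow> column_cost l r V + column_cost l r (V \<circ> prod.swap)
        \<le> 4 * real_of_int ((b1 - mo 4 - (a1 + mo 2) + 1) + (b2 - mo 3 - (a2 + mo 1) + 1)) + 8"
    by (rule J.exists_competitor[OF s'(1) outN roomJ]) blast
  define v where "v p = (if p \<in> lattice \<epsilon> then V (inv (emb \<epsilon>) p) else 0)" for p
  have v: "v (emb \<epsilon> p) = V p" for p
    using inv_f_f[OF inj_emb[OF \<epsilon>(1)]] by (simp add: v_def)
  have vc: "v \<in> configs \<epsilon>"
  proof -
    have "finite (phaseZ \<epsilon> v)"
    proof -
      have "finite {p. V p = 0}" by (rule finite_subset[OF _ V(3)]) auto
      then show ?thesis unfolding phaseZ_emb v by simp
    qed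
    moreover have "v \<in> lattice \<epsilon> \<rightarrow> {-1, 0, 1}" using V(1) v by (auto simp: lattice_eq)
    ultimately show ?thesis by (simp add: configs_def phaseZ_def)
  qed
  have le: "functional k \<tau> \<gamma> \<epsilon> u w \<le> functional k \<tau> \<gamma> \<epsilon> v w"
    using min vc by (simp add: minimizer_def \<tau>_def)
  have Jsub: "{p. V p = 1} \<subseteq> pts" unfolding V(2) Jpts by blast
  have Fv: "functional k \<tau> \<gamma> \<epsilon> v w = ennreal (\<epsilon> * ((1 - k) / 2 * reduced_cost l r V) +
      1 / \<tau> * (\<epsilon> ^ 3 * sum weight (pts - J.pts)))" if "spin_box l r V" for l r
    using functional_eq[OF \<epsilon>(1) \<tau> k w(2) that v refl Jsub _ ncV] V(2,4) by (simp add: N_def)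
  define U where "U p = u (emb \<epsilon> p)" for p
  define K where "K = {p. U p = 1}"
  have uc: "u \<in> configs \<epsilon>" using min by (simp add: minimizer_def)
  \<comment> \<open>The competitor has a finite functional, whereas an infinite phase has infinite
    dissipation. Only now is the minimizer known to be -1 outside a box.\<close>
  have finK: "finite K"
  proof (rule ccontr)
    assume "infinite K"
    then have "dissipation \<epsilon> {p. u (emb \<epsilon> p) = 1} = top"
      unfolding K_def U_def by (rule dissipation_infinite[OF \<epsilon>(1)])
    then have "functional k \<tau> \<gamma> \<epsilon> u w = top"
      unfolding dissipation_functional[OF w(2)] using \<tau> by (simp add: ennreal_mult_top)
    moreover obtain l r where "spin_box l r V" using spin_box_exists[OF V(1,3) V(1,3)] by blast
    ultimately show False using le Fv by (simp add: top_unique)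
  qed
  have rU: "range U \<subseteq> {-1, 0, 1}" using uc by (auto simp: U_def configs_def Pi_iff)
  have finZ: "finite {p. U p = 0}"
  proof -
    have "finite (phaseZ \<epsilon> u)" using uc by (simp add: configs_def phaseZ_def)
    then show ?thesis unfolding phaseZ_emb U_def
      by (rule finite_imageD) (rule inj_on_subset[OF inj_emb[OF \<epsilon>(1)]], simp)
  qed
  have "{p. U p \<noteq> -1} \<subseteq> K \<union> {p. U p = 0}" using rU by (force simp: K_def)
  then have finU: "finite {p. U p \<noteq> -1}" using finK finZ finite_subset by blast
  obtain l r where bU: "spin_box l r U" and bV: "spin_box l r V"
    using spin_box_exists[OF rU finU V(1,3)] by blast
  define Nu where "Nu = card {p. U p = 0}"
  \<comment> \<open>The unit in which a point at depth \<open>t\<close> dissipates \<open>t\<close>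
    and a unit of \<open>reduced_cost\<close> amounts to \<open>lam / 4\<close>.\<close>
  define c where "c = \<epsilon>\<^sup>2 / \<zeta>"
  have c0: "0 < c" using \<epsilon> by (simp add: c_def)
  have c1: "\<epsilon> * ((1 - k) / 2 * x) = c * (lam / 4 * x)" for x
    using \<epsilon> by (simp add: c_def lam field_simps power2_eq_square)
  have c2: "1 / \<tau> * (\<epsilon> ^ 3 * x) = c * x" for x
    using \<epsilon> by (simp add: c_def \<tau>_def field_simps power2_eq_square power3_eq_cube)
  \<comment> \<open>In these units a zero carries energy \<open>lam\<close>, and \<open>pen\<close>
    says that the penalty per zero gained or lost is at least as much. Changing the number of zeros
    therefore never pays, as used in \<open>NN\<close>.\<close>
  have c3: "c * (lam * \<bar>real Nu - real N\<bar>) \<le> 1 / \<tau> * (\<epsilon> powr \<gamma> * \<bar>real Nu - real N\<bar>)"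
  proof -
    have "c * lam \<le> \<epsilon> powr \<gamma> / \<tau>" using pen \<epsilon> by (simp add: c_def lam \<tau>_def power2_eq_square mult_ac)
    then have "c * lam * \<bar>real Nu - real N\<bar> \<le> \<epsilon> powr \<gamma> / \<tau> * \<bar>real Nu - real N\<bar>"
      by (rule mult_right_mono) simp
    then show ?thesis by (simp add: mult_ac)
  qed
  have "ennreal (\<epsilon> * ((1 - k) / 2 * reduced_cost l r U) + 1 / \<tau> * (\<epsilon> ^ 3 * (sum weight (pts - K) + real (card (K - pts)))
      + \<epsilon> powr \<gamma> * \<bar>real Nu - real N\<bar>))
    \<le> ennreal (\<epsilon> * ((1 - k) / 2 * reduced_cost l r V) + 1 / \<tau> * (\<epsilon> ^ 3 * sum weight (pts - J.pts)))"
    using functional_ge[OF \<epsilon>(1) \<tau> k w(2) bU U_def[symmetric] K_def, of \<gamma>] le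
    unfolding Fv[OF bV] Nu_def N_def by (rule order_trans)
  moreover have "0 \<le> \<epsilon> * ((1 - k) / 2 * reduced_cost l r V) + 1 / \<tau> * (\<epsilon> ^ 3 * sum weight (pts - J.pts))"
    using \<epsilon> \<tau> k reduced_cost_ge(1)[OF bV] weight_sum_nonneg[of "pts - J.pts"] by (intro add_nonneg_nonneg mult_nonneg_nonneg) auto
  ultimately have "c * (lam / 4 * reduced_cost l r U) + (c * (sum weight (pts - K) + real (card (K - pts))) +
      1 / \<tau> * (\<epsilon> powr \<gamma> * \<bar>real Nu - real N\<bar>)) \<le> c * (lam / 4 * reduced_cost l r V) + c * sum weight (pts - J.pts)"
    by (simp only: ennreal_le_iff distrib_left c1 c2)
  then have "c * (lam / 4 * reduced_cost l r U + (sum weight (pts - K) + real (card (K - pts))) + lam * \<bar>real Nu - real N\<bar>)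
     \<le> c * (lam / 4 * reduced_cost l r V + sum weight (pts - J.pts))"
    using c3 by (simp only: distrib_left)
  then have main: "lam / 4 * reduced_cost l r U + (sum weight (pts - K) + real (card (K - pts))) + lam * \<bar>real Nu - real N\<bar>
     \<le> lam / 4 * reduced_cost l r V + sum weight (pts - J.pts)"
    using c0 by simp
  have pcs: "b1 - mo 4 - (a1 + mo 2) + 1 = int (card Xo)" "b2 - mo 3 - (a2 + mo 1) + 1 = int (card Yo)"
    using J.fit J.cuts by (auto simp: mo(3,4))
  have "reduced_cost l r V \<le> 4 * (real (card Xo) + real (card Yo)) + 8 + 4 * real N"
    unfolding reduced_cost_def V(4) using cV[OF bV] unfolding pcs by simp
  then have RV: "lam / 4 * reduced_cost l r V \<le> lam * (real (card Xo) + real (card Yo)) + 2 * lam + lam * real N"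
    using mult_left_mono[of _ _ "lam / 4"] lam0 by (fastforce simp: algebra_simps)
  have D: "sum weight (pts - A) = sum weight pts - sum weight (pts \<inter> A)" for A
    using finite_pts sum.Int_Diff[of pts weight A] by simp
  have G: "net_gain weight lam Xo Yo = sum weight (pts \<inter> J.pts) - lam * (real (card Xo) + real (card Yo))"
    unfolding net_gain_def Jpts by (subst sum_weight_box) (auto simp: mo(3,4) Int_assoc)
  have NN: "lam * real N \<le> lam * real Nu + lam * \<bar>real Nu - real N\<bar>"
    using mult_left_mono[of "real N" "real Nu + \<bar>real Nu - real N\<bar>" lam] lam0 by (simp add: distrib_left)
  \<comment> \<open>The constant 8 in the bound for \<open>reduced_cost\<close> is available only
    for a nonempty phase. The empty one would save the corresponding \<open>2 * lam\<close>, but the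
    core alone gains at least \<open>lam\<close> for each of its lines, of which there are more than
    two.\<close>
  have neK: "K \<noteq> {}"
  proof
    assume "K = {}"
    have "lam / 4 * (4 * real Nu) \<le> lam / 4 * reduced_cost l r U"
      using reduced_cost_ge(1)[OF bU] lam0 unfolding Nu_def by (intro mult_left_mono) auto
    then have "net_gain weight lam Xo Yo \<le> 2 * lam"
      using main RV NN G unfolding D \<open>K = {}\<close> by simp
    moreover have "lam * (card {a1 + M..b1 - M} + card {a2 + M..b2 - M}) \<le> net_gain weight lam Xo Yo"
      by (rule optimal_core(3)[OF M(1) L lam0 lam(2) opt])
    ultimately have "lam * real (card {a1 + M..b1 - M} + card {a2 + M..b2 - M}) \<le> lam * 2" by simp
    then have "card {a1 + M..b1 - M} + card {a2 + M..b2 - M} \<le> 2" using lam0 by simp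
    moreover have "3 \<le> card {a1 + M..b1 - M}"
      using pc[of 1] L[of 1] M cuts by (simp add: par_count_def)
    ultimately show False by simp
  qed
  have "lam / 4 * (4 * (real (card (fst ` K)) + real (card (snd ` K))) + 8 + 4 * real Nu) \<le> lam / 4 * reduced_cost l r U"
    using reduced_cost_ge(2)[OF bU] neK lam0 unfolding Nu_def K_def by (intro mult_left_mono) auto
  then have "lam * (real (card (fst ` K)) + real (card (snd ` K))) + 2 * lam + lam * real Nu \<le> lam / 4 * reduced_cost l r U"
    by (simp add: algebra_simps)
  then have "lam * (real (card (fst ` K)) + real (card (snd ` K))) - sum weight (pts \<inter> K) + real (card (K - pts))
      \<le> - net_gain weight lam Xo Yo"
    using main RV NN G unfolding D by linarith
  then obtain X Y where XY: "optimal_pair weight lam {a1..b1} {a2..b2} X Y" "K = pts \<inter> X \<times> Y"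
    by (rule optimal_phase[OF opt lam0 finK])
  obtain m :: "nat \<Rightarrow> int" where m: "\<And>i. 0 \<le> m i" "\<And>i. m i \<le> M" "X = {a1 + m 2..b1 - m 4}" "Y = {a2 + m 1..b2 - m 3}"
    "\<And>i. of_int (m i * (par_count i - 2 * M)) \<le> lam"
    "\<And>i. lam \<le> of_int ((m i + 1) * (par_count i + 2 * (m i + 1)))"
    by (rule optimal_shape[OF M L lam0 lam(2) XY(1)]) blast
  have "phaseI \<epsilon> u = emb \<epsilon> ` (pts \<inter> {a1 + m 2..b1 - m 4} \<times> {a2 + m 1..b2 - m 3})"
    unfolding phaseI_emb XY(2)[symmetric, unfolded m(3,4)] K_def U_def ..
  then show ?thesis by (rule that[OF m(1,2,5,6)])
qed

end

subsection \<open>The smallest octagon containing the cells\<close>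

lemma side_eq:
  assumes "\<And>q. q \<in> S \<Longrightarrow> q \<bullet> \<nu> \<le> c" "z \<in> S" "z \<bullet> \<nu> = c"
  shows "side \<nu> S = {p \<in> S. p \<bullet> \<nu> = c}"
proof -
  have "(\<forall>q\<in>S. q \<bullet> \<nu> \<le> p \<bullet> \<nu>) \<longleftrightarrow> p \<bullet> \<nu> = c" if "p \<in> S" for p
    using assms(1)[OF that] assms(2,3) by (metis assms(1) order_antisym)
  then show ?thesis unfolding side_def by blast
qed

lemma diameter_closed_segment: "diameter (closed_segment a b) = dist a b" for a b :: "'a::euclidean_space"
proof (rule antisym)
  show "diameter (closed_segment a b) \<le> dist a b"
  proof (rule diameter_le)
    fix x y assume "x \<in> closed_segment a b" "y \<in> closed_segment a b"
    then obtain s t where st: "x = (1 - s) *\<^sub>R a + s *\<^sub>R b" "0 \<le> s" "s \<le> 1"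
      "y = (1 - t) *\<^sub>R a + t *\<^sub>R b" "0 \<le> t" "t \<le> 1" by (auto simp: in_segment)
    have "x - y = (t - s) *\<^sub>R (a - b)" unfolding st by (simp add: algebra_simps)
    then have "norm (x - y) = \<bar>t - s\<bar> * norm (a - b)" by simp
    also have "\<dots> \<le> 1 * norm (a - b)" using st by (intro mult_right_mono) auto
    finally show "norm (x - y) \<le> dist a b" by (simp add: dist_norm)
  qed simp
  show "dist a b \<le> diameter (closed_segment a b)"
    by (intro diameter_bounded_bound bounded_closed_segment) auto
qed

lemma graph_segment:
  fixes x0 x1 m c :: real
  assumes "x0 \<le> x1"
  shows "{(x, y). x0 \<le> x \<and> x \<le> x1 \<and> y = m * x + c} = closed_segment (x0, m * x0 + c) (x1, m * x1 + c)"
proof (rule set_eqI, rule iffI)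
  fix p assume "p \<in> {(x, y). x0 \<le> x \<and> x \<le> x1 \<and> y = m * x + c}"
  then obtain x where p: "p = (x, m * x + c)" "x \<in> closed_segment x0 x1"
    using assms by (auto simp: closed_segment_eq_real_ivl)
  then obtain t where t: "x = (1 - t) * x0 + t * x1" "0 \<le> t" "t \<le> 1" by (auto simp: in_segment)
  then show "p \<in> closed_segment (x0, m * x0 + c) (x1, m * x1 + c)"
    unfolding p in_segment t(1) by (intro exI[of _ t]) (simp add: algebra_simps)
next
  fix p assume "p \<in> closed_segment (x0, m * x0 + c) (x1, m * x1 + c)"
  then obtain t where t: "p = (1 - t) *\<^sub>R (x0, m * x0 + c) + t *\<^sub>R (x1, m * x1 + c)" "0 \<le> t" "t \<le> 1"
    by (auto simp: in_segment)
  have "(1 - t) * x0 + t * x1 \<in> closed_segment x0 x1" using t by (auto simp: in_segment)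
  then have "x0 \<le> (1 - t) * x0 + t * x1" "(1 - t) * x0 + t * x1 \<le> x1"
    using assms by (auto simp: closed_segment_eq_real_ivl)
  then show "p \<in> {(x, y). x0 \<le> x \<and> x \<le> x1 \<and> y = m * x + c}"
    unfolding t by (auto simp: algebra_simps)
qed

lemma vertical_segment:
  fixes y0 y1 c :: real
  assumes "y0 \<le> y1"
  shows "{(x, y). x = c \<and> y0 \<le> y \<and> y \<le> y1} = closed_segment (c, y0) (c, y1)"
proof (rule set_eqI, rule iffI)
  fix p assume "p \<in> {(x, y). x = c \<and> y0 \<le> y \<and> y \<le> y1}"
  then obtain y where p: "p = (c, y)" "y \<in> closed_segment y0 y1"
    using assms by (auto simp: closed_segment_eq_real_ivl)
  then obtain t where "y = (1 - t) * y0 + t * y1" "0 \<le> t" "t \<le> 1" by (auto simp: in_segment)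
  then show "p \<in> closed_segment (c, y0) (c, y1)"
    unfolding p in_segment by (intro exI[of _ t]) (simp add: algebra_simps)
next
  fix p assume "p \<in> closed_segment (c, y0) (c, y1)"
  then obtain t where t: "p = (1 - t) *\<^sub>R (c, y0) + t *\<^sub>R (c, y1)" "0 \<le> t" "t \<le> 1"
    by (auto simp: in_segment)
  have "(1 - t) * y0 + t * y1 \<in> closed_segment y0 y1" using t by (auto simp: in_segment)
  then have "y0 \<le> (1 - t) * y0 + t * y1" "(1 - t) * y0 + t * y1 \<le> y1"
    using assms by (auto simp: closed_segment_eq_real_ivl)
  then show "p \<in> {(x, y). x = c \<and> y0 \<le> y \<and> y \<le> y1}"
    unfolding t by (auto simp: algebra_simps)
qed

lemma setdist_hyperplanes:
  fixes \<nu> :: "'a::euclidean_space"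
  assumes "norm \<nu> = 1"
  shows "setdist {x. x \<bullet> \<nu> = c} {x. x \<bullet> \<nu> = c'} = \<bar>c - c'\<bar>"
proof (rule antisym)
  have n: "\<nu> \<bullet> \<nu> = 1" using assms by (simp add: dot_square_norm)
  have "setdist {x. x \<bullet> \<nu> = c} {x. x \<bullet> \<nu> = c'} \<le> dist (c *\<^sub>R \<nu>) (c' *\<^sub>R \<nu>)"
    by (rule setdist_le_dist) (simp_all add: n)
  also have "\<dots> = \<bar>c - c'\<bar>" by (simp add: dist_norm assms flip: scaleR_diff_left)
  finally show "setdist {x. x \<bullet> \<nu> = c} {x. x \<bullet> \<nu> = c'} \<le> \<bar>c - c'\<bar>" .
  show "\<bar>c - c'\<bar> \<le> setdist {x. x \<bullet> \<nu> = c} {x. x \<bullet> \<nu> = c'}"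
  proof (rule le_setdistI)
    have "c *\<^sub>R \<nu> \<in> {x. x \<bullet> \<nu> = c}" "c' *\<^sub>R \<nu> \<in> {x. x \<bullet> \<nu> = c'}" by (simp_all add: n)
    then show "{x. x \<bullet> \<nu> = c} \<noteq> {}" "{x. x \<bullet> \<nu> = c'} \<noteq> {}" by blast+
    fix x y assume "x \<in> {x. x \<bullet> \<nu> = c}" "y \<in> {x. x \<bullet> \<nu> = c'}"
    then have "\<bar>c - c'\<bar> = \<bar>(x - y) \<bullet> \<nu>\<bar>" by (simp add: inner_diff_left)
    also have "\<dots> \<le> norm (x - y) * norm \<nu>" by (rule Cauchy_Schwarz_ineq2)
    finally show "\<bar>c - c'\<bar> \<le> dist x y" by (simp add: assms dist_norm)
  qed
qed

definition real_oct :: "real \<Rightarrow> real \<Rightarrow> real \<Rightarrow> real \<Rightarrow> real \<Rightarrow> real \<Rightarrow> real \<Rightarrow> real \<Rightarrow> pt set" where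
  "real_oct a1 b1 a2 b2 a3 b3 a4 b4 = {(x, y). a1 \<le> x \<and> x \<le> b1 \<and> a2 \<le> y \<and> y \<le> b2 \<and>
     a3 \<le> x + y \<and> x + y \<le> b3 \<and> a4 \<le> x - y \<and> x - y \<le> b4}"

lemma octagon_iff: "octagon A \<longleftrightarrow> interior A \<noteq> {} \<and> (\<exists>a1 b1 a2 b2 a3 b3 a4 b4. A = real_oct a1 b1 a2 b2 a3 b3 a4 b4)"
  unfolding octagon_def real_oct_def ..

lemma convex_real_oct: "convex (real_oct a1 b1 a2 b2 a3 b3 a4 b4)"
proof -
  have "real_oct a1 b1 a2 b2 a3 b3 a4 b4 =
    fst -` {a1..b1} \<inter> snd -` {a2..b2} \<inter> (\<lambda>p. fst p + snd p) -` {a3..b3} \<inter> (\<lambda>p. fst p - snd p) -` {a4..b4}"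
    unfolding real_oct_def by auto
  moreover have "linear (fst :: pt \<Rightarrow> real)" "linear (snd :: pt \<Rightarrow> real)"
    by (simp_all add: linear_fst linear_snd)
  moreover have "linear (\<lambda>p :: pt. fst p + snd p)"
    by (intro linear_compose_add linear_fst linear_snd)
  moreover have "linear (\<lambda>p :: pt. fst p - snd p)"
    by (intro linear_compose_sub linear_fst linear_snd)
  ultimately show ?thesis
    by (simp only:) (intro convex_Int convex_linear_vimage convex_real_interval; assumption)
qed

lemma interior_real_oct:
  assumes "0 < d" "a1 + d \<le> x" "x \<le> b1 - d" "a2 + d \<le> y" "y \<le> b2 - d"
    "a3 + 2 * d \<le> x + y" "x + y \<le> b3 - 2 * d" "a4 + 2 * d \<le> x - y" "x - y \<le> b4 - 2 * d"
  shows "interior (real_oct a1 b1 a2 b2 a3 b3 a4 b4) \<noteq> {}"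
proof -
  have "{x - d<..<x + d} \<times> {y - d<..<y + d} \<subseteq> real_oct a1 b1 a2 b2 a3 b3 a4 b4"
    using assms unfolding real_oct_def by auto
  then have "{x - d<..<x + d} \<times> {y - d<..<y + d} \<subseteq> interior (real_oct a1 b1 a2 b2 a3 b3 a4 b4)"
    by (rule interior_maximal) (intro open_Times open_greaterThanLessThan)
  moreover have "(x, y) \<in> {x - d<..<x + d} \<times> {y - d<..<y + d}" using assms by simp
  ultimately show ?thesis by blast
qed

lemma emb_inner: "emb \<epsilon> p \<bullet> (c, d) = \<epsilon> * (of_int (fst p) * c + of_int (snd p) * d)"
  by (simp add: emb_def algebra_simps)

section \<open>The octagon hull of the cells and the lengths of its sides\<close>

context lat_octagon
begin

lemma corners:
  "(a1 + s1, a2) \<in> pts" "(b1 - s4, a2) \<in> pts" "(a1, a2 + s1) \<in> pts" "(a1, b2 - s2) \<in> pts"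
  "(a1 + s2, b2) \<in> pts" "(b1 - s3, b2) \<in> pts" "(b1, a2 + s4) \<in> pts" "(b1, b2 - s3) \<in> pts"
  using cuts fit by (auto simp: pts_def)

text \<open>Parallel constraints move out by half a step, diagonal ones by a whole step, because the
  corner of a cell adds one half in both coordinates. The cuts thereby keep their lengths.\<close>

definition cell_hull :: "real \<Rightarrow> pt set" where
  "cell_hull \<epsilon> = real_oct (\<epsilon> * (of_int a1 - 1/2)) (\<epsilon> * (of_int b1 + 1/2)) (\<epsilon> * (of_int a2 - 1/2)) (\<epsilon> * (of_int b2 + 1/2))
     (\<epsilon> * (of_int (a1 + a2 + s1) - 1)) (\<epsilon> * (of_int (b1 + b2 - s3) + 1)) (\<epsilon> * (of_int (a1 - b2 + s2) - 1)) (\<epsilon> * (of_int (b1 - a2 - s4) + 1))"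

lemma cell_mem:
  assumes "p \<in> pts" "\<bar>c\<bar> \<le> 1/2" "\<bar>d\<bar> \<le> 1/2"
  shows "(\<epsilon> * (of_int (fst p) + c), \<epsilon> * (of_int (snd p) + d)) \<in> cells \<epsilon> (emb \<epsilon> ` pts)"
proof -
  have "(\<epsilon> * (of_int (fst p) + c), \<epsilon> * (of_int (snd p) + d)) = emb \<epsilon> p + \<epsilon> *\<^sub>R (c, d)"
    by (simp add: emb_def distrib_left)
  moreover have "(c, d) \<in> {-1/2..1/2} \<times> {-1/2..1/2}" using assms by auto
  ultimately show ?thesis using assms(1) unfolding cells_def by blast
qed

lemma cells_subset_hull:
  assumes "0 < \<epsilon>"
  shows "cells \<epsilon> (emb \<epsilon> ` pts) \<subseteq> cell_hull \<epsilon>"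
proof
  fix z assume "z \<in> cells \<epsilon> (emb \<epsilon> ` pts)"
  then obtain p c d where p: "p \<in> pts" and cd: "c \<in> {-1/2..1/2}" "d \<in> {-1/2..1/2}" and "z = emb \<epsilon> p + \<epsilon> *\<^sub>R (c, d)"
    unfolding cells_def by blast
  then have z: "z = (\<epsilon> * (of_int (fst p) + c), \<epsilon> * (of_int (snd p) + d))" by (simp add: emb_def distrib_left)
  obtain x y where xy: "p = (x, y)" by (cases p)
  have b: "a1 \<le> x" "x \<le> b1" "a2 \<le> y" "y \<le> b2" "a1 + a2 + s1 \<le> x + y" "x + y \<le> b1 + b2 - s3"
    "a1 - b2 + s2 \<le> x - y" "x - y \<le> b1 - a2 - s4" using p by (auto simp: xy pts_def)
  have r: "real_of_int a1 \<le> x" "real_of_int x \<le> b1" "real_of_int a2 \<le> y" "real_of_int y \<le> b2"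
    "real_of_int a1 + a2 + s1 \<le> real_of_int x + y" "real_of_int x + y \<le> real_of_int b1 + b2 - s3"
    "real_of_int a1 - b2 + s2 \<le> real_of_int x - y" "real_of_int x - y \<le> real_of_int b1 - a2 - s4"
    using b by linarith+
  have m: "\<epsilon> * s \<le> \<epsilon> * t" if "s \<le> t" for s t :: real using that assms by simp
  have e: "\<epsilon> * (x + c) + \<epsilon> * (y + d) = \<epsilon> * (x + c + (y + d))" "\<epsilon> * (x + c) - \<epsilon> * (y + d) = \<epsilon> * (x + c - (y + d))"
    by (simp_all add: algebra_simps)
  show "z \<in> cell_hull \<epsilon>"
    unfolding z xy fst_conv snd_conv cell_hull_def real_oct_def mem_Collect_eq case_prod_conv e
    using r cd by (intro conjI m) auto
qed

text \<open>Each of the eight constraints is attained at the corner of a cell around an end point of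
  a side, so an octagon containing the cells cannot be tighter in any direction.\<close>

lemma octagon_hull_eq:
  assumes "0 < \<epsilon>"
  shows "octagon_hull (cells \<epsilon> (emb \<epsilon> ` pts)) = cell_hull \<epsilon>"
proof (rule antisym)
  have "octagon (cell_hull \<epsilon>)"
    unfolding octagon_iff cell_hull_def
  proof (intro conjI)
    define x where "x = \<epsilon> * of_int a1"
    define y where "y = \<epsilon> * of_int (a2 + s1)"
    define B where "B = {x - \<epsilon> / 2<..<x + \<epsilon> / 2} \<times> {y - \<epsilon> / 2<..<y + \<epsilon> / 2}"
    have "B \<subseteq> cells \<epsilon> (emb \<epsilon> ` pts)"
    proof clarify
      fix X Y assume "(X, Y) \<in> B"
      then have "x - \<epsilon> / 2 < X" "X < x + \<epsilon> / 2" "y - \<epsilon> / 2 < Y" "Y < y + \<epsilon> / 2"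
        by (simp_all add: B_def)
      then have "\<bar>X - x\<bar> \<le> \<epsilon> / 2" "\<bar>Y - y\<bar> \<le> \<epsilon> / 2" by linarith+
      then have "\<bar>(X - x) / \<epsilon>\<bar> \<le> 1/2" "\<bar>(Y - y) / \<epsilon>\<bar> \<le> 1/2"
        using assms by (simp_all add: field_simps)
      from cell_mem[OF corners(3) this, of \<epsilon>] show "(X, Y) \<in> cells \<epsilon> (emb \<epsilon> ` pts)"
        using assms by (simp add: x_def y_def distrib_left)
    qed
    then have "B \<subseteq> interior (cell_hull \<epsilon>)"
      using cells_subset_hull[OF assms] unfolding B_def
      by (intro interior_maximal open_Times open_greaterThanLessThan) auto
    moreover have "(x, y) \<in> B" using assms by (simp add: B_def)
    ultimately show "interior (real_oct (\<epsilon> * (of_int a1 - 1/2)) (\<epsilon> * (of_int b1 + 1/2)) (\<epsilon> * (of_int a2 - 1/2)) (\<epsilon> * (of_int b2 + 1/2))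
     (\<epsilon> * (of_int (a1 + a2 + s1) - 1)) (\<epsilon> * (of_int (b1 + b2 - s3) + 1)) (\<epsilon> * (of_int (a1 - b2 + s2) - 1)) (\<epsilon> * (of_int (b1 - a2 - s4) + 1))) \<noteq> {}"
      unfolding cell_hull_def by blast
  qed blast
  then show "octagon_hull (cells \<epsilon> (emb \<epsilon> ` pts)) \<subseteq> cell_hull \<epsilon>"
    unfolding octagon_hull_def using cells_subset_hull[OF assms] by blast
  show "cell_hull \<epsilon> \<subseteq> octagon_hull (cells \<epsilon> (emb \<epsilon> ` pts))"
    unfolding octagon_hull_def
  proof (rule Inter_greatest)
    fix A assume "A \<in> {A. octagon A \<and> cells \<epsilon> (emb \<epsilon> ` pts) \<subseteq> A}"
    then obtain a1' b1' a2' b2' a3' b3' a4' b4' where A: "A = real_oct a1' b1' a2' b2' a3' b3' a4' b4'"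
      and sub: "cells \<epsilon> (emb \<epsilon> ` pts) \<subseteq> A" unfolding octagon_iff by blast
    have c: "(\<epsilon> * (of_int x + c), \<epsilon> * (of_int y + d)) \<in> real_oct a1' b1' a2' b2' a3' b3' a4' b4'"
      if "(x, y) \<in> pts" "\<bar>c\<bar> = 1/2" "\<bar>d\<bar> = 1/2" for x y c d
    proof -
      have "(\<epsilon> * (of_int x + c), \<epsilon> * (of_int y + d)) \<in> cells \<epsilon> (emb \<epsilon> ` pts)"
        using cell_mem[OF that(1), of c d \<epsilon>] that(2,3) by simp
      then show ?thesis using sub unfolding A by blast
    qed
    have "a1' \<le> \<epsilon> * (of_int a1 - 1/2)" "a3' \<le> \<epsilon> * (of_int (a1 + a2 + s1) - 1)"
      using c[OF corners(3), of "-1/2" "-1/2"] by (simp_all add: real_oct_def algebra_simps)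
    moreover have "a4' \<le> \<epsilon> * (of_int (a1 - b2 + s2) - 1)"
      using c[OF corners(4), of "-1/2" "1/2"] by (simp_all add: real_oct_def algebra_simps)
    moreover have "\<epsilon> * (of_int b1 + 1/2) \<le> b1'" "\<epsilon> * (of_int (b1 - a2 - s4) + 1) \<le> b4'"
      using c[OF corners(7), of "1/2" "-1/2"] by (simp_all add: real_oct_def algebra_simps)
    moreover have "\<epsilon> * (of_int (b1 + b2 - s3) + 1) \<le> b3'"
      using c[OF corners(8), of "1/2" "1/2"] by (simp_all add: real_oct_def algebra_simps)
    moreover have "a2' \<le> \<epsilon> * (of_int a2 - 1/2)"
      using c[OF corners(1), of "1/2" "-1/2"] by (simp_all add: real_oct_def algebra_simps)
    moreover have "\<epsilon> * (of_int b2 + 1/2) \<le> b2'"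
      using c[OF corners(5), of "1/2" "1/2"] by (simp_all add: real_oct_def algebra_simps)
    ultimately show "cell_hull \<epsilon> \<subseteq> A"
      unfolding cell_hull_def A real_oct_def by auto
  qed
qed

end

lemma real_oct_sides:
  fixes a1 b1 a2 b2 s1 s2 s3 s4 :: real
  assumes s: "0 \<le> s1" "0 \<le> s2" "0 \<le> s3" "0 \<le> s4"
    and f: "s1 + s4 \<le> b1 - a1" "s1 + s2 \<le> b2 - a2" "s2 + s3 \<le> b1 - a1" "s3 + s4 \<le> b2 - a2"
    and A: "A = real_oct a1 b1 a2 b2 (a1 + a2 + s1) (b1 + b2 - s3) (a1 - b2 + s2) (b1 - a2 - s4)"
  shows "side (0, -1) A = closed_segment (a1 + s1, a2) (b1 - s4, a2)"
    "side (-1, 0) A = closed_segment (a1, a2 + s1) (a1, b2 - s2)"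
    "side (0, 1) A = closed_segment (a1 + s2, b2) (b1 - s3, b2)"
    "side (1, 0) A = closed_segment (b1, a2 + s4) (b1, b2 - s3)"
    "side (-1, -1) A = closed_segment (a1, a2 + s1) (a1 + s1, a2)"
    "side (-1, 1) A = closed_segment (a1, b2 - s2) (a1 + s2, b2)"
    "side (1, 1) A = closed_segment (b1 - s3, b2) (b1, b2 - s3)"
    "side (1, -1) A = closed_segment (b1 - s4, a2) (b1, a2 + s4)"
proof -
  note d = A real_oct_def inner_Pair
  have "side (0, -1) A = {p \<in> A. p \<bullet> (0, -1) = - a2}"
    by (rule side_eq[of _ _ _ "(a1 + s1, a2)"]) (use s f in \<open>auto simp: d\<close>)
  also have "\<dots> = {(x, y). a1 + s1 \<le> x \<and> x \<le> b1 - s4 \<and> y = 0 * x + a2}"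
    using s f by (auto simp: d)
  also have "\<dots> = closed_segment (a1 + s1, a2) (b1 - s4, a2)"
    using graph_segment[of "a1 + s1" "b1 - s4" 0 a2] f by simp
  finally show "side (0, -1) A = closed_segment (a1 + s1, a2) (b1 - s4, a2)" .
  have "side (0, 1) A = {p \<in> A. p \<bullet> (0, 1) = b2}"
    by (rule side_eq[of _ _ _ "(a1 + s2, b2)"]) (use s f in \<open>auto simp: d\<close>)
  also have "\<dots> = {(x, y). a1 + s2 \<le> x \<and> x \<le> b1 - s3 \<and> y = 0 * x + b2}"
    using s f by (auto simp: d)
  also have "\<dots> = closed_segment (a1 + s2, b2) (b1 - s3, b2)"
    using graph_segment[of "a1 + s2" "b1 - s3" 0 b2] f by simp
  finally show "side (0, 1) A = closed_segment (a1 + s2, b2) (b1 - s3, b2)" .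
  have "side (-1, 0) A = {p \<in> A. p \<bullet> (-1, 0) = - a1}"
    by (rule side_eq[of _ _ _ "(a1, a2 + s1)"]) (use s f in \<open>auto simp: d\<close>)
  also have "\<dots> = {(x, y). x = a1 \<and> a2 + s1 \<le> y \<and> y \<le> b2 - s2}"
    using s f by (auto simp: d)
  also have "\<dots> = closed_segment (a1, a2 + s1) (a1, b2 - s2)"
    using f by (intro vertical_segment) simp
  finally show "side (-1, 0) A = closed_segment (a1, a2 + s1) (a1, b2 - s2)" .
  have "side (1, 0) A = {p \<in> A. p \<bullet> (1, 0) = b1}"
    by (rule side_eq[of _ _ _ "(b1, a2 + s4)"]) (use s f in \<open>auto simp: d\<close>)
  also have "\<dots> = {(x, y). x = b1 \<and> a2 + s4 \<le> y \<and> y \<le> b2 - s3}"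
    using s f by (auto simp: d)
  also have "\<dots> = closed_segment (b1, a2 + s4) (b1, b2 - s3)"
    using f by (intro vertical_segment) simp
  finally show "side (1, 0) A = closed_segment (b1, a2 + s4) (b1, b2 - s3)" .
  have "side (-1, -1) A = {p \<in> A. p \<bullet> (-1, -1) = - (a1 + a2 + s1)}"
    by (rule side_eq[of _ _ _ "(a1, a2 + s1)"]) (use s f in \<open>auto simp: d\<close>)
  also have "\<dots> = {(x, y). a1 \<le> x \<and> x \<le> a1 + s1 \<and> y = -1 * x + (a1 + a2 + s1)}"
    using s f by (auto simp: d)
  also have "\<dots> = closed_segment (a1, a2 + s1) (a1 + s1, a2)"
    using graph_segment[of a1 "a1 + s1" "-1" "a1 + a2 + s1"] s by simp
  finally show "side (-1, -1) A = closed_segment (a1, a2 + s1) (a1 + s1, a2)" .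
  have "side (-1, 1) A = {p \<in> A. p \<bullet> (-1, 1) = - (a1 - b2 + s2)}"
    by (rule side_eq[of _ _ _ "(a1, b2 - s2)"]) (use s f in \<open>auto simp: d\<close>)
  also have "\<dots> = {(x, y). a1 \<le> x \<and> x \<le> a1 + s2 \<and> y = 1 * x + (b2 - s2 - a1)}"
    using s f by (auto simp: d)
  also have "\<dots> = closed_segment (a1, b2 - s2) (a1 + s2, b2)"
    using graph_segment[of a1 "a1 + s2" 1 "b2 - s2 - a1"] s by simp
  finally show "side (-1, 1) A = closed_segment (a1, b2 - s2) (a1 + s2, b2)" .
  have "side (1, 1) A = {p \<in> A. p \<bullet> (1, 1) = b1 + b2 - s3}"
    by (rule side_eq[of _ _ _ "(b1, b2 - s3)"]) (use s f in \<open>auto simp: d\<close>)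
  also have "\<dots> = {(x, y). b1 - s3 \<le> x \<and> x \<le> b1 \<and> y = -1 * x + (b1 + b2 - s3)}"
    using s f by (auto simp: d)
  also have "\<dots> = closed_segment (b1 - s3, b2) (b1, b2 - s3)"
    using graph_segment[of "b1 - s3" b1 "-1" "b1 + b2 - s3"] s by simp
  finally show "side (1, 1) A = closed_segment (b1 - s3, b2) (b1, b2 - s3)" .
  have "side (1, -1) A = {p \<in> A. p \<bullet> (1, -1) = b1 - a2 - s4}"
    by (rule side_eq[of _ _ _ "(b1, a2 + s4)"]) (use s f in \<open>auto simp: d\<close>)
  also have "\<dots> = {(x, y). b1 - s4 \<le> x \<and> x \<le> b1 \<and> y = 1 * x + (a2 + s4 - b1)}"
    using s f by (auto simp: d)
  also have "\<dots> = closed_segment (b1 - s4, a2) (b1, a2 + s4)"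
    using graph_segment[of "b1 - s4" b1 1 "a2 + s4 - b1"] s by simp
  finally show "side (1, -1) A = closed_segment (b1 - s4, a2) (b1, a2 + s4)" .
qed

lemma dist_diagonal: "0 \<le> s \<Longrightarrow> \<bar>x - x'\<bar> = s \<Longrightarrow> \<bar>y - y'\<bar> = s \<Longrightarrow> dist (x, y) (x', y') = sqrt 2 * s" for x y s :: real
  unfolding dist_Pair_Pair dist_real_def by (simp add: real_sqrt_mult flip: mult_2)

lemma index_cases:
  assumes "i \<in> {1..4}"
  obtains "i = 1" | "i = 2" | "i = 3" | "i = (4::nat)"
  using assms by fastforce

context lat_octagon
begin

definition cut :: "nat \<Rightarrow> int" where
  "cut i = (if i = 1 then s1 else if i = 2 then s2 else if i = 3 then s3 else s4)"

text \<open>Positions along the outward normals, hence the signs: moving any side inwards decreases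
  its \<open>extent\<close>.\<close>

definition extent :: "nat \<Rightarrow> int" where
  "extent i = (if i = 1 then - a2 else if i = 2 then - a1 else if i = 3 then b2 else b1)"

lemma hull_sides:
  assumes "0 < \<epsilon>"
  defines "A1 \<equiv> \<epsilon> * (of_int a1 - 1/2)" and "B1 \<equiv> \<epsilon> * (of_int b1 + 1/2)"
    and "A2 \<equiv> \<epsilon> * (of_int a2 - 1/2)" and "B2 \<equiv> \<epsilon> * (of_int b2 + 1/2)"
    and "S1 \<equiv> \<epsilon> * of_int s1" and "S2 \<equiv> \<epsilon> * of_int s2" and "S3 \<equiv> \<epsilon> * of_int s3" and "S4 \<equiv> \<epsilon> * of_int s4"
  shows "side (0, -1) (cell_hull \<epsilon>) = closed_segment (A1 + S1, A2) (B1 - S4, A2)"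
    "side (-1, 0) (cell_hull \<epsilon>) = closed_segment (A1, A2 + S1) (A1, B2 - S2)"
    "side (0, 1) (cell_hull \<epsilon>) = closed_segment (A1 + S2, B2) (B1 - S3, B2)"
    "side (1, 0) (cell_hull \<epsilon>) = closed_segment (B1, A2 + S4) (B1, B2 - S3)"
    "side (-1, -1) (cell_hull \<epsilon>) = closed_segment (A1, A2 + S1) (A1 + S1, A2)"
    "side (-1, 1) (cell_hull \<epsilon>) = closed_segment (A1, B2 - S2) (A1 + S2, B2)"
    "side (1, 1) (cell_hull \<epsilon>) = closed_segment (B1 - S3, B2) (B1, B2 - S3)"
    "side (1, -1) (cell_hull \<epsilon>) = closed_segment (B1 - S4, A2) (B1, A2 + S4)"
proof -
  note defs = A1_def B1_def A2_def B2_def S1_def S2_def S3_def S4_def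
  have S: "0 \<le> S1" "0 \<le> S2" "0 \<le> S3" "0 \<le> S4" using assms(1) cuts by (simp_all add: defs)
  have m: "\<epsilon> * s \<le> \<epsilon> * t" if "s \<le> t" for s t :: real using that assms(1) by simp
  have F: "S1 + S4 \<le> B1 - A1" "S1 + S2 \<le> B2 - A2" "S2 + S3 \<le> B1 - A1" "S3 + S4 \<le> B2 - A2"
    unfolding defs distrib_left[symmetric] right_diff_distrib[symmetric] using fit by (intro m; linarith)+
  have H: "cell_hull \<epsilon> = real_oct A1 B1 A2 B2 (A1 + A2 + S1) (B1 + B2 - S3) (A1 - B2 + S2) (B1 - A2 - S4)"
    unfolding cell_hull_def defs by (simp add: algebra_simps)
  note sides = real_oct_sides[OF S F H]
  show "side (0, -1) (cell_hull \<epsilon>) = closed_segment (A1 + S1, A2) (B1 - S4, A2)"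
    "side (-1, 0) (cell_hull \<epsilon>) = closed_segment (A1, A2 + S1) (A1, B2 - S2)"
    "side (0, 1) (cell_hull \<epsilon>) = closed_segment (A1 + S2, B2) (B1 - S3, B2)"
    "side (1, 0) (cell_hull \<epsilon>) = closed_segment (B1, A2 + S4) (B1, B2 - S3)"
    "side (-1, -1) (cell_hull \<epsilon>) = closed_segment (A1, A2 + S1) (A1 + S1, A2)"
    "side (-1, 1) (cell_hull \<epsilon>) = closed_segment (A1, B2 - S2) (A1 + S2, B2)"
    "side (1, 1) (cell_hull \<epsilon>) = closed_segment (B1 - S3, B2) (B1, B2 - S3)"
    "side (1, -1) (cell_hull \<epsilon>) = closed_segment (B1 - S4, A2) (B1, A2 + S4)"
    by (rule sides)+
qed

text \<open>The cells add half a step at both ends, so a side with \<open>n\<close> lattice points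
  has length \<open>n\<close> times \<open>\<epsilon>\<close>.\<close>

lemma par_length_eq:
  assumes "0 < \<epsilon>" "i \<in> {1..4}"
  shows "par_length \<epsilon> i (emb \<epsilon> ` pts) = \<epsilon> * of_int (par_count i)"
proof -
  have h: "dist (x, y) (x', y) = c" "dist (y, x) (y, x') = c" if "x' - x = c" "0 \<le> c" for x x' y c :: real
    using that by (simp_all add: dist_Pair_Pair dist_real_def)
  have n: "par_normal 1 = (0, -1)" "par_normal 2 = (-1, 0)" "par_normal 3 = (0, 1)" "par_normal 4 = (1, 0)"
    "par_count 1 = b1 - a1 - s1 - s4 + 1" "par_count 2 = b2 - a2 - s1 - s2 + 1"
    "par_count 3 = b1 - a1 - s2 - s3 + 1" "par_count 4 = b2 - a2 - s3 - s4 + 1"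
    by (simp_all add: par_normal_def par_count_def)
  have nn: "0 \<le> \<epsilon> * of_int (b1 - a1 - s1 - s4 + 1)" "0 \<le> \<epsilon> * of_int (b2 - a2 - s1 - s2 + 1)"
    "0 \<le> \<epsilon> * of_int (b1 - a1 - s2 - s3 + 1)" "0 \<le> \<epsilon> * of_int (b2 - a2 - s3 - s4 + 1)"
    using assms(1) fit by (intro mult_nonneg_nonneg of_int_nonneg; linarith)+
  show ?thesis
    using assms(2)
  proof (cases rule: index_cases)
    case 1
    show ?thesis unfolding 1 n par_length_def octagon_hull_eq[OF assms(1)] hull_sides[OF assms(1)] diameter_closed_segment
      by (rule h(1)[OF _ nn(1)]) (simp add: algebra_simps)
  next
    case 2
    show ?thesis unfolding 2 n par_length_def octagon_hull_eq[OF assms(1)] hull_sides[OF assms(1)] diameter_closed_segment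
      by (rule h(2)[OF _ nn(2)]) (simp add: algebra_simps)
  next
    case 3
    show ?thesis unfolding 3 n par_length_def octagon_hull_eq[OF assms(1)] hull_sides[OF assms(1)] diameter_closed_segment
      by (rule h(1)[OF _ nn(3)]) (simp add: algebra_simps)
  next
    case 4
    show ?thesis unfolding 4 n par_length_def octagon_hull_eq[OF assms(1)] hull_sides[OF assms(1)] diameter_closed_segment
      by (rule h(2)[OF _ nn(4)]) (simp add: algebra_simps)
  qed
qed

lemma diag_length_eq:
  assumes "0 < \<epsilon>" "i \<in> {1..4}"
  shows "diag_length \<epsilon> i (emb \<epsilon> ` pts) = sqrt 2 * (\<epsilon> * of_int (cut i))"
proof -
  have c: "0 \<le> \<epsilon> * of_int s1" "0 \<le> \<epsilon> * of_int s2" "0 \<le> \<epsilon> * of_int s3" "0 \<le> \<epsilon> * of_int s4"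
    using cuts assms(1) by simp_all
  have n: "diag_normal 1 = (-1, -1)" "diag_normal 2 = (-1, 1)" "diag_normal 3 = (1, 1)" "diag_normal 4 = (1, -1)"
    "cut 1 = s1" "cut 2 = s2" "cut 3 = s3" "cut 4 = s4"
    by (simp_all add: diag_normal_def cut_def)
  show ?thesis
    using assms(2)
  proof (cases rule: index_cases)
    case 1
    show ?thesis unfolding 1 n diag_length_def octagon_hull_eq[OF assms(1)] hull_sides[OF assms(1)] diameter_closed_segment
      by (rule dist_diagonal[OF c(1)]) (use c in simp_all)
  next
    case 2
    show ?thesis unfolding 2 n diag_length_def octagon_hull_eq[OF assms(1)] hull_sides[OF assms(1)] diameter_closed_segment
      by (rule dist_diagonal[OF c(2)]) (use c in simp_all)
  next
    case 3
    show ?thesis unfolding 3 n diag_length_def octagon_hull_eq[OF assms(1)] hull_sides[OF assms(1)] diameter_closed_segment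
      by (rule dist_diagonal[OF c(3)]) (use c in simp_all)
  next
    case 4
    show ?thesis unfolding 4 n diag_length_def octagon_hull_eq[OF assms(1)] hull_sides[OF assms(1)] diameter_closed_segment
      by (rule dist_diagonal[OF c(4)]) (use c in simp_all)
  qed
qed

lemma par_line_eq:
  assumes "0 < \<epsilon>" "i \<in> {1..4}"
  shows "par_line \<epsilon> i (emb \<epsilon> ` pts) = {x. x \<bullet> par_normal i = \<epsilon> * (of_int (extent i) + 1/2)}"
proof -
  have key: "{x. \<exists>y\<in>closed_segment p q. x \<bullet> \<nu> = y \<bullet> \<nu>} = {x. x \<bullet> \<nu> = c}"
    if "p \<bullet> \<nu> = c" "q \<bullet> \<nu> = c" for p q \<nu> :: pt and c
  proof -
    have "y \<bullet> \<nu> = c" if "y \<in> closed_segment p q" for y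
    proof -
      from that obtain t where t: "y = (1 - t) *\<^sub>R p + t *\<^sub>R q" by (auto simp: in_segment)
      show ?thesis unfolding t inner_add_left inner_scaleR_left \<open>p \<bullet> \<nu> = c\<close> \<open>q \<bullet> \<nu> = c\<close>
        by (simp add: algebra_simps)
    qed
    moreover have "p \<in> closed_segment p q" by simp
    ultimately show ?thesis using \<open>p \<bullet> \<nu> = c\<close> by force
  qed
  have n: "par_normal 1 = (0, -1)" "par_normal 2 = (-1, 0)" "par_normal 3 = (0, 1)" "par_normal 4 = (1, 0)"
    "extent 1 = - a2" "extent 2 = - a1" "extent 3 = b2" "extent 4 = b1"
    by (simp_all add: par_normal_def extent_def)
  show ?thesis
    using assms(2)
  proof (cases rule: index_cases)
    case 1
    show ?thesis unfolding 1 n par_line_def octagon_hull_eq[OF assms(1)] hull_sides[OF assms(1)]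
      by (rule key) (simp_all add: inner_Pair algebra_simps)
  next
    case 2
    show ?thesis unfolding 2 n par_line_def octagon_hull_eq[OF assms(1)] hull_sides[OF assms(1)]
      by (rule key) (simp_all add: inner_Pair algebra_simps)
  next
    case 3
    show ?thesis unfolding 3 n par_line_def octagon_hull_eq[OF assms(1)] hull_sides[OF assms(1)]
      by (rule key) (simp_all add: inner_Pair algebra_simps)
  next
    case 4
    show ?thesis unfolding 4 n par_line_def octagon_hull_eq[OF assms(1)] hull_sides[OF assms(1)]
      by (rule key) (simp_all add: inner_Pair algebra_simps)
  qed
qed

end

subsection \<open>Slices and diagonal sides\<close>

lemma displacement_eq:
  assumes K: "lat_octagon a1 b1 a2 b2 s1 s2 s3 s4" and J: "lat_octagon a1' b1' a2' b2' s1' s2' s3' s4'"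
    and "0 < \<epsilon>" "i \<in> {1..4}"
  shows "displacement \<epsilon> i (emb \<epsilon> ` lat_octagon.pts a1 b1 a2 b2 s1 s2 s3 s4) (emb \<epsilon> ` lat_octagon.pts a1' b1' a2' b2' s1' s2' s3' s4')
    = of_int \<bar>lat_octagon.extent a1 b1 a2 b2 i - lat_octagon.extent a1' b1' a2' b2' i\<bar>"
proof -
  interpret K: lat_octagon a1 b1 a2 b2 s1 s2 s3 s4 by (rule K)
  interpret J: lat_octagon a1' b1' a2' b2' s1' s2' s3' s4' by (rule J)
  have n: "norm (par_normal i) = 1" by (simp add: par_normal_def norm_Pair)
  have "displacement \<epsilon> i (emb \<epsilon> ` K.pts) (emb \<epsilon> ` J.pts) =
    \<bar>\<epsilon> * (of_int (K.extent i) + 1/2) - \<epsilon> * (of_int (J.extent i) + 1/2)\<bar> / \<epsilon>"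
    unfolding displacement_def K.par_line_eq[OF assms(3,4)] J.par_line_eq[OF assms(3,4)] setdist_hyperplanes[OF n] ..
  also have "\<dots> = \<bar>of_int (K.extent i - J.extent i)\<bar>"
    using assms(3) by (simp add: abs_mult flip: right_diff_distrib)
  finally show ?thesis by simp
qed

context lat_octagon
begin

lemma slices:
  assumes "0 < \<epsilon>"
  shows "slice 1 (emb \<epsilon> ` pts) = emb \<epsilon> ` ({a1 + s1..b1 - s4} \<times> {a2})"
    "slice 2 (emb \<epsilon> ` pts) = emb \<epsilon> ` ({a1} \<times> {a2 + s1..b2 - s2})"
    "slice 3 (emb \<epsilon> ` pts) = emb \<epsilon> ` ({a1 + s2..b1 - s3} \<times> {b2})"
    "slice 4 (emb \<epsilon> ` pts) = emb \<epsilon> ` ({b1} \<times> {a2 + s4..b2 - s3})"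
proof -
  have gen: "side \<nu> (emb \<epsilon> ` pts) = emb \<epsilon> ` {p \<in> pts. f p = c}"
    if f: "\<And>p. emb \<epsilon> p \<bullet> \<nu> = \<epsilon> * of_int (f p)" and "\<And>p. p \<in> pts \<Longrightarrow> f p \<le> c" "z \<in> pts" "f z = c"
    for \<nu> f c z
  proof -
    have "side \<nu> (emb \<epsilon> ` pts) = {p \<in> emb \<epsilon> ` pts. p \<bullet> \<nu> = \<epsilon> * of_int c}"
      by (rule side_eq[of _ _ _ "emb \<epsilon> z"]) (use assms that in \<open>auto simp: f\<close>)
    also have "\<dots> = emb \<epsilon> ` {p \<in> pts. f p = c}" using assms by (auto simp: f)
    finally show ?thesis .
  qed
  have n: "par_normal 1 = (0, -1)" "par_normal 2 = (-1, 0)" "par_normal 3 = (0, 1)" "par_normal 4 = (1, 0)"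
    by (simp_all add: par_normal_def)
  have "slice 1 (emb \<epsilon> ` pts) = emb \<epsilon> ` {p \<in> pts. - snd p = - a2}"
    unfolding slice_def n
    by (rule gen[of "(0, -1)" "\<lambda>p. - snd p" "- a2", OF _ _ corners(1)]) (auto simp: emb_inner pts_def)
  also have "{p \<in> pts. - snd p = - a2} = {a1 + s1..b1 - s4} \<times> {a2}"
    using cuts fit by (auto simp: pts_def)
  finally show "slice 1 (emb \<epsilon> ` pts) = emb \<epsilon> ` ({a1 + s1..b1 - s4} \<times> {a2})" .
  have "slice 2 (emb \<epsilon> ` pts) = emb \<epsilon> ` {p \<in> pts. - fst p = - a1}"
    unfolding slice_def n
    by (rule gen[of "(-1, 0)" "\<lambda>p. - fst p" "- a1", OF _ _ corners(3)]) (auto simp: emb_inner pts_def)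
  also have "{p \<in> pts. - fst p = - a1} = {a1} \<times> {a2 + s1..b2 - s2}"
    using cuts fit by (auto simp: pts_def)
  finally show "slice 2 (emb \<epsilon> ` pts) = emb \<epsilon> ` ({a1} \<times> {a2 + s1..b2 - s2})" .
  have "slice 3 (emb \<epsilon> ` pts) = emb \<epsilon> ` {p \<in> pts. snd p = b2}"
    unfolding slice_def n
    by (rule gen[of "(0, 1)" "\<lambda>p. snd p" "b2", OF _ _ corners(5)]) (auto simp: emb_inner pts_def)
  also have "{p \<in> pts. snd p = b2} = {a1 + s2..b1 - s3} \<times> {b2}"
    using cuts fit by (auto simp: pts_def)
  finally show "slice 3 (emb \<epsilon> ` pts) = emb \<epsilon> ` ({a1 + s2..b1 - s3} \<times> {b2})" .
  have "slice 4 (emb \<epsilon> ` pts) = emb \<epsilon> ` {p \<in> pts. fst p = b1}"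
    unfolding slice_def n
    by (rule gen[of "(1, 0)" "\<lambda>p. fst p" "b1", OF _ _ corners(7)]) (auto simp: emb_inner pts_def)
  also have "{p \<in> pts. fst p = b1} = {b1} \<times> {a2 + s4..b2 - s3}"
    using cuts fit by (auto simp: pts_def)
  finally show "slice 4 (emb \<epsilon> ` pts) = emb \<epsilon> ` ({b1} \<times> {a2 + s4..b2 - s3})" .
qed

lemma card_slice:
  assumes "0 < \<epsilon>" "i \<in> {1..4}"
  shows "int (card (slice i (emb \<epsilon> ` pts))) = par_count i"
proof -
  have c: "card (emb \<epsilon> ` A) = card A" for A
    by (rule card_image) (rule inj_on_subset[OF inj_emb[OF assms(1)]], simp)
  show ?thesis
    using assms(2)
  proof (cases rule: index_cases)
    case 1 then show ?thesis unfolding 1 slices(1)[OF assms(1)] c using fit by (simp add: par_count_def)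
  next
    case 2 then show ?thesis unfolding 2 slices(2)[OF assms(1)] c using fit by (simp add: par_count_def)
  next
    case 3 then show ?thesis unfolding 3 slices(3)[OF assms(1)] c using fit by (simp add: par_count_def)
  next
    case 4 then show ?thesis unfolding 4 slices(4)[OF assms(1)] c using fit by (simp add: par_count_def)
  qed
qed

lemma end_points:
  assumes "0 < \<epsilon>"
  shows "first_pt 1 (emb \<epsilon> ` pts) = emb \<epsilon> (a1 + s1, a2)" "last_pt 1 (emb \<epsilon> ` pts) = emb \<epsilon> (b1 - s4, a2)"
    "first_pt 2 (emb \<epsilon> ` pts) = emb \<epsilon> (a1, a2 + s1)" "last_pt 2 (emb \<epsilon> ` pts) = emb \<epsilon> (a1, b2 - s2)"
    "first_pt 3 (emb \<epsilon> ` pts) = emb \<epsilon> (a1 + s2, b2)" "last_pt 3 (emb \<epsilon> ` pts) = emb \<epsilon> (b1 - s3, b2)"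
    "first_pt 4 (emb \<epsilon> ` pts) = emb \<epsilon> (b1, a2 + s4)" "last_pt 4 (emb \<epsilon> ` pts) = emb \<epsilon> (b1, b2 - s3)"
proof -
  have mn: "Min ((\<lambda>x. \<epsilon> * of_int x) ` {p..q}) = \<epsilon> * of_int p" "Max ((\<lambda>x. \<epsilon> * of_int x) ` {p..q}) = \<epsilon> * of_int q"
    if "p \<le> q" for p q :: int
    using that assms by (auto intro!: Min_eqI Max_eqI)
  have h: "fst ` emb \<epsilon> ` ({p..q} \<times> {r}) = (\<lambda>x. \<epsilon> * of_int x) ` {p..q}"
    "snd ` emb \<epsilon> ` ({p..q} \<times> {r}) = {\<epsilon> * of_int r}" if "p \<le> q" for p q r :: int
    using that by (force simp: emb_def image_image)+
  have v: "snd ` emb \<epsilon> ` ({r} \<times> {p..q}) = (\<lambda>x. \<epsilon> * of_int x) ` {p..q}"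
    "fst ` emb \<epsilon> ` ({r} \<times> {p..q}) = {\<epsilon> * of_int r}" if "p \<le> q" for p q r :: int
    using that by (force simp: emb_def image_image)+
  have le: "a1 + s1 \<le> b1 - s4" "a2 + s1 \<le> b2 - s2" "a1 + s2 \<le> b1 - s3" "a2 + s4 \<le> b2 - s3"
    using fit by linarith+
  show "first_pt 1 (emb \<epsilon> ` pts) = emb \<epsilon> (a1 + s1, a2)" "last_pt 1 (emb \<epsilon> ` pts) = emb \<epsilon> (b1 - s4, a2)"
    unfolding first_pt_def last_pt_def slices[OF assms] h[OF le(1)] mn[OF le(1)] by (simp_all add: emb_def)
  show "first_pt 2 (emb \<epsilon> ` pts) = emb \<epsilon> (a1, a2 + s1)" "last_pt 2 (emb \<epsilon> ` pts) = emb \<epsilon> (a1, b2 - s2)"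
    unfolding first_pt_def last_pt_def slices[OF assms] v[OF le(2)] mn[OF le(2)] by (simp_all add: emb_def)
  show "first_pt 3 (emb \<epsilon> ` pts) = emb \<epsilon> (a1 + s2, b2)" "last_pt 3 (emb \<epsilon> ` pts) = emb \<epsilon> (b1 - s3, b2)"
    unfolding first_pt_def last_pt_def slices[OF assms] h[OF le(3)] mn[OF le(3)] by (simp_all add: emb_def)
  show "first_pt 4 (emb \<epsilon> ` pts) = emb \<epsilon> (b1, a2 + s4)" "last_pt 4 (emb \<epsilon> ` pts) = emb \<epsilon> (b1, b2 - s3)"
    unfolding first_pt_def last_pt_def slices[OF assms] v[OF le(4)] mn[OF le(4)] by (simp_all add: emb_def)
qed

lemma diag_sides:
  assumes "0 < \<epsilon>"
  shows "diag_side \<epsilon> 1 (emb \<epsilon> ` pts) = lattice \<epsilon> \<inter> closed_segment (emb \<epsilon> (a1, a2 + s1)) (emb \<epsilon> (a1 + s1, a2))"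
    "diag_side \<epsilon> 2 (emb \<epsilon> ` pts) = lattice \<epsilon> \<inter> closed_segment (emb \<epsilon> (a1, b2 - s2)) (emb \<epsilon> (a1 + s2, b2))"
    "diag_side \<epsilon> 3 (emb \<epsilon> ` pts) = lattice \<epsilon> \<inter> closed_segment (emb \<epsilon> (b1 - s3, b2)) (emb \<epsilon> (b1, b2 - s3))"
    "diag_side \<epsilon> 4 (emb \<epsilon> ` pts) = lattice \<epsilon> \<inter> closed_segment (emb \<epsilon> (b1 - s4, a2)) (emb \<epsilon> (b1, a2 + s4))"
  unfolding diag_side_def end_points[OF assms] by simp_all

lemma card_diag_side:
  assumes "0 < \<epsilon>" "i \<in> {1..4}" "cut i = 0"
  shows "card (diag_side \<epsilon> i (emb \<epsilon> ` pts)) = 1"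
  using assms(2)
proof (cases rule: index_cases)
  case 1 then show ?thesis using assms(3) unfolding 1 diag_sides[OF assms(1)] by (simp add: cut_def Int_insert_right)
next
  case 2 then show ?thesis using assms(3) unfolding 2 diag_sides[OF assms(1)] by (simp add: cut_def Int_insert_right)
next
  case 3 then show ?thesis using assms(3) unfolding 3 diag_sides[OF assms(1)] by (simp add: cut_def Int_insert_right)
next
  case 4 then show ?thesis using assms(3) unfolding 4 diag_sides[OF assms(1)] by (simp add: cut_def Int_insert_right)
qed

end

lemma emb_diagonal_segment:
  assumes "0 < \<epsilon>" "0 \<le> n"
  shows "closed_segment (emb \<epsilon> (x, y)) (emb \<epsilon> (x + n, y + n)) = {(X, Y). \<epsilon> * of_int x \<le> X \<and> X \<le> \<epsilon> * of_int (x + n) \<and> Y = 1 * X + \<epsilon> * of_int (y - x)}"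
    "closed_segment (emb \<epsilon> (x, y)) (emb \<epsilon> (x + n, y - n)) = {(X, Y). \<epsilon> * of_int x \<le> X \<and> X \<le> \<epsilon> * of_int (x + n) \<and> Y = -1 * X + \<epsilon> * of_int (y + x)}"
  using assms graph_segment[of "\<epsilon> * of_int x" "\<epsilon> * of_int (x + n)" 1 "\<epsilon> * of_int (y - x)"]
    graph_segment[of "\<epsilon> * of_int x" "\<epsilon> * of_int (x + n)" "-1" "\<epsilon> * of_int (y + x)"]
  by (simp_all add: emb_def algebra_simps)

lemma emb_diagonal_subset:
  assumes "0 < \<epsilon>" "0 \<le> n'" "x \<le> x'" "x' + n' \<le> x + n"
  shows "y' - x' = y - x \<Longrightarrow> closed_segment (emb \<epsilon> (x', y')) (emb \<epsilon> (x' + n', y' + n')) \<subseteq> closed_segment (emb \<epsilon> (x, y)) (emb \<epsilon> (x + n, y + n))"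
    "y' + x' = y + x \<Longrightarrow> closed_segment (emb \<epsilon> (x', y')) (emb \<epsilon> (x' + n', y' - n')) \<subseteq> closed_segment (emb \<epsilon> (x, y)) (emb \<epsilon> (x + n, y - n))"
proof -
  have n: "0 \<le> n" using assms by linarith
  have "\<epsilon> * of_int x \<le> \<epsilon> * of_int x'" "\<epsilon> * of_int (x' + n') \<le> \<epsilon> * of_int (x + n)"
    using assms by (simp_all only: mult_le_cancel_left_pos of_int_le_iff)
  then show "y' - x' = y - x \<Longrightarrow> closed_segment (emb \<epsilon> (x', y')) (emb \<epsilon> (x' + n', y' + n')) \<subseteq> closed_segment (emb \<epsilon> (x, y)) (emb \<epsilon> (x + n, y + n))"
    "y' + x' = y + x \<Longrightarrow> closed_segment (emb \<epsilon> (x', y')) (emb \<epsilon> (x' + n', y' - n')) \<subseteq> closed_segment (emb \<epsilon> (x, y)) (emb \<epsilon> (x + n, y - n))"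
    unfolding emb_diagonal_segment[OF assms(1,2)] emb_diagonal_segment[OF assms(1) n] by auto
qed

context lat_octagon
begin

text \<open>The diagonal stays on its line and is only shortened at both ends. Positivity of the new
  cut excludes the case in which \<open>max 0\<close> takes effect and the corner leaves that
  line.\<close>

lemma truncated_diag_side:
  fixes m :: "nat \<Rightarrow> int"
  assumes m: "\<And>i. 0 \<le> m i" "\<And>i. m i \<le> M" and pc: "\<And>i. 2 * M + 1 \<le> par_count i"
    and "0 < \<epsilon>" "i \<in> {1..4}"
    and pos: "0 < lat_octagon.cut (max 0 (s1 - m 1 - m 2)) (max 0 (s2 - m 2 - m 3)) (max 0 (s3 - m 3 - m 4)) (max 0 (s4 - m 1 - m 4)) i"
  shows "diag_side \<epsilon> i (emb \<epsilon> ` lat_octagon.pts (a1 + m 2) (b1 - m 4) (a2 + m 1) (b2 - m 3)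
    (max 0 (s1 - m 1 - m 2)) (max 0 (s2 - m 2 - m 3)) (max 0 (s3 - m 3 - m 4)) (max 0 (s4 - m 1 - m 4)))
    \<subseteq> diag_side \<epsilon> i (emb \<epsilon> ` pts)"
proof -
  interpret J: lat_octagon "a1 + m 2" "b1 - m 4" "a2 + m 1" "b2 - m 3" "max 0 (s1 - m 1 - m 2)"
    "max 0 (s2 - m 2 - m 3)" "max 0 (s3 - m 3 - m 4)" "max 0 (s4 - m 1 - m 4)"
    by (rule truncated[OF m pc])
  note b = m(1)[of 1] m(1)[of 2] m(1)[of 3] m(1)[of 4]
  show ?thesis
    using assms(5)
  proof (cases rule: index_cases)
    case 1
    have e: "max 0 (s1 - m 1 - m 2) = s1 - m 1 - m 2" "0 \<le> s1 - m 1 - m 2"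
      using pos unfolding 1 J.cut_def by (simp_all split: if_splits)
    have "closed_segment (emb \<epsilon> (a1 + m 2, a2 + s1 - m 2)) (emb \<epsilon> (a1 + m 2 + (s1 - m 1 - m 2), a2 + s1 - m 2 - (s1 - m 1 - m 2)))
      \<subseteq> closed_segment (emb \<epsilon> (a1, a2 + s1)) (emb \<epsilon> (a1 + s1, a2 + s1 - s1))"
      by (rule emb_diagonal_subset(2)[OF assms(4)]) (use e b in auto)
    then show ?thesis
      unfolding 1 J.diag_sides(1)[OF assms(4)] diag_sides(1)[OF assms(4)]
      by (simp only: e(1)) (auto simp: algebra_simps)
  next
    case 2
    have e: "max 0 (s2 - m 2 - m 3) = s2 - m 2 - m 3" "0 \<le> s2 - m 2 - m 3"
      using pos unfolding 2 J.cut_def by (simp_all split: if_splits)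
    have "closed_segment (emb \<epsilon> (a1 + m 2, b2 - s2 + m 2)) (emb \<epsilon> (a1 + m 2 + (s2 - m 2 - m 3), b2 - s2 + m 2 + (s2 - m 2 - m 3)))
      \<subseteq> closed_segment (emb \<epsilon> (a1, b2 - s2)) (emb \<epsilon> (a1 + s2, b2 - s2 + s2))"
      by (rule emb_diagonal_subset(1)[OF assms(4)]) (use e b in auto)
    then show ?thesis
      unfolding 2 J.diag_sides(2)[OF assms(4)] diag_sides(2)[OF assms(4)]
      by (simp only: e(1)) (auto simp: algebra_simps)
  next
    case 3
    have e: "max 0 (s3 - m 3 - m 4) = s3 - m 3 - m 4" "0 \<le> s3 - m 3 - m 4"
      using pos unfolding 3 J.cut_def by (simp_all split: if_splits)
    have "closed_segment (emb \<epsilon> (b1 - s3 + m 3, b2 - m 3)) (emb \<epsilon> (b1 - s3 + m 3 + (s3 - m 3 - m 4), b2 - m 3 - (s3 - m 3 - m 4)))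
      \<subseteq> closed_segment (emb \<epsilon> (b1 - s3, b2)) (emb \<epsilon> (b1 - s3 + s3, b2 - s3))"
      by (rule emb_diagonal_subset(2)[OF assms(4)]) (use e b in auto)
    then show ?thesis
      unfolding 3 J.diag_sides(3)[OF assms(4)] diag_sides(3)[OF assms(4)]
      by (simp only: e(1)) (auto simp: algebra_simps)
  next
    case 4
    have e: "max 0 (s4 - m 1 - m 4) = s4 - m 1 - m 4" "0 \<le> s4 - m 1 - m 4"
      using pos unfolding 4 J.cut_def by (simp_all split: if_splits)
    have "closed_segment (emb \<epsilon> (b1 - s4 + m 1, a2 + m 1)) (emb \<epsilon> (b1 - s4 + m 1 + (s4 - m 1 - m 4), a2 + m 1 + (s4 - m 1 - m 4)))
      \<subseteq> closed_segment (emb \<epsilon> (b1 - s4, a2)) (emb \<epsilon> (b1 - s4 + s4, a2 + s4))"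
      by (rule emb_diagonal_subset(1)[OF assms(4)]) (use e b in auto)
    then show ?thesis
      unfolding 4 J.diag_sides(4)[OF assms(4)] diag_sides(4)[OF assms(4)]
      by (simp only: e(1)) (auto simp: algebra_simps)
  qed
qed

end

subsection \<open>Discrete octagons\<close>

lemma nbhd_emb: "nbhd \<epsilon> (emb \<epsilon> (x, y)) = emb \<epsilon> ` {(x + 1, y), (x - 1, y), (x, y + 1), (x, y - 1)}"
  by (simp add: nbhd_def emb_def algebra_simps)

lemma two_neighbours_iff:
  assumes "\<not> ((x + 1, y) \<in> K \<and> (x - 1, y) \<in> K)" "\<not> ((x, y + 1) \<in> K \<and> (x, y - 1) \<in> K)"
  shows "card ({(x + 1, y), (x - 1, y), (x, y + 1), (x, y - 1 :: int)} \<inter> K) = 2 \<longleftrightarrow>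
    ((x + 1, y) \<in> K \<or> (x - 1, y) \<in> K) \<and> ((x, y + 1) \<in> K \<or> (x, y - 1) \<in> K)"
  using assms by (auto simp: Int_insert_left)

definition grid_convex :: "(int \<times> int) set \<Rightarrow> bool" where
  "grid_convex K \<longleftrightarrow>
     (\<forall>x y y' t. (x, y) \<in> K \<longrightarrow> (x, y') \<in> K \<longrightarrow> y \<le> t \<longrightarrow> t \<le> y' \<longrightarrow> (x, t) \<in> K) \<and>
     (\<forall>x x' y t. (x, y) \<in> K \<longrightarrow> (x', y) \<in> K \<longrightarrow> x \<le> t \<longrightarrow> t \<le> x' \<longrightarrow> (t, y) \<in> K)"

lemma grid_convex_box: "grid_convex K \<Longrightarrow> grid_convex (K \<inter> {a..b} \<times> {c..d})"
  unfolding grid_convex_def Int_iff mem_Times_iff atLeastAtMost_iff fst_conv snd_conv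
  by (meson order_trans)

lemma grid_convex_gap:
  assumes "grid_convex K" "(x, y) \<notin> K"
  shows "\<not> ((x + 1, y) \<in> K \<and> (x - 1, y) \<in> K)" "\<not> ((x, y + 1) \<in> K \<and> (x, y - 1) \<in> K)"
proof -
  have "(x - 1, y) \<in> K \<longrightarrow> (x + 1, y) \<in> K \<longrightarrow> x - 1 \<le> x \<longrightarrow> x \<le> x + 1 \<longrightarrow> (x, y) \<in> K"
    "(x, y - 1) \<in> K \<longrightarrow> (x, y + 1) \<in> K \<longrightarrow> y - 1 \<le> y \<longrightarrow> y \<le> y + 1 \<longrightarrow> (x, y) \<in> K"
    using assms(1) unfolding grid_convex_def by blast+
  then show "\<not> ((x + 1, y) \<in> K \<and> (x - 1, y) \<in> K)" "\<not> ((x, y + 1) \<in> K \<and> (x, y - 1) \<in> K)"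
    using assms(2) by auto
qed

text \<open>By convexity, two opposite neighbours of an outside point cannot both lie in
  \<open>K\<close>. Having two neighbours thus means one horizontal and one vertical
  neighbour.\<close>

lemma OO_set_iff:
  assumes "0 < \<epsilon>" "grid_convex K"
  shows "z \<in> OO_set \<epsilon> (emb \<epsilon> ` K) \<longleftrightarrow> (\<exists>x y. z = emb \<epsilon> (x, y) \<and> (x, y) \<notin> K \<and>
    ((x + 1, y) \<in> K \<or> (x - 1, y) \<in> K) \<and> ((x, y + 1) \<in> K \<or> (x, y - 1) \<in> K))"
proof -
  have *: "emb \<epsilon> (x, y) \<in> OO_set \<epsilon> (emb \<epsilon> ` K) \<longleftrightarrow> (x, y) \<notin> K \<and>
    ((x + 1, y) \<in> K \<or> (x - 1, y) \<in> K) \<and> ((x, y + 1) \<in> K \<or> (x, y - 1) \<in> K)" for x y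
  proof -
    define B where "B = {(x + 1, y), (x - 1, y), (x, y + 1), (x, y - 1)}"
    have "nbhd \<epsilon> (emb \<epsilon> (x, y)) \<inter> emb \<epsilon> ` K = emb \<epsilon> ` (B \<inter> K)"
      unfolding nbhd_emb B_def by (rule image_Int[OF inj_emb[OF assms(1)], symmetric])
    moreover have "card (emb \<epsilon> ` (B \<inter> K)) = card (B \<inter> K)"
      by (rule card_image) (rule inj_on_subset[OF inj_emb[OF assms(1)]], simp)
    ultimately have "emb \<epsilon> (x, y) \<in> OO_set \<epsilon> (emb \<epsilon> ` K) \<longleftrightarrow> (x, y) \<in> outer K \<and> card (B \<inter> K) = 2"
      unfolding OO_set_def outer_boundary_emb[OF assms(1)] by (simp add: emb_image_iff[OF assms(1)])
    also have "\<dots> \<longleftrightarrow> (x, y) \<notin> K \<and>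
      ((x + 1, y) \<in> K \<or> (x - 1, y) \<in> K) \<and> ((x, y + 1) \<in> K \<or> (x, y - 1) \<in> K)"
    proof (cases "(x, y) \<in> K")
      case False
      from two_neighbours_iff[OF grid_convex_gap[OF assms(2) False]] show ?thesis using False unfolding B_def outer_def by auto
    qed (simp add: outer_def)
    finally show ?thesis .
  qed
  show ?thesis
  proof
    assume z: "z \<in> OO_set \<epsilon> (emb \<epsilon> ` K)"
    then obtain x y where "z = emb \<epsilon> (x, y)"
      unfolding OO_set_def outer_boundary_emb[OF assms(1)] by (metis (no_types, lifting) imageE mem_Collect_eq surj_pair)
    then show "\<exists>x y. z = emb \<epsilon> (x, y) \<and> (x, y) \<notin> K \<and>
      ((x + 1, y) \<in> K \<or> (x - 1, y) \<in> K) \<and> ((x, y + 1) \<in> K \<or> (x, y - 1) \<in> K)" using z * by blast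
  qed (use * in blast)
qed

text \<open>A horizontal neighbour in the box fixes the range of \<open>y\<close> and a vertical one
  the range of \<open>x\<close>, so the point itself lies in the box. Being outside the
  intersection, it is then outside \<open>K\<close>: a truncation creates no new inner
  corners.\<close>

lemma OO_set_box_subset:
  assumes "0 < \<epsilon>" "grid_convex K"
  shows "OO_set \<epsilon> (emb \<epsilon> ` (K \<inter> {a..b} \<times> {c..d})) \<subseteq> OO_set \<epsilon> (emb \<epsilon> ` K)"
proof
  fix z assume "z \<in> OO_set \<epsilon> (emb \<epsilon> ` (K \<inter> {a..b} \<times> {c..d}))"
  then obtain x y where z: "z = emb \<epsilon> (x, y)" "(x, y) \<notin> K \<inter> {a..b} \<times> {c..d}"
    "(x + 1, y) \<in> K \<inter> {a..b} \<times> {c..d} \<or> (x - 1, y) \<in> K \<inter> {a..b} \<times> {c..d}"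
    "(x, y + 1) \<in> K \<inter> {a..b} \<times> {c..d} \<or> (x, y - 1) \<in> K \<inter> {a..b} \<times> {c..d}"
    unfolding OO_set_iff[OF assms(1) grid_convex_box[OF assms(2)]] by blast
  then have "(x, y) \<notin> K" "(x + 1, y) \<in> K \<or> (x - 1, y) \<in> K" "(x, y + 1) \<in> K \<or> (x, y - 1) \<in> K" by auto
  then show "z \<in> OO_set \<epsilon> (emb \<epsilon> ` K)" unfolding OO_set_iff[OF assms] using z(1) by blast
qed

lemma half_lattice:
  fixes \<epsilon> :: real
  assumes "0 < \<epsilon>"
  shows "\<epsilon> * (of_int m - 1/2) \<le> \<epsilon> * of_int n \<longleftrightarrow> m \<le> n" "\<epsilon> * of_int n \<le> \<epsilon> * (of_int m + 1/2) \<longleftrightarrow> n \<le> m"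
proof -
  have "\<epsilon> * (of_int m - 1/2) \<le> \<epsilon> * of_int n \<longleftrightarrow> real_of_int m - 1/2 \<le> of_int n"
    by (rule mult_le_cancel_left_pos[OF assms])
  also have "\<dots> \<longleftrightarrow> m \<le> n" by linarith
  finally show "\<epsilon> * (of_int m - 1/2) \<le> \<epsilon> * of_int n \<longleftrightarrow> m \<le> n" .
  have "\<epsilon> * of_int n \<le> \<epsilon> * (of_int m + 1/2) \<longleftrightarrow> real_of_int n \<le> of_int m + 1/2"
    by (rule mult_le_cancel_left_pos[OF assms])
  also have "\<dots> \<longleftrightarrow> n \<le> m" by linarith
  finally show "\<epsilon> * of_int n \<le> \<epsilon> * (of_int m + 1/2) \<longleftrightarrow> n \<le> m" .
qed

section \<open>Lattice octagons are discrete octagons\<close>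

context lat_octagon
begin

lemma grid_convex_pts: "grid_convex pts"
  unfolding grid_convex_def using pts_convex by blast

lemma strongly_connected_pts:
  assumes "0 < \<epsilon>" "\<And>i. 2 \<le> par_count i"
  shows "strongly_connected \<epsilon> (emb \<epsilon> ` pts)"
proof -
  define R where "R = {(x, y). x \<in> emb \<epsilon> ` pts \<and> y \<in> emb \<epsilon> ` pts \<and> l1_dist x y = \<epsilon>}"
  have "(emb \<epsilon> p, emb \<epsilon> q) \<in> R\<^sup>*" if p: "p \<in> pts" and q: "q \<in> pts" for p q
    using p
  proof (induction "nat (\<bar>fst p - fst q\<bar> + \<bar>snd p - snd q\<bar>)" arbitrary: p rule: less_induct)
    case less
    show ?case
    proof (cases "p = q")
      case False
      obtain x y x' y' where pq: "p = (x, y)" "q = (x', y')" by (cases p, cases q)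
      obtain r where r: "r \<in> {(x + 1, y), (x - 1, y), (x, y + 1), (x, y - 1)}" "r \<in> pts"
        "\<bar>fst r - x'\<bar> + \<bar>snd r - y'\<bar> < \<bar>x - x'\<bar> + \<bar>y - y'\<bar>"
        using step_towards[OF assms(2), of x y x' y'] less.prems q False unfolding pq by blast
      have "(emb \<epsilon> r, emb \<epsilon> q) \<in> R\<^sup>*"
        by (rule less.hyps) (use r in \<open>auto simp: pq\<close>)
      moreover have "(emb \<epsilon> p, emb \<epsilon> r) \<in> R"
        using r(1,2) less.prems unfolding R_def by (auto simp: l1_dist_emb[OF assms(1)] pq)
      ultimately show ?thesis by (rule converse_rtrancl_into_rtrancl[rotated])
    qed simp
  qed
  then show ?thesis unfolding strongly_connected_def R_def by blast
qed

lemma discrete_octagon_pts: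
  assumes "0 < \<epsilon>" "\<And>i. 2 \<le> par_count i"
  shows "discrete_octagon \<epsilon> (emb \<epsilon> ` pts)"
proof -
  \<comment> \<open>Relaxing the constraints by half a step adds no lattice points and guarantees a
    nonempty interior.\<close>
  define A where "A = real_oct (\<epsilon> * (of_int a1 - 1/2)) (\<epsilon> * (of_int b1 + 1/2)) (\<epsilon> * (of_int a2 - 1/2)) (\<epsilon> * (of_int b2 + 1/2))
     (\<epsilon> * (of_int (a1 + a2 + s1) - 1/2)) (\<epsilon> * (of_int (b1 + b2 - s3) + 1/2))
     (\<epsilon> * (of_int (a1 - b2 + s2) - 1/2)) (\<epsilon> * (of_int (b1 - a2 - s4) + 1/2))"
  have mem: "emb \<epsilon> p \<in> A \<longleftrightarrow> p \<in> pts" for p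
  proof -
    obtain x y where p: "p = (x, y)" by (cases p)
    have "\<epsilon> * of_int x + \<epsilon> * of_int y = \<epsilon> * of_int (x + y)" "\<epsilon> * of_int x - \<epsilon> * of_int y = \<epsilon> * of_int (x - y)"
      by (simp_all add: algebra_simps)
    then show ?thesis
      unfolding p A_def real_oct_def emb_def pts_def mem_Collect_eq case_prod_conv fst_conv snd_conv
      by (simp only: half_lattice[OF assms(1)])
  qed
  have I: "emb \<epsilon> ` pts = A \<inter> lattice \<epsilon>" unfolding lattice_eq using mem by blast
  have "interior A \<noteq> {}"
    unfolding A_def
  proof (rule interior_real_oct[of "\<epsilon> / 4" _ "\<epsilon> * of_int a1" _ _ "\<epsilon> * of_int (a2 + s1)"])
    have l: "\<epsilon> * (of_int m - 1/2) + \<epsilon> / 2 \<le> \<epsilon> * of_int n" if "m \<le> n" for m n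
      using that assms(1) mult_left_mono[of "of_int m" "of_int n" \<epsilon>] by (simp add: algebra_simps)
    have u: "\<epsilon> * of_int n \<le> \<epsilon> * (of_int m + 1/2) - \<epsilon> / 2" if "n \<le> m" for m n
      using that assms(1) mult_left_mono[of "of_int n" "of_int m" \<epsilon>] by (simp add: algebra_simps)
    have e: "\<epsilon> * of_int x + \<epsilon> * of_int y = \<epsilon> * of_int (x + y)" "\<epsilon> * of_int x - \<epsilon> * of_int y = \<epsilon> * of_int (x - y)" for x y
      by (simp_all add: algebra_simps)
    show "0 < \<epsilon> / 4" using assms by simp
    show "\<epsilon> * (of_int a1 - 1/2) + \<epsilon> / 4 \<le> \<epsilon> * of_int a1" "\<epsilon> * of_int a1 \<le> \<epsilon> * (of_int b1 + 1/2) - \<epsilon> / 4"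
      "\<epsilon> * (of_int a2 - 1/2) + \<epsilon> / 4 \<le> \<epsilon> * of_int (a2 + s1)" "\<epsilon> * of_int (a2 + s1) \<le> \<epsilon> * (of_int b2 + 1/2) - \<epsilon> / 4"
      using l[of a1 a1] u[of a1 b1] l[of a2 "a2 + s1"] u[of "a2 + s1" b2] cuts fit assms(1) by linarith+
    show "\<epsilon> * (of_int (a1 + a2 + s1) - 1/2) + 2 * (\<epsilon> / 4) \<le> \<epsilon> * of_int a1 + \<epsilon> * of_int (a2 + s1)"
      "\<epsilon> * of_int a1 + \<epsilon> * of_int (a2 + s1) \<le> \<epsilon> * (of_int (b1 + b2 - s3) + 1/2) - 2 * (\<epsilon> / 4)"
      "\<epsilon> * (of_int (a1 - b2 + s2) - 1/2) + 2 * (\<epsilon> / 4) \<le> \<epsilon> * of_int a1 - \<epsilon> * of_int (a2 + s1)"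
      "\<epsilon> * of_int a1 - \<epsilon> * of_int (a2 + s1) \<le> \<epsilon> * (of_int (b1 - a2 - s4) + 1/2) - 2 * (\<epsilon> / 4)"
      unfolding e using l[of "a1 + a2 + s1" "a1 + (a2 + s1)"] u[of "a1 + (a2 + s1)" "b1 + b2 - s3"]
        l[of "a1 - b2 + s2" "a1 - (a2 + s1)"] u[of "a1 - (a2 + s1)" "b1 - a2 - s4"] cuts fit by simp_all
  qed
  then have "octagon A" unfolding octagon_iff A_def by blast
  moreover have "convex A" unfolding A_def by (rule convex_real_oct)
  then have "hv_convex \<epsilon> (emb \<epsilon> ` pts)"
    unfolding hv_convex_def I using closed_segment_subset by blast
  moreover have "emb \<epsilon> ` pts \<noteq> {}" using corners(1) by blast
  ultimately show ?thesis
    unfolding discrete_octagon_def staircase_def using I strongly_connected_pts[OF assms] by blast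
qed

end

text \<open>Replace the bounds by the extreme values of \<open>x\<close>, \<open>y\<close>,
  \<open>x + y\<close> and \<open>x - y\<close> over the lattice points, so that all eight are
  attained. The \<open>fit\<close> inequalities follow: for instance, a lowest point satisfies both
  southern diagonal constraints.\<close>

lemma discrete_octagon_normal_form:
  assumes "0 < \<epsilon>" "discrete_octagon \<epsilon> I"
  obtains a1 b1 a2 b2 s1 s2 s3 s4 where "lat_octagon a1 b1 a2 b2 s1 s2 s3 s4"
    "I = emb \<epsilon> ` lat_octagon.pts a1 b1 a2 b2 s1 s2 s3 s4"
proof -
  obtain A where A: "octagon A" "I = A \<inter> lattice \<epsilon>" "I \<noteq> {}" using assms(2) by (auto simp: discrete_octagon_def)
  then obtain u1 v1 u2 v2 u3 v3 u4 v4 where Ao: "A = real_oct u1 v1 u2 v2 u3 v3 u4 v4"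
    unfolding octagon_iff by blast
  define K where "K = {p. emb \<epsilon> p \<in> A}"
  have I: "I = emb \<epsilon> ` K" unfolding A(2) K_def lattice_eq by blast
  have K: "(x, y) \<in> K \<longleftrightarrow> u1 \<le> \<epsilon> * x \<and> \<epsilon> * x \<le> v1 \<and> u2 \<le> \<epsilon> * y \<and> \<epsilon> * y \<le> v2 \<and>
    u3 \<le> \<epsilon> * (x + y) \<and> \<epsilon> * (x + y) \<le> v3 \<and> u4 \<le> \<epsilon> * (x - y) \<and> \<epsilon> * (x - y) \<le> v4" for x y
    unfolding K_def Ao real_oct_def emb_def by (simp add: distrib_left right_diff_distrib)
  have neK: "K \<noteq> {}" using A(3) I by blast
  have "K \<subseteq> {\<lfloor>u1 / \<epsilon>\<rfloor>..\<lceil>v1 / \<epsilon>\<rceil>} \<times> {\<lfloor>u2 / \<epsilon>\<rfloor>..\<lceil>v2 / \<epsilon>\<rceil>}"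
  proof clarify
    fix x y assume "(x, y) \<in> K"
    then have "u1 / \<epsilon> \<le> x" "x \<le> v1 / \<epsilon>" "u2 / \<epsilon> \<le> y" "y \<le> v2 / \<epsilon>"
      unfolding K using assms(1) by (simp_all add: field_simps)
    then show "x \<in> {\<lfloor>u1 / \<epsilon>\<rfloor>..\<lceil>v1 / \<epsilon>\<rceil>} \<and> y \<in> {\<lfloor>u2 / \<epsilon>\<rfloor>..\<lceil>v2 / \<epsilon>\<rceil>}"
      by (simp add: floor_le_iff le_ceiling_iff)
  qed
  then have finK: "finite K" by (rule finite_subset) simp
  have mn: "\<exists>p\<in>K. f p = Min (f ` K) \<and> (\<forall>q\<in>K. Min (f ` K) \<le> f q)" for f :: "int \<times> int \<Rightarrow> int"
  proof -
    have "Min (f ` K) \<in> f ` K" using finK neK by (intro Min_in) auto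
    then show ?thesis using finK by auto
  qed
  have mx: "\<exists>p\<in>K. f p = Max (f ` K) \<and> (\<forall>q\<in>K. f q \<le> Max (f ` K))" for f :: "int \<times> int \<Rightarrow> int"
  proof -
    have "Max (f ` K) \<in> f ` K" using finK neK by (intro Max_in) auto
    then show ?thesis using finK by auto
  qed
  obtain x1 y1 a1 where 1: "(x1, y1) \<in> K" "x1 = a1" "\<And>x y. (x, y) \<in> K \<Longrightarrow> a1 \<le> x" using mn[of fst] by fastforce
  obtain x2 y2 b1 where 2: "(x2, y2) \<in> K" "x2 = b1" "\<And>x y. (x, y) \<in> K \<Longrightarrow> x \<le> b1" using mx[of fst] by fastforce
  obtain x3 y3 a2 where 3: "(x3, y3) \<in> K" "y3 = a2" "\<And>x y. (x, y) \<in> K \<Longrightarrow> a2 \<le> y" using mn[of snd] by fastforce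
  obtain x4 y4 b2 where 4: "(x4, y4) \<in> K" "y4 = b2" "\<And>x y. (x, y) \<in> K \<Longrightarrow> y \<le> b2" using mx[of snd] by fastforce
  obtain x5 y5 a3 where 5: "(x5, y5) \<in> K" "x5 + y5 = a3" "\<And>x y. (x, y) \<in> K \<Longrightarrow> a3 \<le> x + y"
    using mn[of "\<lambda>p. fst p + snd p"] by fastforce
  obtain x6 y6 b3 where 6: "(x6, y6) \<in> K" "x6 + y6 = b3" "\<And>x y. (x, y) \<in> K \<Longrightarrow> x + y \<le> b3"
    using mx[of "\<lambda>p. fst p + snd p"] by fastforce
  obtain x7 y7 a4 where 7: "(x7, y7) \<in> K" "x7 - y7 = a4" "\<And>x y. (x, y) \<in> K \<Longrightarrow> a4 \<le> x - y"
    using mn[of "\<lambda>p. fst p - snd p"] by fastforce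
  obtain x8 y8 b4 where 8: "(x8, y8) \<in> K" "x8 - y8 = b4" "\<And>x y. (x, y) \<in> K \<Longrightarrow> x - y \<le> b4"
    using mx[of "\<lambda>p. fst p - snd p"] by fastforce
  have oct: "lat_octagon a1 b1 a2 b2 (a3 - a1 - a2) (a4 - a1 + b2) (b1 + b2 - b3) (b1 - a2 - b4)"
  proof unfold_locales
    show "0 \<le> a3 - a1 - a2" using 5(2) 1(3)[OF 5(1)] 3(3)[OF 5(1)] by linarith
    show "0 \<le> a4 - a1 + b2" using 7(2) 1(3)[OF 7(1)] 4(3)[OF 7(1)] by linarith
    show "0 \<le> b1 + b2 - b3" using 6(2) 2(3)[OF 6(1)] 4(3)[OF 6(1)] by linarith
    show "0 \<le> b1 - a2 - b4" using 8(2) 2(3)[OF 8(1)] 3(3)[OF 8(1)] by linarith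
    show "a3 - a1 - a2 + (b1 - a2 - b4) \<le> b1 - a1" using 3(2) 5(3)[OF 3(1)] 8(3)[OF 3(1)] by linarith
    show "a3 - a1 - a2 + (a4 - a1 + b2) \<le> b2 - a2" using 1(2) 5(3)[OF 1(1)] 7(3)[OF 1(1)] by linarith
    show "a4 - a1 + b2 + (b1 + b2 - b3) \<le> b1 - a1" using 4(2) 6(3)[OF 4(1)] 7(3)[OF 4(1)] by linarith
    show "b1 + b2 - b3 + (b1 - a2 - b4) \<le> b2 - a2" using 2(2) 6(3)[OF 2(1)] 8(3)[OF 2(1)] by linarith
  qed
  interpret O: lat_octagon a1 b1 a2 b2 "a3 - a1 - a2" "a4 - a1 + b2" "b1 + b2 - b3" "b1 - a2 - b4" by (rule oct)
  have "K = O.pts"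
  proof (rule set_eqI_pair)
    fix x y
    have m: "\<epsilon> * of_int s \<le> \<epsilon> * of_int t" if "s \<le> t" for s t :: int using that assms(1) by simp
    show "(x, y) \<in> K \<longleftrightarrow> (x, y) \<in> O.pts"
    proof
      assume p: "(x, y) \<in> K"
      show "(x, y) \<in> O.pts"
        using 1(3)[OF p] 2(3)[OF p] 3(3)[OF p] 4(3)[OF p] 5(3)[OF p] 6(3)[OF p] 7(3)[OF p] 8(3)[OF p]
        by (simp add: O.pts_def)
    next
      \<comment> \<open>Each inequality defining \<open>A\<close> holds at the point that is extreme
        for its linear form, and therefore at \<open>(x, y)\<close>.\<close>
      assume "(x, y) \<in> O.pts"
      then have b: "x1 \<le> x" "x \<le> x2" "y3 \<le> y" "y \<le> y4" "x5 + y5 \<le> x + y" "x + y \<le> x6 + y6"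
        "x7 - y7 \<le> x - y" "x - y \<le> x8 - y8"
        using 1(2) 2(2) 3(2) 4(2) 5(2) 6(2) 7(2) 8(2) by (simp_all add: O.pts_def)
      note c = 1(1)[unfolded K] 2(1)[unfolded K] 3(1)[unfolded K] 4(1)[unfolded K]
        5(1)[unfolded K] 6(1)[unfolded K] 7(1)[unfolded K] 8(1)[unfolded K]
      note mb = m[OF b(1)] m[OF b(2)] m[OF b(3)] m[OF b(4)] m[OF b(5)] m[OF b(6)] m[OF b(7)] m[OF b(8)]
      show "(x, y) \<in> K" unfolding K using c mb by (intro conjI; (elim conjE)?; (simp only: of_int_add of_int_diff)?; linarith)
    qed
  qed
  then show ?thesis using that[OF oct] I by blast
qed

subsection \<open>The evolution step\<close>

text \<open>The real \<open>x\<close> lies in \<open>[m, m + 1]\<close> up to an error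
  \<open>d\<close>. Far from the integers the error cannot carry it across one, so \<open>m\<close>
  is the floor. If an integer \<open>n\<close> is nearer than \<open>e\<close>, then
  \<open>d + e < 1\<close> leaves only \<open>m = n\<close> and \<open>m = n - 1\<close>.\<close>

lemma displacement_value:
  fixes x d e :: real and m :: int
  assumes "0 \<le> m" "0 < x" "d < e" "2 * e \<le> 1" "of_int m \<le> x + d" "x \<le> of_int m + 1 + d"
  shows "e \<le> infdist x (real ` {1..}) \<Longrightarrow> m = \<lfloor>x\<rfloor>"
    and "infdist x (real ` {1..}) < e \<Longrightarrow> m = round x \<or> m = round x - 1"
proof -
  assume far: "e \<le> infdist x (real ` {1..})"
  have sep: "e \<le> \<bar>x - of_int n\<bar>" if "1 \<le> n" for n :: int
  proof -
    have "real_of_int n \<in> real ` {1..}" using that by (intro image_eqI[of _ _ "nat n"]) auto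
    then show ?thesis using infdist_le[of "real_of_int n" "real ` {1..}" x] far by (simp add: dist_real_def)
  qed
  \<comment> \<open>The distance is to the positive integers only. This suffices, since
    \<open>m > x > 0\<close> would force \<open>m\<close> to be at least 1.\<close>
  have "of_int m \<le> x"
  proof (rule ccontr)
    assume "\<not> of_int m \<le> x"
    then show False using sep[of m] assms by linarith
  qed
  moreover have "x < of_int m + 1"
  proof (rule ccontr)
    assume "\<not> x < of_int m + 1"
    then show False using sep[of "m + 1"] assms by simp
  qed
  ultimately show "m = \<lfloor>x\<rfloor>" by linarith
next
  assume near: "infdist x (real ` {1..}) < e"
  have "\<exists>a\<in>real ` {1..}. dist x a < e"
  proof (rule ccontr)
    assume "\<not> ?thesis"
    then have "e \<le> (INF a\<in>real ` {1..}. dist x a)" by (intro cINF_greatest) (auto simp: not_less)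
    then show False using near by (simp add: infdist_def)
  qed
  then obtain n :: nat where n: "\<bar>x - real n\<bar> < e" by (auto simp: dist_real_def)
  then have "round x = int n" using assms(4) by (intro round_unique') simp
  moreover have "m \<le> int n" "int n - 1 \<le> m" using n assms by linarith+
  ultimately show "m = round x \<or> m = round x - 1" by linarith
qed

text \<open>The statement for a single \<open>\<epsilon>\<close>, with every smallness requirement
  made an explicit inequality in terms of \<open>M\<close>.\<close>

lemma evolution_step:
  fixes M :: int
  assumes \<epsilon>: "0 < \<epsilon>" "0 < \<zeta>" and k: "0 \<le> k" "k < 1" and "0 < cbar"
    and M: "0 \<le> M" "16 * (1 - k) * \<zeta> \<le> of_int (M + 1) * cbar" "of_int (4 * M + 4) \<le> cbar / \<epsilon>"
    and pen: "2 * (1 - k) * \<epsilon> \<le> \<epsilon> powr \<gamma> / (\<zeta> * \<epsilon>)"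
    and c: "c = 3 * of_int ((M + 1)\<^sup>2) / cbar" "2 * (c * \<epsilon>) \<le> 1"
    and w: "w \<in> configs \<epsilon>" "outer_boundary \<epsilon> (phaseI \<epsilon> w) \<subseteq> phaseZ \<epsilon> w"
    and oct: "discrete_octagon \<epsilon> (phaseI \<epsilon> w)"
    and counts: "\<And>i. i \<in> {1..4} \<Longrightarrow> cbar / \<epsilon> \<le> real (card (slice i (phaseI \<epsilon> w)))"
    and min: "minimizer k (\<zeta> * \<epsilon>) \<gamma> \<epsilon> w u"
    and room: "j \<in> {1..4}" "2 * \<epsilon> * sqrt (real (card (phaseZ \<epsilon> w))) \<le> diag_length \<epsilon> j (phaseI \<epsilon> w) / sqrt 2"
      "\<epsilon> * of_int (8 * M + 4) \<le> diag_length \<epsilon> j (phaseI \<epsilon> w) / sqrt 2"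
  shows "let I = phaseI \<epsilon> w; J = phaseI \<epsilon> u in
        discrete_octagon \<epsilon> J \<and>
        OO_set \<epsilon> J \<subseteq> OO_set \<epsilon> I \<and>
        (\<forall>i\<in>{1..4}. diag_length \<epsilon> i J > 0 \<longrightarrow> diag_side \<epsilon> i J \<subseteq> diag_side \<epsilon> i I) \<and>
        (\<forall>i\<in>{1..4}. diag_length \<epsilon> i I = 0 \<longrightarrow> card (diag_side \<epsilon> i J) = 1) \<and>
        (\<forall>i\<in>{1..4}.
          let x = 2 * \<zeta> * (1 - k) / par_length \<epsilon> i I; \<alpha> = displacement \<epsilon> i I J in
            (infdist x (real ` {1..}) \<ge> c * \<epsilon> \<longrightarrow> \<alpha> = of_int \<lfloor>x\<rfloor>) \<and>
            (infdist x (real ` {1..}) < c * \<epsilon> \<longrightarrow>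
               \<alpha> \<in> {of_int (round x), of_int (round x) - 1}))"
proof -
  obtain a1 b1 a2 b2 s1 s2 s3 s4 where lat: "lat_octagon a1 b1 a2 b2 s1 s2 s3 s4"
    and I: "phaseI \<epsilon> w = emb \<epsilon> ` lat_octagon.pts a1 b1 a2 b2 s1 s2 s3 s4"
    by (rule discrete_octagon_normal_form[OF \<epsilon>(1) oct])
  interpret lat_octagon a1 b1 a2 b2 s1 s2 s3 s4 by (rule lat)
  define L where "L = \<lceil>cbar / \<epsilon>\<rceil>"
  define lam where "lam = 2 * (1 - k) * \<zeta> / \<epsilon>"
  have n_ge: "cbar / \<epsilon> \<le> of_int (par_count i)" for i
  proof -
    have *: "cbar / \<epsilon> \<le> of_int (par_count i)" if "i \<in> {1..4}" for i
    proof -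
      have "real (card (slice i (emb \<epsilon> ` pts))) = of_int (par_count i)"
        unfolding card_slice[OF \<epsilon>(1) that, symmetric] by simp
      then show ?thesis using counts[OF that] unfolding I by simp
    qed
    show ?thesis
    proof (cases "i \<in> {1..4}")
      case False
      then have "par_count i = par_count 4" by (auto simp: par_count_def)
      then show ?thesis using *[of 4] by simp
    qed (rule *)
  qed
  have L: "L \<le> par_count i" for i unfolding L_def using n_ge[of i] by (simp add: ceiling_le_iff)
  have LM: "4 * M + 4 \<le> L" unfolding L_def using M(3) by (simp only: le_ceiling_iff)
  have lam4: "4 * lam \<le> of_int ((M + 1) * (L - 2 * M))"
  proof -
    have "4 * lam = 16 * (1 - k) * \<zeta> / (2 * \<epsilon>)" using \<epsilon>(1) by (simp add: lam_def field_simps)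
    also have "\<dots> \<le> of_int (M + 1) * cbar / (2 * \<epsilon>)"
      using \<epsilon>(1) by (intro divide_right_mono M(2)) simp
    also have "\<dots> = of_int (M + 1) * (cbar / \<epsilon> / 2)" by simp
    also have "\<dots> \<le> of_int (M + 1) * (of_int L - 2 * of_int M)"
    proof (rule mult_left_mono)
      have "cbar / \<epsilon> \<le> of_int L" by (simp add: L_def)
      moreover have "4 * of_int M + 4 \<le> cbar / \<epsilon>" using M(3) by simp
      moreover have "z / 2 \<le> l - 2 * m" if "z \<le> l" "4 * m + 4 \<le> z" for z l m :: real
        using that by (simp add: field_simps)
      ultimately show "cbar / \<epsilon> / 2 \<le> of_int L - 2 * of_int M" by blast
    qed (use M(1) in simp)
    finally show ?thesis by simp
  qed
  define s where "s = cut j"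
  have dl: "diag_length \<epsilon> j (phaseI \<epsilon> w) / sqrt 2 = \<epsilon> * of_int s"
    unfolding I diag_length_eq[OF \<epsilon>(1) room(1)] s_def by simp
  have s1: "8 * M + 4 \<le> s"
    using room(3) \<epsilon>(1) unfolding dl by (simp only: mult_le_cancel_left_pos of_int_le_iff)
  have s2: "2 * sqrt (real (card (phaseZ \<epsilon> w))) \<le> of_int s"
  proof -
    have "\<epsilon> * (2 * sqrt (real (card (phaseZ \<epsilon> w)))) \<le> \<epsilon> * of_int s"
      using room(2) unfolding dl by (simp add: mult_ac)
    then show ?thesis using \<epsilon>(1) by (simp only: mult_le_cancel_left_pos)
  qed
  have roomN: "2 * int (card (phaseZ \<epsilon> w)) \<le> (s - 2 * M) * (s - 2 * M - 1)"
  proof -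
    have "(2 * sqrt (real (card (phaseZ \<epsilon> w))))\<^sup>2 \<le> (of_int s)\<^sup>2" using s2 by (intro power_mono) auto
    then have "4 * real (card (phaseZ \<epsilon> w)) \<le> (of_int s)\<^sup>2" by (simp add: power_mult_distrib)
    then have "real_of_int (4 * int (card (phaseZ \<epsilon> w))) \<le> real_of_int (s\<^sup>2)" by simp
    then have "4 * int (card (phaseZ \<epsilon> w)) \<le> s\<^sup>2" by (simp only: of_int_le_iff)
    \<comment> \<open>Since \<open>s\<close> is at least \<open>8 * M + 4\<close>,
      \<open>4 * (s - 2 * M - 1)\<close> is at least \<open>3 * s\<close>, and 8 is at most 9: this
      is the reason for the margin \<open>8 * M + 4\<close>.\<close>
    then have "16 * (2 * int (card (phaseZ \<epsilon> w))) \<le> 8 * s\<^sup>2" by simp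
    also have "\<dots> \<le> (3 * s) * (3 * s)" by (simp add: power2_eq_square)
    also have "\<dots> \<le> (4 * (s - 2 * M)) * (4 * (s - 2 * M - 1))"
      by (rule mult_mono) (use s1 M(1) in auto)
    also have "\<dots> = 16 * ((s - 2 * M) * (s - 2 * M - 1))" by (simp add: algebra_simps)
    finally show ?thesis by (rule mult_left_le_imp_le) simp
  qed
  have sm: "s \<in> {s1, s2, s3, s4}" by (simp add: s_def cut_def)
  have sM: "2 * M + 1 \<le> s" using s1 M(1) by linarith
  obtain m :: "nat \<Rightarrow> int" where m: "\<And>i. 0 \<le> m i" "\<And>i. m i \<le> M"
    and lo: "\<And>i. of_int (m i * (par_count i - 2 * M)) \<le> lam"
    and hi: "\<And>i. lam \<le> of_int ((m i + 1) * (par_count i + 2 * (m i + 1)))"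
    and Ju: "phaseI \<epsilon> u = emb \<epsilon> ` (pts \<inter> {a1 + m 2..b1 - m 4} \<times> {a2 + m 1..b2 - m 3})"
    using minimizer_shape[OF \<epsilon> k w(1) I w(2) min M(1) LM L lam_def lam4 pen sm sM roomN] by blast
  have pc: "2 * M + 1 \<le> par_count i" for i using L[of i] LM M(1) by linarith
  interpret J: lat_octagon "a1 + m 2" "b1 - m 4" "a2 + m 1" "b2 - m 3" "max 0 (s1 - m 1 - m 2)"
    "max 0 (s2 - m 2 - m 3)" "max 0 (s3 - m 3 - m 4)" "max 0 (s4 - m 1 - m 4)"
    by (rule truncated[OF m pc])
  have Jpts: "pts \<inter> {a1 + m 2..b1 - m 4} \<times> {a2 + m 1..b2 - m 3} = J.pts"
    by (rule truncated_pts[OF m pc, symmetric])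
  have J2: "2 \<le> J.par_count i" for i
  proof -
    have "2 \<le> par_count i - 2 * M" using L[of i] LM M(1) by linarith
    also have "\<dots> \<le> J.par_count i" by (rule truncated_counts(1)[OF m pc])
    finally show ?thesis .
  qed
  have p1: "discrete_octagon \<epsilon> (emb \<epsilon> ` J.pts)" by (rule J.discrete_octagon_pts[OF \<epsilon>(1) J2])
  have p2: "OO_set \<epsilon> (emb \<epsilon> ` J.pts) \<subseteq> OO_set \<epsilon> (emb \<epsilon> ` pts)"
    unfolding Jpts[symmetric] by (rule OO_set_box_subset[OF \<epsilon>(1) grid_convex_pts])
  have p3: "diag_side \<epsilon> i (emb \<epsilon> ` J.pts) \<subseteq> diag_side \<epsilon> i (emb \<epsilon> ` pts)"
    if "i \<in> {1..4}" "0 < diag_length \<epsilon> i (emb \<epsilon> ` J.pts)" for i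
  proof -
    have "0 < J.cut i"
      using that(2) \<epsilon>(1) unfolding J.diag_length_eq[OF \<epsilon>(1) that(1)] by (simp add: zero_less_mult_iff)
    then show ?thesis by (rule truncated_diag_side[OF m pc \<epsilon>(1) that(1)])
  qed
  have p4: "card (diag_side \<epsilon> i (emb \<epsilon> ` J.pts)) = 1"
    if "i \<in> {1..4}" "diag_length \<epsilon> i (emb \<epsilon> ` pts) = 0" for i
  proof (rule J.card_diag_side[OF \<epsilon>(1) that(1)])
    have "cut i = 0" using that(2) \<epsilon>(1) unfolding diag_length_eq[OF \<epsilon>(1) that(1)] by simp
    then show "J.cut i = 0"
      unfolding J.cut_def using m(1)[of 1] m(1)[of 2] m(1)[of 3] m(1)[of 4]
      by (auto simp: cut_def split: if_splits)
  qed
  have disp: "displacement \<epsilon> i (emb \<epsilon> ` pts) (emb \<epsilon> ` J.pts) = of_int (m i)" if i: "i \<in> {1..4}" for i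
  proof -
    have "\<bar>extent i - J.extent i\<bar> = m i"
      unfolding extent_def J.extent_def using i m(1)[of i] by (cases rule: index_cases) simp_all
    then show ?thesis
      using displacement_eq[OF lat J.lat_octagon_axioms \<epsilon>(1) i] by simp
  qed
  \<comment> \<open>Bounds the errors in \<open>lo\<close> and \<open>hi\<close> after division by
    \<open>par_count i\<close>, which is at least \<open>cbar / \<epsilon>\<close>. The factor 3
    instead of 2 in \<open>c\<close> makes \<open>d < c * \<epsilon>\<close> strict, as
    \<open>displacement_value\<close> requires.\<close>
  define d where "d = 2 * of_int ((M + 1)\<^sup>2) / cbar * \<epsilon>"
  have M1: "0 < real_of_int ((M + 1)\<^sup>2)" using M(1) by simp
  have dc: "d < c * \<epsilon>"
    unfolding d_def c(1) using \<epsilon>(1) \<open>0 < cbar\<close> M1 by (intro mult_strict_right_mono divide_strict_right_mono) auto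
  have bounds: "0 < 2 * \<zeta> * (1 - k) / (\<epsilon> * of_int (par_count i))"
    "of_int (m i) \<le> 2 * \<zeta> * (1 - k) / (\<epsilon> * of_int (par_count i)) + d"
    "2 * \<zeta> * (1 - k) / (\<epsilon> * of_int (par_count i)) \<le> of_int (m i) + 1 + d" for i
  proof -
    define n where "n = real_of_int (par_count i)"
    define x where "x = 2 * \<zeta> * (1 - k) / (\<epsilon> * n)"
    have n: "0 < n" unfolding n_def using pc[of i] M(1) by simp
    have cn: "cbar / \<epsilon> \<le> n" unfolding n_def by (rule n_ge)
    have lamx: "lam = n * x" using n by (simp add: lam_def x_def)
    have dn: "2 * real_of_int ((M + 1)\<^sup>2) \<le> n * d"
    proof -
      have "2 * real_of_int ((M + 1)\<^sup>2) = cbar / \<epsilon> * d" using \<epsilon>(1) \<open>0 < cbar\<close> by (simp add: d_def)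
      also have "\<dots> \<le> n * d" using cn M1 \<epsilon>(1) \<open>0 < cbar\<close> by (intro mult_right_mono) (simp_all add: d_def)
      finally show ?thesis .
    qed
    have sq: "m i * M \<le> (M + 1)\<^sup>2" "(m i + 1) * (m i + 1) \<le> (M + 1)\<^sup>2"
      unfolding power2_eq_square using m[of i] M(1) by (intro mult_mono; simp)+
    then have sqr: "real_of_int (m i * M) \<le> of_int ((M + 1)\<^sup>2)"
      "real_of_int ((m i + 1) * (m i + 1)) \<le> of_int ((M + 1)\<^sup>2)"
      by (simp_all only: of_int_le_iff)
    have "n * of_int (m i) = of_int (m i * (par_count i - 2 * M)) + 2 * of_int (m i * M)"
      by (simp add: n_def algebra_simps)
    also have "\<dots> \<le> n * x + 2 * of_int ((M + 1)\<^sup>2)"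
      unfolding lamx[symmetric] by (rule add_mono[OF lo mult_left_mono[OF sqr(1) zero_le_numeral]])
    also have "\<dots> \<le> n * x + n * d" using dn by simp
    finally have "n * of_int (m i) \<le> n * (x + d)" by (simp add: distrib_left)
    then show "of_int (m i) \<le> 2 * \<zeta> * (1 - k) / (\<epsilon> * of_int (par_count i)) + d"
      using n unfolding x_def n_def by simp
    have "n * x \<le> of_int ((m i + 1) * (par_count i + 2 * (m i + 1)))" using hi[of i] unfolding lamx .
    also have "\<dots> = n * (of_int (m i) + 1) + 2 * of_int ((m i + 1) * (m i + 1))"
      by (simp add: n_def algebra_simps)
    also have "\<dots> \<le> n * (of_int (m i) + 1) + 2 * of_int ((M + 1)\<^sup>2)"
      by (rule add_left_mono[OF mult_left_mono[OF sqr(2) zero_le_numeral]])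
    also have "\<dots> \<le> n * (of_int (m i) + 1) + n * d" using dn by simp
    finally have "n * x \<le> n * (of_int (m i) + 1 + d)" by (simp add: distrib_left)
    then have "x \<le> of_int (m i) + 1 + d" by (simp only: mult_le_cancel_left_pos[OF n])
    then show "2 * \<zeta> * (1 - k) / (\<epsilon> * of_int (par_count i)) \<le> of_int (m i) + 1 + d"
      unfolding x_def n_def .
    show "0 < 2 * \<zeta> * (1 - k) / (\<epsilon> * of_int (par_count i))"
      using n \<epsilon> k unfolding n_def by simp
  qed
  have p5: "let x = 2 * \<zeta> * (1 - k) / par_length \<epsilon> i (emb \<epsilon> ` pts); \<alpha> = displacement \<epsilon> i (emb \<epsilon> ` pts) (emb \<epsilon> ` J.pts) in
            (infdist x (real ` {1..}) \<ge> c * \<epsilon> \<longrightarrow> \<alpha> = of_int \<lfloor>x\<rfloor>) \<and>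
            (infdist x (real ` {1..}) < c * \<epsilon> \<longrightarrow> \<alpha> \<in> {of_int (round x), of_int (round x) - 1})"
    if i: "i \<in> {1..4}" for i
    using displacement_value[OF m(1)[of i] bounds(1)[of i] dc c(2) bounds(2,3)[of i]]
    unfolding Let_def par_length_eq[OF \<epsilon>(1) i] disp[OF i] by fastforce
  show ?thesis
    unfolding Let_def I Ju Jpts using p1 p2 p3 p4 p5[unfolded Let_def] by blast
qed

lemma powr_le_small:
  fixes \<epsilon> a b :: real
  assumes "0 < \<epsilon>" "0 < a" "0 < b" "\<epsilon> \<le> b powr (1 / a)"
  shows "\<epsilon> powr a \<le> b"
proof -
  have "\<epsilon> powr a \<le> (b powr (1 / a)) powr a" using assms by (intro powr_mono2) auto
  then show ?thesis using assms by (simp add: powr_powr)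
qed

theorem proposition5p8:
  fixes k \<zeta> \<mu> cbar :: real
  assumes "1/3 < k" "k < 1" and "\<zeta> > 0" and "0 < \<mu>" "\<mu> < 1/4" and "cbar > 0"
  shows "\<exists>c>0. \<forall>(\<gamma>::real) (R::real) (\<epsilon>0::real) (u :: real \<Rightarrow> pt \<Rightarrow> real) (v :: real \<Rightarrow> pt \<Rightarrow> real).
    0 < \<gamma> \<and> \<gamma> < 2 \<and> 0 < \<epsilon>0 \<and>
    (\<forall>\<epsilon>\<in>{0<..\<epsilon>0}.
       u \<epsilon> \<in> configs \<epsilon> \<and>
       minimizer k (\<zeta> * \<epsilon>) \<gamma> \<epsilon> (u \<epsilon>) (v \<epsilon>) \<and>
       discrete_octagon \<epsilon> (phaseI \<epsilon> (u \<epsilon>)) \<and>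
       outer_boundary \<epsilon> (phaseI \<epsilon> (u \<epsilon>)) \<subseteq> phaseZ \<epsilon> (u \<epsilon>) \<and>
       (\<exists>i\<in>{1..4}. diag_length \<epsilon> i (phaseI \<epsilon> (u \<epsilon>)) / sqrt 2
          \<ge> max (2 * \<epsilon> * sqrt (real (card (phaseZ \<epsilon> (u \<epsilon>))))) (\<epsilon> powr \<mu>))) \<and>
    assumption_H {0<..\<epsilon>0} (\<lambda>\<epsilon>. phaseI \<epsilon> (u \<epsilon>)) R cbar \<and>
    ((\<lambda>\<epsilon>. \<epsilon>\<^sup>2 * real (card (phaseZ \<epsilon> (u \<epsilon>)))) \<longlongrightarrow> 0) (at_right 0)
    \<longrightarrow>
    (\<exists>\<epsilon>bar>0. \<forall>\<epsilon>. 0 < \<epsilon> \<and> \<epsilon> \<le> \<epsilon>bar \<longrightarrow>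
      (let I = phaseI \<epsilon> (u \<epsilon>); J = phaseI \<epsilon> (v \<epsilon>) in
        discrete_octagon \<epsilon> J \<and>
        OO_set \<epsilon> J \<subseteq> OO_set \<epsilon> I \<and>
        (\<forall>i\<in>{1..4}. diag_length \<epsilon> i J > 0 \<longrightarrow> diag_side \<epsilon> i J \<subseteq> diag_side \<epsilon> i I) \<and>
        (\<forall>i\<in>{1..4}. diag_length \<epsilon> i I = 0 \<longrightarrow> card (diag_side \<epsilon> i J) = 1) \<and>
        (\<forall>i\<in>{1..4}.
          let x = 2 * \<zeta> * (1 - k) / par_length \<epsilon> i I; \<alpha> = displacement \<epsilon> i I J in
            (infdist x (real ` {1..}) \<ge> c * \<epsilon> \<longrightarrow> \<alpha> = of_int \<lfloor>x\<rfloor>) \<and>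
            (infdist x (real ` {1..}) < c * \<epsilon> \<longrightarrow>
               \<alpha> \<in> {of_int (round x), of_int (round x) - 1}))))"
proof -
  \<comment> \<open>Bounds the number of layers a side can lose. The factor 16 collects the 4 in the
    weight \<open>4 * lam\<close> demanded of core lines, the 2 in \<open>lam\<close>, and another 2
    because trimming may cost half of a slice.\<close>
  define M where "M = \<lceil>16 * (1 - k) * \<zeta> / cbar\<rceil>"
  have M0: "0 \<le> M"
  proof -
    have "0 \<le> 16 * (1 - k) * \<zeta> / cbar" using assms by simp
    then show ?thesis unfolding M_def by (simp add: le_ceiling_iff)
  qed
  have M1: "16 * (1 - k) * \<zeta> \<le> of_int (M + 1) * cbar"
  proof -
    have "16 * (1 - k) * \<zeta> / cbar \<le> of_int (M + 1)" unfolding M_def by linarith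
    then show ?thesis using assms(6) by (simp add: field_simps)
  qed
  \<comment> \<open>Fixed before \<open>\<gamma>\<close>, the radius and the families of
    configurations, hence uniform in them.\<close>
  define c where "c = 3 * real_of_int ((M + 1)\<^sup>2) / cbar"
  have c0: "0 < c" using M0 assms(6) by (simp add: c_def)
  show ?thesis
  proof (rule exI[of _ c], intro conjI c0 allI impI, elim conjE)
    fix \<gamma> R \<epsilon>0 :: real and u v :: "real \<Rightarrow> pt \<Rightarrow> real"
    assume \<gamma>: "0 < \<gamma>" "\<gamma> < 2" and \<epsilon>0: "0 < \<epsilon>0"
      and hyp: "\<forall>\<epsilon>\<in>{0<..\<epsilon>0}.
       u \<epsilon> \<in> configs \<epsilon> \<and>
       minimizer k (\<zeta> * \<epsilon>) \<gamma> \<epsilon> (u \<epsilon>) (v \<epsilon>) \<and>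
       discrete_octagon \<epsilon> (phaseI \<epsilon> (u \<epsilon>)) \<and>
       outer_boundary \<epsilon> (phaseI \<epsilon> (u \<epsilon>)) \<subseteq> phaseZ \<epsilon> (u \<epsilon>) \<and>
       (\<exists>i\<in>{1..4}. diag_length \<epsilon> i (phaseI \<epsilon> (u \<epsilon>)) / sqrt 2
          \<ge> max (2 * \<epsilon> * sqrt (real (card (phaseZ \<epsilon> (u \<epsilon>))))) (\<epsilon> powr \<mu>))"
      and H: "assumption_H {0<..\<epsilon>0} (\<lambda>\<epsilon>. phaseI \<epsilon> (u \<epsilon>)) R cbar"
    \<comment> \<open>\<open>e1\<close> gives every slice at least \<open>4 * M + 4\<close> points;
      \<open>e2\<close> makes the penalty for one zero outweigh its energy, which is where
      \<open>\<gamma> < 2\<close> enters; \<open>e3\<close> makes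
      \<open>\<epsilon> powr \<mu>\<close> at least \<open>8 * M + 4\<close> lattice steps;
      \<open>e4\<close> gives \<open>c * \<epsilon> \<le> 1/2\<close>, so that the closest integer
      is unambiguous in the second case.\<close>
    define e1 where "e1 = cbar / of_int (4 * M + 4)"
    define e2 where "e2 = (1 / (2 * (1 - k) * \<zeta>)) powr (1 / (2 - \<gamma>))"
    define e3 where "e3 = (1 / of_int (8 * M + 4)) powr (1 / (1 - \<mu>))"
    define e4 where "e4 = 1 / (2 * c)"
    define e where "e = min \<epsilon>0 (min (min e1 e2) (min e3 e4))"
    have e0: "0 < e" using \<epsilon>0 assms M0 c0 by (simp add: e_def e1_def e2_def e3_def e4_def)
    let ?Q = "\<lambda>\<epsilon>. let I = phaseI \<epsilon> (u \<epsilon>); J = phaseI \<epsilon> (v \<epsilon>) in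
        discrete_octagon \<epsilon> J \<and>
        OO_set \<epsilon> J \<subseteq> OO_set \<epsilon> I \<and>
        (\<forall>i\<in>{1..4}. diag_length \<epsilon> i J > 0 \<longrightarrow> diag_side \<epsilon> i J \<subseteq> diag_side \<epsilon> i I) \<and>
        (\<forall>i\<in>{1..4}. diag_length \<epsilon> i I = 0 \<longrightarrow> card (diag_side \<epsilon> i J) = 1) \<and>
        (\<forall>i\<in>{1..4}.
          let x = 2 * \<zeta> * (1 - k) / par_length \<epsilon> i I; \<alpha> = displacement \<epsilon> i I J in
            (infdist x (real ` {1..}) \<ge> c * \<epsilon> \<longrightarrow> \<alpha> = of_int \<lfloor>x\<rfloor>) \<and>
            (infdist x (real ` {1..}) < c * \<epsilon> \<longrightarrow>
               \<alpha> \<in> {of_int (round x), of_int (round x) - 1}))"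
    show "\<exists>\<epsilon>bar>0. \<forall>\<epsilon>. 0 < \<epsilon> \<and> \<epsilon> \<le> \<epsilon>bar \<longrightarrow> ?Q \<epsilon>"
    proof (rule exI[of _ e], intro conjI e0 allI impI, elim conjE)
      fix \<epsilon> :: real assume \<epsilon>: "0 < \<epsilon>" "\<epsilon> \<le> e"
      have le: "\<epsilon> \<le> \<epsilon>0" "\<epsilon> \<le> e1" "\<epsilon> \<le> e2" "\<epsilon> \<le> e3" "\<epsilon> \<le> e4" using \<epsilon>(2) by (simp_all add: e_def)
      have \<epsilon>in: "\<epsilon> \<in> {0<..\<epsilon>0}" using \<epsilon> le by simp
      obtain j where j: "j \<in> {1..4}" "max (2 * \<epsilon> * sqrt (real (card (phaseZ \<epsilon> (u \<epsilon>))))) (\<epsilon> powr \<mu>)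
          \<le> diag_length \<epsilon> j (phaseI \<epsilon> (u \<epsilon>)) / sqrt 2"
        using hyp \<epsilon>in by blast
      have M2: "of_int (4 * M + 4) \<le> cbar / \<epsilon>"
        using le(2) \<epsilon>(1) M0 by (simp add: e1_def field_simps)
      have pen: "2 * (1 - k) * \<epsilon> \<le> \<epsilon> powr \<gamma> / (\<zeta> * \<epsilon>)"
      proof -
        have "\<epsilon> powr (2 - \<gamma>) \<le> 1 / (2 * (1 - k) * \<zeta>)"
          using le(3) \<epsilon>(1) \<gamma> assms unfolding e2_def by (intro powr_le_small) auto
        then have "\<epsilon> powr (2 - \<gamma>) * (2 * (1 - k) * \<zeta>) \<le> 1" using assms by (simp add: field_simps)
        then have "\<epsilon> powr \<gamma> * (\<epsilon> powr (2 - \<gamma>) * (2 * (1 - k) * \<zeta>)) \<le> \<epsilon> powr \<gamma> * 1"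
          by (rule mult_left_mono) simp
        moreover have "\<epsilon> powr \<gamma> * \<epsilon> powr (2 - \<gamma>) = \<epsilon>\<^sup>2"
          using \<epsilon>(1) by (simp flip: powr_add)
        ultimately have "\<epsilon>\<^sup>2 * (2 * (1 - k) * \<zeta>) \<le> \<epsilon> powr \<gamma>" by (simp add: mult.assoc[symmetric])
        then show ?thesis using \<epsilon>(1) assms(3) by (simp add: pos_le_divide_eq power2_eq_square mult_ac)
      qed
      have c2: "2 * (c * \<epsilon>) \<le> 1" using le(5) c0 by (simp add: e4_def field_simps)
      have room: "\<epsilon> * of_int (8 * M + 4) \<le> \<epsilon> powr \<mu>"
      proof -
        have "\<epsilon> powr (1 - \<mu>) \<le> 1 / of_int (8 * M + 4)"
          using le(4) \<epsilon>(1) assms M0 unfolding e3_def by (intro powr_le_small) auto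
        then have "\<epsilon> powr (1 - \<mu>) * of_int (8 * M + 4) \<le> 1"
          using M0 by (simp add: field_simps)
        then have "\<epsilon> powr \<mu> * (\<epsilon> powr (1 - \<mu>) * of_int (8 * M + 4)) \<le> \<epsilon> powr \<mu> * 1"
          by (rule mult_left_mono) simp
        moreover have "\<epsilon> powr \<mu> * \<epsilon> powr (1 - \<mu>) = \<epsilon>"
          using \<epsilon>(1) by (simp flip: powr_add)
        ultimately show ?thesis by (simp add: mult.assoc[symmetric])
      qed
      have k0: "0 \<le> k" using assms(1) by simp
      show "?Q \<epsilon>"
      proof (rule evolution_step[OF \<epsilon>(1) assms(3) k0 assms(2,6) M0 M1 M2 pen c_def c2])
        show "u \<epsilon> \<in> configs \<epsilon>" "outer_boundary \<epsilon> (phaseI \<epsilon> (u \<epsilon>)) \<subseteq> phaseZ \<epsilon> (u \<epsilon>)"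
          "discrete_octagon \<epsilon> (phaseI \<epsilon> (u \<epsilon>))" "minimizer k (\<zeta> * \<epsilon>) \<gamma> \<epsilon> (u \<epsilon>) (v \<epsilon>)"
          using hyp \<epsilon>in by blast+
        show "cbar / \<epsilon> \<le> real (card (slice i (phaseI \<epsilon> (u \<epsilon>))))" if "i \<in> {1..4}" for i
          using H \<epsilon>in that unfolding assumption_H_def by blast
        show "j \<in> {1..4}" by (rule j(1))
        show "2 * \<epsilon> * sqrt (real (card (phaseZ \<epsilon> (u \<epsilon>)))) \<le> diag_length \<epsilon> j (phaseI \<epsilon> (u \<epsilon>)) / sqrt 2"
          "\<epsilon> * of_int (8 * M + 4) \<le> diag_length \<epsilon> j (phaseI \<epsilon> (u \<epsilon>)) / sqrt 2"
          using j(2) room by simp_all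
      qed
    qed
  qed
qed

end
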